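(* Let $G$ be a finite irreducible Coxeter group of any type except $F_4$, of rank $n$, realised as a finite reflection group on $\mathbb{R}^n$ with the symmetric group $S_n$ as a standard parabolic subgroup acting by permuting the coordinates. Let $d_1,\dots,d_m$ be the basic invariant degrees of $G$ (so $m=n$). For $j=0,\dots,N-1$ let $n_j = N_j/n!$, where $N_j$ is the number of cones of $G$ that yield the interval $U_j$ of the confidence net based on $G$. Then the generating function $G(q)=\sum_{j=0}^{N-1} n_j q^j$ for the frequency distribution of the intervals of the confidence net is $$G(q)=\frac{\prod_{j=1}^{m}(1-q^{d_j})}{\prod_{i=1}^{n}(1-q^{i})}.$$
   Context: Setting. $G$ acts on $\mathbb{R}^n$ as a finite group generated by orthogonal reflections, with no nonzero vector fixed by all of $G$. The reflecting hyperplanes are $H_a=\{x\in\mathbb{R}^n : a^Tx=0\}$, where $a$ runs over the roots of $G$; roots come in pairs $\pm a$, one pair for each reflecting hyperplane. The cones (chambers) of $G$ are the closures of the connected components of the complement of the union of all the reflecting hyperplanes. There are $|G|$ of them, they are permuted simply transitively by $G$, and one of them, $C_e$, is fixed as the fundamental cone; the simple generators of $G$ are the reflections in the walls of $C_e$. A standard parabolic subgroup is a subgroup generated by a subset of the simple generators. Coordinates on $\mathbb{R}^n$ are orthonormal and chosen so that a standard parabolic subgroup of $G$ isomorphic to $S_n$ (of type $A_{n-1}$) acts by permuting the coordinates; such a parabolic subgroup exists for every finite irreducible type except $F_4$. For instance, $B_n$ is the group of all permutations and sign changes of the coordinates, and $D_n$ is the group of all permutations and even numbers of sign changes. Put $\mathbf{j}=(1,1,\dots,1)^T\in\mathbb{R}^n$,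 which is fixed by $S_n$. The confidence net. The data are $y\in\mathbb{R}^n$, the parameter is $\theta\in\mathbb{R}$, and $z=y-\theta\mathbf{j}$. (The statistical assumption is that the random vector $Z=Y-\theta\mathbf{j}$ lies in each cone with the same probability $1/|G|$, and that intersections of distinct cones have probability zero; then $U_j$ covers $\theta$ with probability $N_j/|G|$.) A reflecting hyperplane is called live if its root is not orthogonal to $\mathbf{j}$. Let $N-1$ be the number of live hyperplanes. For $y$ in general position, the line $\{y-\theta\mathbf{j}:\theta\in\mathbb{R}\}$ meets the live hyperplanes at $N-1$ distinct parameter values $\theta_1(y)<\dots<\theta_{N-1}(y)$, namely the values $a^Ty/a^T\mathbf{j}$ with one root $a$ chosen for each live hyperplane. The intervals of the net are $$U_0=(-\infty,\theta_1(y)],\quad U_j=[\theta_j(y),\theta_{j+1}(y)]\ (1\le j\le N-2),\quad U_{N-1}=[\theta_{N-1}(y),\infty).$$ A cone $C$ yields the interval $U_j$ if, whenever $y-\theta\mathbf{j}$ lies in the interior of $C$, exactly $j$ of the boundary values $a^Ty/a^T\mathbf{j}$ (one for each live hyperplane) are less than $\theta$; the index $j$ depends only on $C$. Thus each cone yields exactly one interval. The basic invariant degrees $d_1,\dots,d_m$ of $G$ are the degrees of a set of algebraically independent homogeneous generators of the ring of $G$-invariant polynomials on $\mathbb{R}^n$. *)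

theory Defs
  imports
    "HOL-Analysis.Analysis"
    "HOL-Computational_Algebra.Formal_Power_Series"
    "HOL-Algebra.Bij"
    "HOL-Algebra.Generated_Groups"
    "HOL-Algebra.Multiplicative_Group"
begin

section \<open>Finite reflection groups\<close>

definition hyp :: "'v::euclidean_space \<Rightarrow> 'v set" where
  "hyp a = {x. a \<bullet> x = 0}"

definition reflection :: "'v::euclidean_space \<Rightarrow> 'v \<Rightarrow> 'v" where
  "reflection a x = x - (2 * (a \<bullet> x) / (a \<bullet> a)) *\<^sub>R a"

text \<open>Groups of transformations are given by their carriers inside \<^term>\<open>BijGroup UNIV\<close>, the
  group of all bijections of the space under composition.\<close>

definition finite_reflection_group :: "('v::euclidean_space \<Rightarrow> 'v) set \<Rightarrow> bool" where
  "finite_reflection_group G \<longleftrightarrow> finite G \<and>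
     (\<exists>R. R \<subseteq> reflection ` (- {0}) \<and> G = generate (BijGroup UNIV) R)"

definition essential :: "('v::euclidean_space \<Rightarrow> 'v) set \<Rightarrow> bool" where
  "essential G \<longleftrightarrow> (\<forall>x. (\<forall>g\<in>G. g x = x) \<longrightarrow> x = 0)"

text \<open>Roots are normalised to unit length, so that there is exactly one pair \<open>a\<close>, \<open>-a\<close> for each
  reflecting hyperplane.  The quotients \<open>(a \<bullet> y) / (a \<bullet> \<j>)\<close> used below do not depend on the
  choice of normalisation or of sign.\<close>

definition roots :: "('v::euclidean_space \<Rightarrow> 'v) set \<Rightarrow> 'v set" where
  "roots G = {a. norm a = 1 \<and> reflection a \<in> G}"

definition hyperplanes :: "('v::euclidean_space \<Rightarrow> 'v) set \<Rightarrow> 'v set set" where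
  "hyperplanes G = hyp ` roots G"

definition cones :: "('v::euclidean_space \<Rightarrow> 'v) set \<Rightarrow> 'v set set" where
  "cones G = closure ` components (- \<Union>(hyperplanes G))"

definition walls :: "('v::euclidean_space \<Rightarrow> 'v) set \<Rightarrow> 'v set \<Rightarrow> 'v set set" where
  "walls G C = {H \<in> hyperplanes G. (C \<inter> H) facet_of C}"

definition simple_generators :: "('v::euclidean_space \<Rightarrow> 'v) set \<Rightarrow> 'v set \<Rightarrow> ('v \<Rightarrow> 'v) set" where
  "simple_generators G C = {reflection a | a. a \<in> roots G \<and> hyp a \<in> walls G C}"

definition standard_parabolic ::
    "('v::euclidean_space \<Rightarrow> 'v) set \<Rightarrow> 'v set \<Rightarrow> ('v \<Rightarrow> 'v) set \<Rightarrow> bool" where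
  "standard_parabolic G C P \<longleftrightarrow>
     (\<exists>J \<subseteq> simple_generators G C. P = generate (BijGroup UNIV) J)"

text \<open>Irreducibility: the Coxeter diagram is connected, i.e.\ the simple generators do not split
  into two nonempty sets that commute with each other.\<close>

definition irreducible_group :: "('v::euclidean_space \<Rightarrow> 'v) set \<Rightarrow> 'v set \<Rightarrow> bool" where
  "irreducible_group G C \<longleftrightarrow> simple_generators G C \<noteq> {} \<and>
     \<not> (\<exists>S T. S \<noteq> {} \<and> T \<noteq> {} \<and> S \<inter> T = {} \<and> S \<union> T = simple_generators G C \<and>
             (\<forall>s\<in>S. \<forall>t\<in>T. s \<circ> t = t \<circ> s))"

text \<open>Type \<open>F\<^sub>4\<close>: the Coxeter diagram is a path on four vertices with labels 3, 4, 3.\<close>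

definition type_F4 :: "('v::euclidean_space \<Rightarrow> 'v) set \<Rightarrow> 'v set \<Rightarrow> bool" where
  "type_F4 G C \<longleftrightarrow>
     (\<exists>s1 s2 s3 s4. distinct [s1, s2, s3, s4] \<and> simple_generators G C = {s1, s2, s3, s4} \<and>
        group.ord (BijGroup UNIV) (s1 \<circ> s2) = 3 \<and>
        group.ord (BijGroup UNIV) (s2 \<circ> s3) = 4 \<and>
        group.ord (BijGroup UNIV) (s3 \<circ> s4) = 3 \<and>
        group.ord (BijGroup UNIV) (s1 \<circ> s3) = 2 \<and>
        group.ord (BijGroup UNIV) (s1 \<circ> s4) = 2 \<and>
        group.ord (BijGroup UNIV) (s2 \<circ> s4) = 2)"

definition coordinate_permutations :: "(real^'n \<Rightarrow> real^'n) set" where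
  "coordinate_permutations = {\<lambda>x. \<chi> i. x $ p i | p. bij p}"


section \<open>Basic invariants and their degrees\<close>

text \<open>Over the reals, polynomials and polynomial functions are the same thing.\<close>

definition invariant_polynomials :: "('v::euclidean_space \<Rightarrow> 'v) set \<Rightarrow> ('v \<Rightarrow> real) set" where
  "invariant_polynomials G = {p. real_polynomial_function p \<and> (\<forall>g\<in>G. p \<circ> g = p)}"

definition homogeneous :: "nat \<Rightarrow> ('v::euclidean_space \<Rightarrow> real) \<Rightarrow> bool" where
  "homogeneous k p \<longleftrightarrow> (\<forall>c x. p (c *\<^sub>R x) = c ^ k * p x)"

text \<open>A family \<open>f\<close> indexed by the finite type \<open>'m\<close> has \<open>m = CARD('m)\<close> members, and polynomials in
  \<open>m\<close> variables are the polynomial functions on \<open>real^'m\<close>.\<close>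

definition algebraically_independent ::
    "('m::finite \<Rightarrow> 'v::euclidean_space \<Rightarrow> real) \<Rightarrow> bool" where
  "algebraically_independent f \<longleftrightarrow>
     (\<forall>P :: real^'m \<Rightarrow> real. real_polynomial_function P \<and> (\<forall>x. P (\<chi> i. f i x) = 0)
        \<longrightarrow> (\<forall>u. P u = 0))"

definition basic_invariants ::
    "('v::euclidean_space \<Rightarrow> 'v) set \<Rightarrow> ('m::finite \<Rightarrow> 'v \<Rightarrow> real) \<Rightarrow> ('m \<Rightarrow> nat) \<Rightarrow> bool" where
  "basic_invariants G f d \<longleftrightarrow>
     (\<forall>i. f i \<in> invariant_polynomials G \<and> homogeneous (d i) (f i)) \<and>
     algebraically_independent f \<and>
     (\<forall>p \<in> invariant_polynomials G. \<exists>P :: real^'m \<Rightarrow> real.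
        real_polynomial_function P \<and> (\<forall>x. p x = P (\<chi> i. f i x)))"


section \<open>The confidence net\<close>

definition all_ones :: "real^'n" ("\<j>") where
  "\<j> = (\<chi> i. 1)"

definition live_hyperplanes :: "(real^'n \<Rightarrow> real^'n) set \<Rightarrow> (real^'n) set set" where
  "live_hyperplanes G = {hyp a | a. a \<in> roots G \<and> a \<bullet> \<j> \<noteq> 0}"

definition num_intervals :: "(real^'n \<Rightarrow> real^'n) set \<Rightarrow> nat" where
  "num_intervals G = card (live_hyperplanes G) + 1"

text \<open>The boundary values are counted once per live hyperplane, by counting hyperplanes rather
  than roots or values.\<close>

definition yields :: "(real^'n \<Rightarrow> real^'n) set \<Rightarrow> (real^'n) set \<Rightarrow> nat \<Rightarrow> bool" where
  "yields G C j \<longleftrightarrow>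
     (\<forall>y \<theta>. y - \<theta> *\<^sub>R \<j> \<in> interior C \<longrightarrow>
        card {H \<in> live_hyperplanes G. \<exists>a \<in> roots G. H = hyp a \<and> (a \<bullet> y) / (a \<bullet> \<j>) < \<theta>} = j)"

definition num_cones :: "(real^'n \<Rightarrow> real^'n) set \<Rightarrow> nat \<Rightarrow> nat" where
  "num_cones G j = card {C \<in> cones G. yields G C j}"

text \<open>The generating function is a polynomial in the indeterminate \<open>q = fps_X\<close>, viewed as a formal
  power series.\<close>

definition net_gen_fun :: "(real^'n \<Rightarrow> real^'n) set \<Rightarrow> real fps" where
  "net_gen_fun G =
     (\<Sum>j = 0..num_intervals G - 1.
        fps_const (real (num_cones G j) / fact CARD('n)) * fps_X ^ j)"

end

theory Submission
  imports Defs "HOL-Library.Function_Algebras"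
begin

text \<open>A cone yields the interval whose index is the number of live hyperplanes that separate it
  from \<open>\<j>\<close>. The cones correspond to the elements of \<open>G\<close>, and factoring through the stabilizer of
  \<open>\<j>\<close>, which is the parabolic subgroup \<open>S\<^sub>n\<close>, shows that the generating function is the quotient of
  the Poincare polynomials of \<open>G\<close> and \<open>S\<^sub>n\<close>. By Solomon's formula the Poincare polynomial \<open>W(q)\<close> of a
  finite reflection group and the Hilbert series \<open>H(q)\<close> of its invariants satisfy
  \<open>W(q) H(q) (1 - q)^n = 1\<close>; the degrees enter through \<open>H(q)\<close>.

  Solomon's formula is proved by induction on the order of the group, from two alternating sums over
  the faces \<open>F\<close> of the arrangement. With \<open>N\<close> the number of hyperplanes and \<open>W\<^sub>F\<close> the pointwise
  stabilizer of \<open>F\<close>, the sum of \<open>(-1)^(dim F) \<Sum>\<^sub>C q^sep(C, F)\<close> over all faces is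
  \<open>(-1)^n \<bar>W\<bar> q^N\<close>, and the sum of \<open>(-1)^(dim F) \<bar>W\<^sub>F\<bar> H\<^sub>F(q)\<close> is \<open>(-1)^n \<bar>W\<bar> q^N H(q)\<close>. Both rest
  on the Euler characteristic of an open convex set; the second also on the fact that the skew
  invariants are the multiples of the product of the positive roots. By the induction hypothesis
  the two summands differ by the factor \<open>W(q) (1 - q)^n\<close> on every face but the smallest, and
  comparing the sums gives the formula.\<close>

section \<open>Reflections and the groups they generate\<close>

text \<open>Nothing provides the stabilizers met in the induction with basic invariants. The
  induction therefore runs on Hilbert series, which exist for every group. Degrees enter only at the
  end: for \<open>G\<close> through the given invariants, for \<open>S_n\<close> through a count of
  monomial symmetric polynomials. A stabilizer keeps acting on the same space, so the factor (1 -
  q)^n is common to all groups of the induction. Faces are summed one by one and not up to the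
  action of the group. This is the origin of the weight |W_F|: the chambers seen from F give the
  series |W_F| W(q) / W_F(q). On the smallest face the group W_F is all of \<open>G\<close>, and the
  induction hypothesis says nothing. There the two summands are, up to the same sign, |G| and |G|
  H(q), and the comparison leaves |G| D(q) (W(q) H(q) (1 - q)^n - 1) = 0, where D(q) is (-1)^n q^N
  minus the sign of the smallest face. D(q) can be cancelled because N > 0 makes its constant term
  nonzero; N = 0 is the trivial group. Chambers are represented throughout by regular points, and
  faces by sign vectors.\<close>

lemma reflection_unit: "norm a = 1 \<Longrightarrow> reflection a x = x - (2 * (a \<bullet> x)) *\<^sub>R a"
  by (simp add: reflection_def dot_square_norm)

lemma linear_reflection: "linear (reflection a)"
  unfolding reflection_def
  by (intro linearI) (auto simp: inner_right_distrib algebra_simps add_divide_distrib)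

lemma reflection_inner_left: "reflection a x \<bullet> y = x \<bullet> y - 2 * (a \<bullet> x) * (a \<bullet> y) / (a \<bullet> a)"
  by (simp add: reflection_def inner_diff_left)

lemma reflection_self_adjoint: "reflection a x \<bullet> y = x \<bullet> reflection a y"
  by (simp add: reflection_def inner_diff_left inner_diff_right inner_commute)

lemma reflection_involution [simp]: "reflection a (reflection a x) = x"
proof (cases "a = 0")
  case False
  then show ?thesis
    by (simp add: reflection_def inner_diff_right algebra_simps flip: scaleR_left_distrib)
qed (simp add: reflection_def)

lemma reflection_comp_self [simp]: "reflection a \<circ> reflection a = id"
  by auto

lemma orthogonal_reflection: "orthogonal_transformation (reflection a)"
  unfolding orthogonal_transformation_def
  by (simp add: linear_reflection reflection_self_adjoint)

lemma reflection_self: "reflection a a = - a"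
  by (cases "a = 0") (auto simp: reflection_def scaleR_2)

lemma reflection_scaleR: "c \<noteq> 0 \<Longrightarrow> reflection (c *\<^sub>R a) = reflection a"
  by (rule ext) (simp add: reflection_def field_simps)

lemma reflection_minus [simp]: "reflection (- a) = reflection a"
  by (rule ext) (simp add: reflection_def)

lemma reflection_fixes_iff: "a \<noteq> 0 \<Longrightarrow> reflection a x = x \<longleftrightarrow> a \<bullet> x = 0"
  by (auto simp: reflection_def)

lemma reflection_eq_iff:
  assumes "norm a = 1" "norm b = 1"
  shows "reflection a = reflection b \<longleftrightarrow> a = b \<or> a = - b"
proof
  assume "reflection a = reflection b"
  then have "reflection b a = - a"
    using reflection_self[of a] by metis
  then have "a - (2 * (b \<bullet> a)) *\<^sub>R b = - a"
    using assms by (simp add: reflection_unit)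
  then have "2 *\<^sub>R a = 2 *\<^sub>R ((b \<bullet> a) *\<^sub>R b)"
    by (simp add: algebra_simps scaleR_2)
  then have *: "a = (b \<bullet> a) *\<^sub>R b"
    using scaleR_cancel_left[of 2 a "(b \<bullet> a) *\<^sub>R b"] by (metis zero_neq_numeral)
  then have "norm a = \<bar>b \<bullet> a\<bar> * norm b"
    by (metis norm_scaleR)
  then have "b \<bullet> a = 1 \<or> b \<bullet> a = -1"
    using assms by auto
  then show "a = b \<or> a = - b"
    using * by (metis scaleR_minus1_left scaleR_one)
qed auto

lemma reflection_conj:
  assumes "orthogonal_transformation g"
  shows "g (reflection a x) = reflection (g a) (g x)"
  using assms
  by (auto simp: reflection_def orthogonal_transformation_def linear_diff linear_cmul)

abbreviation ginv :: "('v \<Rightarrow> 'v) \<Rightarrow> 'v \<Rightarrow> 'v" where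
  "ginv \<equiv> inv_into UNIV"

text \<open>Group elements are handled as explicit words in normal vectors, which allows induction
  on the length of a word; \<open>generate_reflections\<close> translates from the subgroups of
  \<open>BijGroup UNIV\<close>.\<close>

definition refl_prod :: "'v::euclidean_space list \<Rightarrow> 'v \<Rightarrow> 'v" where
  "refl_prod as = foldr (\<lambda>a g. reflection a \<circ> g) as id"

lemma refl_prod_Nil [simp]: "refl_prod [] = id"
  and refl_prod_Cons [simp]: "refl_prod (a # as) = reflection a \<circ> refl_prod as"
  by (simp_all add: refl_prod_def)

lemma refl_prod_append [simp]: "refl_prod (as @ bs) = refl_prod as \<circ> refl_prod bs"
  by (induction as) (auto simp: fun_eq_iff)

lemma orthogonal_refl_prod: "orthogonal_transformation (refl_prod as)"
proof (induction as)
  case Nil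
  then show ?case using orthogonal_transformation_id by (simp add: id_def)
next
  case (Cons a as)
  then show ?case
    using orthogonal_transformation_compose[OF orthogonal_reflection Cons] by (simp only: refl_prod_Cons)
qed

lemma refl_prod_rev: "refl_prod (rev as) \<circ> refl_prod as = id"
  by (induction as) (auto simp: fun_eq_iff)

lemma mem_Bij_UNIV: "f \<in> Bij UNIV \<longleftrightarrow> bij f"
  by (simp add: Bij_def)

lemma bij_refl_prod: "bij (refl_prod as)"
  by (rule orthogonal_transformation_bij[OF orthogonal_refl_prod])

lemma bij_reflection: "bij (reflection a)"
  by (rule orthogonal_transformation_bij[OF orthogonal_reflection])

lemma one_BijGroup_UNIV: "one (BijGroup UNIV) = id"
  by (simp add: BijGroup_def restrict_UNIV id_def)

lemma mult_BijGroup_UNIV: "bij f \<Longrightarrow> bij g \<Longrightarrow> mult (BijGroup UNIV) f g = f \<circ> g"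
  by (simp add: BijGroup_def mem_Bij_UNIV compose_def restrict_UNIV comp_def)

lemma generate_reflections:
  "generate (BijGroup UNIV) (reflection ` A) = refl_prod ` lists A" (is "?L = ?R")
proof
  show "?L \<subseteq> ?R"
  proof
    fix w assume "w \<in> ?L"
    then show "w \<in> ?R"
    proof induction
      case one
      have "refl_prod [] \<in> ?R" by (rule imageI) simp
      then show ?case by (simp only: one_BijGroup_UNIV refl_prod_Nil)
    next
      case (incl h)
      then obtain a where "a \<in> A" "h = reflection a" by auto
      then show ?case by (intro image_eqI[of _ _ "[a]"]) auto
    next
      case (inv h)
      then obtain a where a: "a \<in> A" "h = reflection a" by auto
      have "inv_into UNIV (reflection a) = reflection a"
        by (rule inv_unique_comp) auto
      then have "m_inv (BijGroup UNIV) h = reflection a"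
        using a bij_reflection[of a] by (simp add: inv_BijGroup mem_Bij_UNIV restrict_UNIV)
      then show ?case using a by (intro image_eqI[of _ _ "[a]"]) auto
    next
      case (eng h1 h2)
      then obtain as bs where "as \<in> lists A" "bs \<in> lists A" "h1 = refl_prod as" "h2 = refl_prod bs"
        by auto
      then show ?case
        by (intro image_eqI[of _ _ "as @ bs"])
          (auto simp: mult_BijGroup_UNIV bij_refl_prod)
    qed
  qed
  show "?R \<subseteq> ?L"
  proof (rule image_subsetI)
    fix as assume "as \<in> lists A"
    then show "refl_prod as \<in> ?L"
    proof (induction as)
      case Nil
      show ?case using generate.one[of "BijGroup UNIV"] by (simp only: one_BijGroup_UNIV refl_prod_Nil)
    next
      case (Cons a as)
      have "reflection a \<in> ?L" using Cons by (intro generate.incl) auto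
      from generate.eng[OF this Cons.IH] show ?case
        by (simp only: mult_BijGroup_UNIV bij_refl_prod bij_reflection refl_prod_Cons)
    qed
  qed
qed

lemma finite_reflection_group_iff:
  "finite_reflection_group G \<longleftrightarrow> finite G \<and> (\<exists>A. 0 \<notin> A \<and> G = refl_prod ` lists A)"
proof -
  have "(\<exists>R. R \<subseteq> reflection ` (- {0}) \<and> G = generate (BijGroup UNIV) R) \<longleftrightarrow>
    (\<exists>A. 0 \<notin> A \<and> G = generate (BijGroup UNIV) (reflection ` A))"
    by (auto simp: subset_image_iff)
  then show ?thesis
    by (simp add: finite_reflection_group_def generate_reflections)
qed

lemma roots_norm: "a \<in> roots G \<Longrightarrow> norm a = 1"
  and roots_nz: "a \<in> roots G \<Longrightarrow> a \<noteq> 0"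
  by (auto simp: roots_def)

lemma roots_minus: "a \<in> roots G \<Longrightarrow> - a \<in> roots G"
  by (simp add: roots_def)

lemma finite_roots:
  assumes "finite G"
  shows "finite (roots G)"
proof -
  have "finite {a. norm a = 1 \<and> reflection a = g}" for g :: "'a \<Rightarrow> 'a"
  proof (cases "\<exists>b. norm b = 1 \<and> reflection b = g")
    case True
    then obtain b where "norm b = 1" "reflection b = g" by auto
    then have "{a. norm a = 1 \<and> reflection a = g} \<subseteq> {b, - b}"
      by (auto simp: reflection_eq_iff)
    then show ?thesis by (rule finite_subset) auto
  next
    case False
    then have "{a. norm a = 1 \<and> reflection a = g} = {}" by blast
    then show ?thesis by (simp only: finite.emptyI)
  qed
  then have "finite (\<Union>g\<in>G. {a. norm a = 1 \<and> reflection a = g})"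
    by (intro finite_UN_I assms)
  moreover have "roots G = (\<Union>g\<in>G. {a. norm a = 1 \<and> reflection a = g})"
    by (auto simp: roots_def)
  ultimately show ?thesis by simp
qed

text \<open>Each hyperplane that strictly separates \<open>x\<close> from \<open>y\<close> contributes exactly one of its two unit
  normals to \<open>sep G x y\<close>.\<close>

definition sep :: "('v::euclidean_space \<Rightarrow> 'v) set \<Rightarrow> 'v \<Rightarrow> 'v \<Rightarrow> nat" where
  "sep G x y = card {a \<in> roots G. a \<bullet> x > 0 \<and> a \<bullet> y < 0}"

definition generic :: "'v::euclidean_space set \<Rightarrow> 'v \<Rightarrow> bool" where
  "generic A x \<longleftrightarrow> (\<forall>a\<in>A. a \<bullet> x \<noteq> 0)"

abbreviation regular :: "('v::euclidean_space \<Rightarrow> 'v) set \<Rightarrow> 'v \<Rightarrow> bool" where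
  "regular G \<equiv> generic (roots G)"

definition stab :: "('v \<Rightarrow> 'v) set \<Rightarrow> 'v \<Rightarrow> ('v \<Rightarrow> 'v) set" where
  "stab G x = {g \<in> G. g x = x}"

section \<open>Elementary properties of a finite reflection group\<close>

locale refl_group =
  fixes G :: "('v::euclidean_space \<Rightarrow> 'v) set"
  assumes frg: "finite_reflection_group G"
begin

lemma finite_group: "finite G"
  using frg by (simp add: finite_reflection_group_def)

lemma finite_roots_group: "finite (roots G)"
  by (rule finite_roots[OF finite_group])

text \<open>Rescaling the generating vectors to unit length does not change their reflections and
  turns them into roots; conversely every root contributes a reflection of the group.\<close>

lemma group_eq: "G = refl_prod ` lists (roots G)"
proof -
  obtain A where A: "0 \<notin> A" "G = refl_prod ` lists A"
    using frg by (auto simp: finite_reflection_group_iff)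
  define n where "n a = inverse (norm a) *\<^sub>R a" for a :: 'v
  have n: "reflection (n a) = reflection a" if "a \<in> A" for a
    unfolding n_def by (rule reflection_scaleR) (use that A in auto)
  have nr: "n a \<in> roots G" if "a \<in> A" for a
  proof -
    have "refl_prod [a] \<in> G" unfolding A(2) using that by (intro imageI) auto
    moreover have "norm (n a) = 1" using that A(1) by (auto simp: n_def intro!: left_inverse)
    ultimately show ?thesis using n[OF that] by (simp add: roots_def)
  qed
  have comp: "refl_prod as \<in> G" if "as \<in> lists (roots G)" for as
    using that
  proof (induction as)
    case Nil
    have "refl_prod [] \<in> G" unfolding A(2) by (intro imageI) auto
    then show ?case .
  next
    case (Cons a as)
    then have "reflection a \<in> G" "refl_prod as \<in> G" by (auto simp: roots_def)
    then obtain us vs where "us \<in> lists A" "vs \<in> lists A" "reflection a = refl_prod us" "refl_prod as = refl_prod vs"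
      unfolding A(2) by blast
    then show ?case unfolding A(2) by (intro image_eqI[of _ _ "us @ vs"]) auto
  qed
  have "refl_prod as = refl_prod (map n as)" if "as \<in> lists A" for as
    using that by (induction as) (auto simp: n)
  moreover have "map n as \<in> lists (roots G)" if "as \<in> lists A" for as
    using that nr by auto
  ultimately have "refl_prod ` lists A \<subseteq> refl_prod ` lists (roots G)"
    by (metis image_subsetI image_eqI)
  then show ?thesis using A comp by blast
qed

lemma mem_group_iff: "g \<in> G \<longleftrightarrow> (\<exists>as. set as \<subseteq> roots G \<and> g = refl_prod as)"
proof -
  have "g \<in> G \<longleftrightarrow> g \<in> refl_prod ` lists (roots G)"
    by (rule arg_cong[OF group_eq])
  also have "\<dots> \<longleftrightarrow> (\<exists>as. set as \<subseteq> roots G \<and> g = refl_prod as)"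
    by (auto simp: image_iff in_lists_conv_set subset_iff)
  finally show ?thesis .
qed

lemma id_mem: "id \<in> G"
  unfolding mem_group_iff by (intro exI[of _ "[]"]) simp

lemma comp_mem: "g \<in> G \<Longrightarrow> h \<in> G \<Longrightarrow> g \<circ> h \<in> G"
proof -
  assume "g \<in> G" "h \<in> G"
  then obtain us vs where "set us \<subseteq> roots G" "set vs \<subseteq> roots G" "g = refl_prod us" "h = refl_prod vs"
    by (auto simp: mem_group_iff)
  then show ?thesis
    unfolding mem_group_iff by (intro exI[of _ "us @ vs"]) auto
qed

lemma orthogonal_mem: "g \<in> G \<Longrightarrow> orthogonal_transformation g"
  by (auto simp: mem_group_iff orthogonal_refl_prod)

lemma linear_mem: "g \<in> G \<Longrightarrow> linear g"
  by (simp add: orthogonal_mem orthogonal_transformation_linear)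

lemma inner_mem: "g \<in> G \<Longrightarrow> g x \<bullet> g y = x \<bullet> y"
  using orthogonal_mem by (auto simp: orthogonal_transformation_def)

lemma bij_mem: "g \<in> G \<Longrightarrow> bij g"
  by (simp add: orthogonal_mem orthogonal_transformation_bij)

lemma inv_mem: "g \<in> G \<Longrightarrow> ginv g \<in> G"
proof -
  assume "g \<in> G"
  then obtain as where as: "set as \<subseteq> roots G" "g = refl_prod as"
    by (auto simp: mem_group_iff)
  have "ginv g = refl_prod (rev as)"
    unfolding as by (rule inv_unique_comp) (metis refl_prod_rev rev_rev_ident, rule refl_prod_rev)
  then show ?thesis
    unfolding mem_group_iff using as by (intro exI[of _ "rev as"]) auto
qed

lemma inv_apply [simp]: "g \<in> G \<Longrightarrow> ginv g (g x) = x" "g \<in> G \<Longrightarrow> g (ginv g x) = x"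
  using bij_mem by (auto simp: bij_def surj_f_inv_f)

lemma inner_mem_inv: "g \<in> G \<Longrightarrow> g x \<bullet> y = x \<bullet> ginv g y"
  by (metis inner_mem inv_apply(2))

lemma reflection_mem: "a \<in> roots G \<Longrightarrow> reflection a \<in> G"
  by (simp add: roots_def)

text \<open>Conjugating the reflection in \<open>a\<close> by \<open>g\<close> gives the reflection
  in \<open>g a\<close>.\<close>

lemma root_image: "g \<in> G \<Longrightarrow> a \<in> roots G \<Longrightarrow> g a \<in> roots G"
proof -
  assume g: "g \<in> G" and a: "a \<in> roots G"
  have "reflection (g a) = g \<circ> reflection a \<circ> ginv g"
    using g reflection_conj[OF orthogonal_mem[OF g]] by (auto simp: fun_eq_iff)
  then have "reflection (g a) \<in> G"
    using g a comp_mem inv_mem reflection_mem by simp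
  moreover have "norm (g a) = 1"
    using g a by (metis orthogonal_mem orthogonal_transformation_norm roots_norm)
  ultimately show ?thesis by (simp add: roots_def)
qed

lemma inner_mem_inv': "g \<in> G \<Longrightarrow> a \<bullet> g x = ginv g a \<bullet> x"
  using inner_mem_inv[of g x a] by (simp add: inner_commute)

lemma sep_mem: "g \<in> G \<Longrightarrow> sep G (g x) (g y) = sep G x y"
  unfolding sep_def
  by (rule bij_betw_same_card[of "ginv g"], rule bij_betw_byWitness[of _ g])
    (auto simp: inner_mem_inv' intro: root_image inv_mem)

lemma generic_mem: "g \<in> G \<Longrightarrow> regular G (g x) \<longleftrightarrow> regular G x"
  unfolding generic_def by (metis inner_mem_inv' inv_apply(1) inv_mem root_image)

lemma group_induct [consumes 1, case_names id refl]:
  assumes "g \<in> G" "P id" "\<And>a h. a \<in> roots G \<Longrightarrow> h \<in> G \<Longrightarrow> P h \<Longrightarrow> P (reflection a \<circ> h)"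
  shows "P g"
proof -
  obtain as where "set as \<subseteq> roots G" "g = refl_prod as"
    using assms(1) by (auto simp: mem_group_iff)
  then show ?thesis
  proof (induction as arbitrary: g)
    case (Cons a as)
    then have a: "a \<in> roots G" and "set as \<subseteq> roots G" by simp_all
    then have "refl_prod as \<in> G" "P (refl_prod as)"
      by (blast intro: mem_group_iff[THEN iffD2], intro Cons.IH refl)
    then have "P (reflection a \<circ> refl_prod as)"
      by (rule assms(3)[OF a])
    then show ?case using Cons.prems by (simp only: refl_prod_Cons)
  qed (use assms in simp)
qed

end

subsection \<open>Generic points\<close>

lemma generic_near:
  fixes A :: "'v::euclidean_space set"
  assumes "finite A" "open U" "x \<in> U" "0 \<notin> A"
  shows "\<exists>y\<in>U. generic A y"
proof -
  have "negligible (\<Union>a\<in>A. {x. a \<bullet> x = 0})"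
    using assms by (intro negligible_Union) (auto intro!: negligible_hyperplane)
  then have "\<not> U \<subseteq> (\<Union>a\<in>A. {x. a \<bullet> x = 0})"
    using assms open_not_negligible negligible_subset by blast
  then show ?thesis by (auto simp: generic_def)
qed

text \<open>A real vector space is not a finite union of proper subspaces. If \<open>a\<close> does
  not vanish on \<open>V\<close>, moving the point along a \<open>v\<close> with nonzero
  \<open>a\<close>-value repairs \<open>a\<close>, and only finitely many step lengths
  \<open>t\<close> spoil something.\<close>

lemma subspace_generic_point:
  fixes A :: "'v::euclidean_space set"
  assumes "finite A" "subspace V"
  shows "\<exists>x\<in>V. \<forall>a\<in>A. a \<bullet> x = 0 \<longrightarrow> (\<forall>v\<in>V. a \<bullet> v = 0)"
  using assms(1)
proof (induction A rule: finite_induct)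
  case empty
  then show ?case using subspace_0[OF assms(2)] by auto
next
  case (insert a A)
  then obtain x where x: "x \<in> V" "\<And>b v. b \<in> A \<Longrightarrow> b \<bullet> x = 0 \<Longrightarrow> v \<in> V \<Longrightarrow> b \<bullet> v = 0" by blast
  show ?case
  proof (cases "\<forall>v\<in>V. a \<bullet> v = 0")
    case True
    then show ?thesis using x by blast
  next
    case False
    then obtain v where v: "v \<in> V" "a \<bullet> v \<noteq> 0" by blast
    have "finite ((\<lambda>b. - (b \<bullet> x) / (b \<bullet> v)) ` insert a A)" using insert.hyps by simp
    then obtain t where t: "t \<notin> (\<lambda>b. - (b \<bullet> x) / (b \<bullet> v)) ` insert a A"
      using ex_new_if_finite infinite_UNIV_char_0 by blast
    have *: "b \<bullet> (x + t *\<^sub>R v) \<noteq> 0" if "b \<in> insert a A" "b \<bullet> v \<noteq> 0" for b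
    proof
      assume "b \<bullet> (x + t *\<^sub>R v) = 0"
      then have "t = - (b \<bullet> x) / (b \<bullet> v)" using that(2) by (simp add: inner_add_right field_simps eq_neg_iff_add_eq_0)
      then show False using t that(1) by blast
    qed
    have "x + t *\<^sub>R v \<in> V" using x v assms(2) by (simp add: subspace_add subspace_scale)
    moreover have "\<forall>u\<in>V. b \<bullet> u = 0" if b: "b \<in> insert a A" "b \<bullet> (x + t *\<^sub>R v) = 0" for b
    proof -
      have "b \<bullet> v = 0" using * b by blast
      then have "b \<in> A" "b \<bullet> x = 0" using b v by (auto simp: inner_add_right)
      then show ?thesis using x by blast
    qed
    ultimately show ?thesis by blast
  qed
qed

lemma generic_on_hyperplane:
  fixes A :: "'v::euclidean_space set"
  assumes "finite A" "\<And>a. a \<in> A \<Longrightarrow> norm a = 1" "norm b = 1"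
  obtains x where "b \<bullet> x = 0" "\<And>a. a \<in> A \<Longrightarrow> a \<noteq> b \<Longrightarrow> a \<noteq> - b \<Longrightarrow> a \<bullet> x \<noteq> 0"
proof -
  obtain x where x: "b \<bullet> x = 0" "\<And>a v. a \<in> A \<Longrightarrow> a \<bullet> x = 0 \<Longrightarrow> b \<bullet> v = 0 \<Longrightarrow> a \<bullet> v = 0"
    using subspace_generic_point[OF assms(1) subspace_hyperplane[of b]] by auto
  have "a = b \<or> a = - b" if a: "a \<in> A" "a \<bullet> x = 0" for a
  proof -
    \<comment> \<open>The component of \<open>a\<close> orthogonal to \<open>b\<close> lies in the
      hyperplane of \<open>b\<close>, so \<open>a\<close> kills it; hence it is zero and
      \<open>a\<close> is a multiple of \<open>b\<close>.\<close>
    let ?v = "a - (b \<bullet> a) *\<^sub>R b"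
    have bv: "b \<bullet> ?v = 0" using assms(3) by (simp add: inner_diff_right dot_square_norm)
    then have "?v \<bullet> ?v = 0" using x(2)[OF a bv] by (simp add: inner_diff_left)
    then have *: "a = (b \<bullet> a) *\<^sub>R b" by simp
    then have "norm a = \<bar>b \<bullet> a\<bar> * norm b" by (metis norm_scaleR)
    then have "b \<bullet> a = 1 \<or> b \<bullet> a = -1" using assms a by auto
    then show ?thesis using * by (metis scaleR_minus1_left scaleR_one)
  qed
  then show ?thesis using that x by blast
qed

subsection \<open>Simple roots\<close>

text \<open>Simple roots are described by geometry instead of indecomposability: \<open>z\<close> is
  a point of the wall of \<open>a\<close> that lies strictly inside all other positive half-spaces.
  This witness replaces arguments with a basis of simple roots.\<close>

definition simple :: "('v::euclidean_space \<Rightarrow> 'v) set \<Rightarrow> 'v \<Rightarrow> 'v set" where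
  "simple G c = {a \<in> roots G. a \<bullet> c > 0 \<and>
     (\<exists>z. a \<bullet> z = 0 \<and> (\<forall>b\<in>roots G. b \<bullet> c > 0 \<longrightarrow> b \<noteq> a \<longrightarrow> b \<bullet> z > 0))}"

lemma finite_max_ex:
  fixes f :: "'a \<Rightarrow> real"
  assumes "finite X" "X \<noteq> {}"
  obtains x where "x \<in> X" "\<And>y. y \<in> X \<Longrightarrow> f y \<le> f x"
proof -
  have "Max (f ` X) \<in> f ` X" using assms by (intro Max_in) auto
  then obtain x where "x \<in> X" "f x = Max (f ` X)" by auto
  moreover have "f y \<le> Max (f ` X)" if "y \<in> X" for y
    using assms that by (intro Max_ge) auto
  ultimately show ?thesis using that by metis
qed

text \<open>Among the finitely many images of \<open>y\<close> one takes an image with the largest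
  inner product with \<open>c\<close>; a negative value of \<open>a\<close> on it could be improved
  by one more reflection. With all simple roots for \<open>S\<close> this leads into the closed
  chamber of \<open>c\<close>; with those vanishing at \<open>x\<close> the words stay in the
  stabilizer of \<open>x\<close>.\<close>

lemma refl_prod_inner_max:
  assumes "finite (refl_prod ` lists S)"
  obtains as where "set as \<subseteq> S" "\<And>a. a \<in> S \<Longrightarrow> a \<bullet> c > 0 \<Longrightarrow> a \<bullet> refl_prod as y \<ge> 0"
proof -
  have "refl_prod ` lists S \<noteq> {}" by auto
  then obtain w where w: "w \<in> refl_prod ` lists S" "\<And>u. u \<in> refl_prod ` lists S \<Longrightarrow> u y \<bullet> c \<le> w y \<bullet> c"
    using finite_max_ex[OF assms, of "\<lambda>w. w y \<bullet> c"] by blast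
  then obtain as where as: "set as \<subseteq> S" "w = refl_prod as" by auto
  have "a \<bullet> refl_prod as y \<ge> 0" if a: "a \<in> S" "a \<bullet> c > 0" for a
  proof -
    have "refl_prod (a # as) \<in> refl_prod ` lists S"
      using as a by (intro imageI) auto
    then have "refl_prod (a # as) y \<bullet> c \<le> refl_prod as y \<bullet> c"
      using w(2)[of "refl_prod (a # as)"] unfolding as(2) by blast
    then have "2 * (a \<bullet> refl_prod as y) * (a \<bullet> c) / (a \<bullet> a) \<ge> 0"
      by (simp add: reflection_inner_left)
    moreover have "a \<bullet> a > 0" using a by (auto simp: inner_gt_zero_iff)
    ultimately show ?thesis
      using a by (auto simp: zero_le_divide_iff zero_le_mult_iff)
  qed
  then show ?thesis using that as by blast
qed

section \<open>Simple roots, words, and the action on chambers\<close>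

context refl_group
begin

lemma roots_antipodal:
  assumes "a \<in> roots G" "b \<in> roots G" "a = k *\<^sub>R b" "a \<bullet> c > 0" "b \<bullet> c > 0"
  shows "a = b"
proof -
  have "\<bar>k\<bar> = 1" using assms roots_norm by (metis norm_scaleR mult.right_neutral)
  moreover have "k > 0" using assms by (simp add: zero_less_mult_iff)
  ultimately show ?thesis using assms by auto
qed

text \<open>The reflection in \<open>a\<close> fixes the wall point \<open>z\<close>, so the image
  of \<open>b\<close> has the same positive value at \<open>z\<close> as \<open>b\<close>. If the
  image were negative at \<open>c\<close>, its negative would be a positive root other than
  \<open>a\<close> and would also be positive at \<open>z\<close>.\<close>

lemma simple_reflection_pos:
  assumes c: "regular G c" and a: "a \<in> simple G c"
    and b: "b \<in> roots G" "b \<bullet> c > 0" "b \<noteq> a"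
  shows "reflection a b \<bullet> c > 0"
proof (rule ccontr)
  assume *: "\<not> reflection a b \<bullet> c > 0"
  from a obtain z where z: "a \<in> roots G" "a \<bullet> z = 0" "\<And>b. b \<in> roots G \<Longrightarrow> b \<bullet> c > 0 \<Longrightarrow> b \<noteq> a \<Longrightarrow> b \<bullet> z > 0"
    by (auto simp: simple_def)
  have r: "reflection a b \<in> roots G" using z b root_image reflection_mem by blast
  then have "- reflection a b \<bullet> c > 0" using c * by (force simp: generic_def)
  moreover have "- reflection a b \<noteq> a"
  proof
    assume "- reflection a b = a"
    then have "reflection a b = - a" by (metis add.inverse_inverse)
    then have "b = reflection a (- a)" by (metis reflection_involution)
    also have "\<dots> = a" by (metis reflection_involution reflection_self)
    finally show False using b by simp
  qed
  ultimately have "- reflection a b \<bullet> z > 0" using z r roots_minus by blast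
  moreover have "reflection a b \<bullet> z = b \<bullet> z"
    using z by (simp add: reflection_inner_left)
  ultimately show False using z(3)[OF b] by simp
qed

text \<open>If \<open>a\<close> and \<open>b\<close> had positive inner product, the reflection in
  \<open>a\<close> would send \<open>b\<close> to another positive root, whose value at the wall
  point of \<open>b\<close> is -2 (a . b) (a . z) < 0.\<close>

lemma simple_obtuse:
  assumes c: "regular G c" and a: "a \<in> simple G c" and b: "b \<in> simple G c"
    and "a \<noteq> b"
  shows "a \<bullet> b \<le> 0"
proof (rule ccontr)
  assume *: "\<not> a \<bullet> b \<le> 0"
  have ar: "a \<in> roots G" "a \<bullet> c > 0" and br: "b \<in> roots G" "b \<bullet> c > 0"
    using a b by (auto simp: simple_def)
  obtain z where z: "b \<bullet> z = 0" "\<And>d. d \<in> roots G \<Longrightarrow> d \<bullet> c > 0 \<Longrightarrow> d \<noteq> b \<Longrightarrow> d \<bullet> z > 0"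
    using b by (auto simp: simple_def)
  let ?b = "reflection a b"
  have "?b \<in> roots G" "?b \<bullet> c > 0"
    using root_image[OF reflection_mem] ar br simple_reflection_pos[OF c a] assms(4) by auto
  moreover have "?b \<noteq> b"
    using * roots_nz[OF ar(1)] by (simp add: reflection_fixes_iff)
  ultimately have "?b \<bullet> z > 0" using z by blast
  moreover have "?b \<bullet> z = - (2 * (a \<bullet> b) * (a \<bullet> z))"
    using roots_norm[OF ar(1)] by (simp add: reflection_inner_left z dot_square_norm)
  moreover have "a \<bullet> z > 0" using z ar assms(4) by blast
  ultimately show False using * by (simp add: zero_less_mult_iff mult_less_0_iff)
qed

text \<open>A straight path that leaves the chamber of \<open>c\<close> and starts at a point in general position
  crosses its first hyperplane away from all others, hence through a wall.\<close>

lemma crossing_simple: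
  assumes c: "regular G c" and y: "regular G y"
    and b0: "b0 \<in> roots G" "b0 \<bullet> c > 0" "b0 \<bullet> y < 0"
  shows "\<exists>a\<in>simple G c. a \<bullet> y < 0"
proof -
  define B where "B = {b \<in> roots G. b \<bullet> c > 0}"
  define B0 where "B0 = {b \<in> B. b \<bullet> y < 0}"
  \<comment> \<open>If \<open>c'\<close> is off all hyperplanes with normals in \<open>D\<close>,
    the ray from \<open>c'\<close> in direction \<open>y\<close> meets different root hyperplanes at
    different times.\<close>
  define D where "D = (\<lambda>(b, d). (d \<bullet> y) *\<^sub>R b - (b \<bullet> y) *\<^sub>R d) ` {(b, d) \<in> B \<times> B. b \<noteq> d}"
  have finB: "finite B" using finite_roots_group by (simp add: B_def)
  then have "finite {(b, d) \<in> B \<times> B. b \<noteq> d}"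
    by (auto intro: finite_subset[of _ "B \<times> B"])
  then have "finite D" unfolding D_def by (rule finite_imageI)
  moreover have "0 \<notin> D"
  proof
    assume "0 \<in> D"
    then obtain b d where bd: "b \<in> B" "d \<in> B" "b \<noteq> d" "(d \<bullet> y) *\<^sub>R b = (b \<bullet> y) *\<^sub>R d"
      by (auto simp: D_def)
    have "d \<bullet> y \<noteq> 0" using bd y by (auto simp: generic_def B_def)
    have "inverse (d \<bullet> y) *\<^sub>R (d \<bullet> y) *\<^sub>R b = inverse (d \<bullet> y) *\<^sub>R (b \<bullet> y) *\<^sub>R d"
      using bd(4) by simp
    then have "b = (inverse (d \<bullet> y) * (b \<bullet> y)) *\<^sub>R d"
      using \<open>d \<bullet> y \<noteq> 0\<close> by simp
    moreover have "b \<in> roots G" "d \<in> roots G" "b \<bullet> c > 0" "d \<bullet> c > 0"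
      using bd by (auto simp: B_def)
    ultimately show False using roots_antipodal[of b d _ c] bd(3) by blast
  qed
  moreover have "open (\<Inter>b\<in>B. {x. b \<bullet> x > 0})"
    using finB by (intro open_INT) (auto simp: open_halfspace_gt)
  moreover have "c \<in> (\<Inter>b\<in>B. {x. b \<bullet> x > 0})" by (auto simp: B_def)
  ultimately have "\<exists>x\<in>\<Inter>b\<in>B. {x. b \<bullet> x > 0}. generic D x"
    by (intro generic_near) auto
  then obtain c' where c': "\<And>b. b \<in> B \<Longrightarrow> b \<bullet> c' > 0" "generic D c'"
    by auto
  \<comment> \<open>The parameter at which \<open>c' + t y\<close> crosses the hyperplane of
    \<open>b\<close>.\<close>
  define r where "r b = (b \<bullet> c') / - (b \<bullet> y)" for b
  have "b0 \<in> B0" using b0 by (auto simp: B0_def B_def)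
  moreover have "finite B0" unfolding B0_def using finB by (rule finite_subset[rotated]) auto
  ultimately obtain b1 where b1: "b1 \<in> B0" "\<And>b. b \<in> B0 \<Longrightarrow> r b1 \<le> r b"
    using finite_max_ex[of B0 "\<lambda>b. - r b"] by (metis empty_iff neg_le_iff_le)
  define z where "z = c' + r b1 *\<^sub>R y"
  have b1': "b1 \<in> B" "b1 \<bullet> y < 0" using b1 by (auto simp: B0_def)
  have r0: "r b1 > 0" using b1' c' by (auto simp: r_def divide_pos_neg)
  have "b1 \<bullet> z = 0" using b1' by (simp add: z_def r_def inner_add_right inner_diff_right)
  moreover have "b \<bullet> z > 0" if b: "b \<in> B" "b \<noteq> b1" for b
  proof (cases "b \<bullet> y < 0")
    case False
    then show ?thesis using c'(1)[OF b(1)] r0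
      by (simp add: z_def inner_add_right add_pos_nonneg)
  next
    case True
    then have "r b1 \<le> r b" using b b1 by (auto simp: B0_def)
    moreover have "r b1 \<noteq> r b"
    proof
      assume "r b1 = r b"
      then have "(b1 \<bullet> y) * (b \<bullet> c') = (b \<bullet> y) * (b1 \<bullet> c')"
        using True b1' by (simp add: r_def frac_eq_eq mult.commute)
      then have "((b1 \<bullet> y) *\<^sub>R b - (b \<bullet> y) *\<^sub>R b1) \<bullet> c' = 0"
        by (simp add: inner_diff_left)
      moreover have "(b1 \<bullet> y) *\<^sub>R b - (b \<bullet> y) *\<^sub>R b1 \<in> D"
        unfolding D_def using b b1' by (intro image_eqI[of _ _ "(b, b1)"]) auto
      ultimately show False using c'(2) by (auto simp: generic_def)
    qed
    ultimately have "r b1 < r b" by simp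
    then have "r b1 * - (b \<bullet> y) < r b * - (b \<bullet> y)"
      using True by (intro mult_strict_right_mono) auto
    then show ?thesis using True by (simp add: z_def inner_add_right inner_diff_right r_def)
  qed
  ultimately have "b1 \<in> simple G c"
    using b1' by (auto simp: simple_def B_def)
  then show ?thesis using b1' by blast
qed

text \<open>Otherwise \<open>y\<close> could be perturbed to a regular point that is still positive
  on all simple roots but negative on \<open>b\<close>, contradicting
  \<open>crossing_simple\<close>.\<close>

lemma simple_pos_imp_pos:
  assumes c: "regular G c" and y: "\<And>a. a \<in> simple G c \<Longrightarrow> a \<bullet> y > 0"
    and b: "b \<in> roots G" "b \<bullet> c > 0"
  shows "b \<bullet> y > 0"
proof (rule ccontr)
  assume *: "\<not> b \<bullet> y > 0"
  define U where "U = (\<Inter>a\<in>simple G c. {x. a \<bullet> x > 0})"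
  have "simple G c \<subseteq> roots G" by (auto simp: simple_def)
  then have "finite (simple G c)" using finite_roots_group finite_subset by blast
  then have "open U" unfolding U_def by (intro open_INT) (auto simp: open_halfspace_gt)
  moreover have "y \<in> U" using y by (simp add: U_def)
  ultimately obtain e where e: "e > 0" "ball y e \<subseteq> U" using open_contains_ball by blast
  \<comment> \<open>Only b . y <= 0 is known, so a small step against \<open>b\<close> is taken to
    make the value strictly negative.\<close>
  let ?y = "y - (e / 2) *\<^sub>R b"
  have "?y \<in> ball y e" using e roots_norm[OF b(1)] by (simp add: dist_norm)
  then have "?y \<in> U \<inter> {x. b \<bullet> x < 0}"
    using e * roots_norm[OF b(1)] by (auto simp: inner_diff_right dot_square_norm)
  moreover have "open (U \<inter> {x. b \<bullet> x < 0})" using \<open>open U\<close> by (intro open_Int open_halfspace_lt)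
  moreover have "0 \<notin> roots G" using roots_nz by blast
  ultimately obtain y' where "y' \<in> U" "b \<bullet> y' < 0" "regular G y'"
    using generic_near[OF finite_roots_group] by blast
  then show False
    using crossing_simple[OF c _ b, of y'] by (force simp: U_def)
qed

lemma simple_nonneg_imp_nonneg:
  assumes c: "regular G c" and y: "\<And>a. a \<in> simple G c \<Longrightarrow> a \<bullet> y \<ge> 0"
    and b: "b \<in> roots G" "b \<bullet> c > 0"
  shows "b \<bullet> y \<ge> 0"
proof (rule ccontr)
  assume *: "\<not> b \<bullet> y \<ge> 0"
  \<comment> \<open>With this amount of \<open>c\<close> added, \<open>b\<close> vanishes exactly
    while all simple roots become strictly positive.\<close>
  define e where "e = - (b \<bullet> y) / (b \<bullet> c)"
  have "e > 0" using * b by (simp add: e_def divide_neg_pos)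
  then have "a \<bullet> (y + e *\<^sub>R c) > 0" if "a \<in> simple G c" for a
    using y[OF that] that by (auto simp: simple_def inner_add_right intro!: add_nonneg_pos)
  from simple_pos_imp_pos[OF c this b] show False
    using b by (simp add: e_def inner_add_right inner_diff_right)
qed

lemma simple_subset: "simple G c \<subseteq> roots G"
  by (auto simp: simple_def)

lemma refl_prod_mem: "set as \<subseteq> roots G \<Longrightarrow> refl_prod as \<in> G"
  by (auto simp: mem_group_iff)

lemma finite_refl_prod: "S \<subseteq> roots G \<Longrightarrow> finite (refl_prod ` lists S)"
  by (rule finite_subset[OF _ finite_group]) (auto intro!: refl_prod_mem)

lemma simple_dominant:
  assumes "regular G c"
  obtains as where "set as \<subseteq> simple G c"
    "\<And>b. b \<in> roots G \<Longrightarrow> b \<bullet> c > 0 \<Longrightarrow> b \<bullet> refl_prod as y \<ge> 0"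
proof -
  obtain as where as: "set as \<subseteq> simple G c"
    "\<And>a. a \<in> simple G c \<Longrightarrow> a \<bullet> c > 0 \<Longrightarrow> a \<bullet> refl_prod as y \<ge> 0"
    using refl_prod_inner_max[OF finite_refl_prod[OF simple_subset]] by metis
  have "a \<bullet> refl_prod as y \<ge> 0" if "a \<in> simple G c" for a
    by (rule as(2)[OF that]) (use that in \<open>simp add: simple_def\<close>)
  from simple_nonneg_imp_nonneg[OF assms this] show ?thesis using that as(1) by blast
qed

text \<open>A discrete intermediate value argument: \<open>a\<close> starts positive and ends
  negative, so some letter of the word turns it around.\<close>

lemma refl_prod_first_neg:
  assumes "a \<bullet> c > 0" "\<not> refl_prod bs a \<bullet> c > 0"
  shows "\<exists>us b vs. bs = us @ b # vs \<and> refl_prod vs a \<bullet> c > 0 \<and> \<not> reflection b (refl_prod vs a) \<bullet> c > 0"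
  using assms(2)
proof (induction bs)
  case Nil
  then show ?case using assms(1) by simp
next
  case (Cons b bs)
  show ?case
  proof (cases "refl_prod bs a \<bullet> c > 0")
    case True
    then show ?thesis using Cons.prems by (intro exI[of _ "[]"] exI[of _ b] exI[of _ bs]) simp
  next
    case False
    then obtain us b' vs where "bs = us @ b' # vs" "refl_prod vs a \<bullet> c > 0" "\<not> reflection b' (refl_prod vs a) \<bullet> c > 0"
      using Cons.IH by blast
    then show ?thesis by (intro exI[of _ "b # us"] exI[of _ b'] exI[of _ vs]) simp
  qed
qed

text \<open>The deletion argument: a word in simple reflections that keeps all positive roots positive
  can be shortened by two letters.\<close>

lemma simple_word_trivial:
  assumes c: "regular G c"
  shows "set as \<subseteq> simple G c \<Longrightarrow> (\<And>b. b \<in> roots G \<Longrightarrow> b \<bullet> c > 0 \<Longrightarrow> refl_prod as b \<bullet> c > 0) \<Longrightarrow>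
    refl_prod as = id"
proof (induction "length as" arbitrary: as rule: less_induct)
  case less
  show ?case
  proof (cases as rule: rev_cases)
    case (snoc bs a)
    have a: "a \<in> simple G c" "a \<in> roots G" "a \<bullet> c > 0" and bs: "set bs \<subseteq> simple G c"
      using less.prems(1) snoc by (auto simp: simple_def)
    \<comment> \<open>The last letter negates its own root, so the remaining word \<open>bs\<close>
      must carry \<open>a\<close> to a negative root.\<close>
    have "refl_prod as a = - refl_prod bs a"
      using orthogonal_refl_prod[of bs]
      by (simp add: snoc reflection_self linear_neg orthogonal_transformation_linear)
    moreover have "refl_prod as a \<bullet> c > 0" using less.prems(2) a by blast
    ultimately have "\<not> refl_prod bs a \<bullet> c > 0" by simp
    then obtain us b vs where bv: "bs = us @ b # vs" "refl_prod vs a \<bullet> c > 0" "\<not> reflection b (refl_prod vs a) \<bullet> c > 0"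
      using refl_prod_first_neg[of a c bs] a by blast
    have b: "b \<in> simple G c" and vs: "set vs \<subseteq> roots G" using bs bv simple_subset by auto
    have "refl_prod vs a \<in> roots G" using a vs root_image refl_prod_mem by blast
    \<comment> \<open>A simple reflection turns only its own root negative.\<close>
    then have eq: "refl_prod vs a = b"
      using simple_reflection_pos[OF c b] bv by blast
    \<comment> \<open>Since \<open>vs\<close> carries \<open>a\<close> to \<open>b\<close>, it
      conjugates the reflection in \<open>a\<close> to that in \<open>b\<close>, and the two letters
      cancel.\<close>
    have "reflection b (refl_prod vs (reflection a x)) = refl_prod vs x" for x
      using reflection_conj[OF orthogonal_refl_prod, of vs a x] by (simp add: eq)
    then have *: "refl_prod as = refl_prod (us @ vs)"
      by (simp add: snoc bv fun_eq_iff)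
    have "refl_prod (us @ vs) = id"
    proof (rule less.hyps)
      show "length (us @ vs) < length as" by (simp add: snoc bv)
      show "set (us @ vs) \<subseteq> simple G c" using bs bv by auto
      show "refl_prod (us @ vs) b \<bullet> c > 0" if "b \<in> roots G" "b \<bullet> c > 0" for b
        using less.prems(2)[OF that] unfolding * .
    qed
    with * show ?thesis by simp
  qed simp
qed

lemma refl_prod_inverse:
  "refl_prod (rev as) (refl_prod as x) = x" "refl_prod as (refl_prod (rev as) x) = x"
  using fun_cong[OF refl_prod_rev[of as], of x] fun_cong[OF refl_prod_rev[of "rev as"], of x] by simp_all

text \<open>A point \<open>x\<close> lying on the hyperplane of \<open>b\<close> and on no other is
  moved by a simple word \<open>w\<close> into the closed chamber of \<open>c\<close>. Its image
  lies on exactly one hyperplane, which is therefore a wall: \<open>w b\<close> is a simple root up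
  to sign, and the reflection in \<open>b\<close> is conjugate to a simple reflection.\<close>

lemma reflection_simple_word:
  assumes c: "regular G c" and b: "b \<in> roots G"
  obtains as where "set as \<subseteq> simple G c" "reflection b = refl_prod as"
proof -
  obtain x where bx: "b \<bullet> x = 0" and dx: "\<And>d. d \<in> roots G \<Longrightarrow> d \<noteq> b \<Longrightarrow> d \<noteq> - b \<Longrightarrow> d \<bullet> x \<noteq> 0"
    by (rule generic_on_hyperplane[OF finite_roots_group roots_norm roots_norm[OF b]]) (assumption, rule that)
  obtain us where us: "set us \<subseteq> simple G c"
    "\<And>b. b \<in> roots G \<Longrightarrow> b \<bullet> c > 0 \<Longrightarrow> b \<bullet> refl_prod us x \<ge> 0"
    using simple_dominant[OF c] by blast
  define w where "w = refl_prod us"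
  have wG: "w \<in> G" unfolding w_def using us simple_subset by (intro refl_prod_mem) auto
  define a where "a = (if w b \<bullet> c > 0 then w b else - w b)"
  have wb: "w b \<in> roots G" using wG b root_image by blast
  then have a: "a \<in> roots G" "a \<bullet> c > 0"
    using c roots_minus by (auto simp: a_def generic_def)
  have "a \<bullet> w x = 0" using bx wG inner_mem by (auto simp: a_def)
  moreover have "d \<bullet> w x > 0" if d: "d \<in> roots G" "d \<bullet> c > 0" "d \<noteq> a" for d
  proof -
    have "d \<noteq> - a" using d a by auto
    then have "d \<noteq> w b" "d \<noteq> - w b" using d by (auto simp: a_def split: if_splits)
    then have "ginv w d \<noteq> b" "ginv w d \<noteq> - b"
      using wG by (metis inv_apply(2), metis inv_apply(2) linear_mem linear_neg)
    moreover have "ginv w d \<in> roots G" using d wG inv_mem root_image by blast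
    ultimately have "ginv w d \<bullet> x \<noteq> 0" using dx by blast
    then have "d \<bullet> w x \<noteq> 0" using inner_mem_inv'[OF wG] by simp
    with us(2)[OF d(1,2)] show ?thesis by (simp add: w_def)
  qed
  ultimately have aS: "a \<in> simple G c" using a by (auto simp: simple_def)
  have ra: "reflection (w b) = reflection a" by (simp add: a_def)
  have "reflection b x = refl_prod (rev us @ [a] @ us) x" for x
    using reflection_conj[OF orthogonal_refl_prod, of us b x] refl_prod_inverse(1)[of us "reflection b x"] ra
    by (simp add: w_def flip: ra)
  then have "reflection b = refl_prod (rev us @ [a] @ us)" by blast
  then show ?thesis using that[of "rev us @ [a] @ us"] us aS by auto
qed

lemma simple_generate:
  assumes c: "regular G c" and "g \<in> G"
  obtains as where "set as \<subseteq> simple G c" "g = refl_prod as"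
proof -
  have "\<exists>as. set as \<subseteq> simple G c \<and> g = refl_prod as"
    using assms(2)
  proof (induction rule: group_induct)
    case id
    show ?case by (intro exI[of _ "[]"]) simp
  next
    case (refl a h)
    then obtain as where "set as \<subseteq> simple G c" "h = refl_prod as" by blast
    moreover obtain bs where "set bs \<subseteq> simple G c" "reflection a = refl_prod bs"
      using reflection_simple_word[OF c refl(1)] by blast
    ultimately show ?case by (intro exI[of _ "bs @ as"]) (simp add: fun_eq_iff)
  qed
  then show ?thesis using that by blast
qed

text \<open>The inverse of \<open>g\<close> keeps positive roots positive, because its value on
  \<open>b\<close> at \<open>c\<close> is b . g c; \<open>simple_word_trivial\<close> applies to a
  simple word for this inverse.\<close>

lemma chamber_free:
  assumes c: "regular G c" and g: "g \<in> G"
    and pos: "\<And>b. b \<in> roots G \<Longrightarrow> b \<bullet> c > 0 \<Longrightarrow> b \<bullet> g c > 0"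
  shows "g = id"
proof -
  obtain as where as: "set as \<subseteq> simple G c" "ginv g = refl_prod as"
    using simple_generate[OF c inv_mem[OF g]] .
  have "refl_prod as b \<bullet> c > 0" if "b \<in> roots G" "b \<bullet> c > 0" for b
    using pos[OF that] inner_mem_inv[OF inv_mem[OF g], of b c] g
    by (simp add: as(2)[symmetric] inv_inv_eq[OF bij_mem])
  from simple_word_trivial[OF c as(1) this] have "ginv g = id" using as by simp
  then show "g = id" using g by (metis bij_mem inv_id inv_inv_eq)
qed

lemma chamber_transitive:
  assumes c: "regular G c" and y: "regular G y"
  obtains g where "g \<in> G" "\<And>b. b \<in> roots G \<Longrightarrow> b \<bullet> c > 0 \<Longrightarrow> b \<bullet> g y > 0"
proof -
  obtain as where as: "set as \<subseteq> simple G c"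
    "\<And>b. b \<in> roots G \<Longrightarrow> b \<bullet> c > 0 \<Longrightarrow> b \<bullet> refl_prod as y \<ge> 0"
    using simple_dominant[OF c] by blast
  have g: "refl_prod as \<in> G" using as simple_subset by (intro refl_prod_mem) auto
  have "b \<bullet> refl_prod as y > 0" if "b \<in> roots G" "b \<bullet> c > 0" for b
    using as(2)[OF that] generic_mem[OF g] y that by (force simp: generic_def)
  then show ?thesis using that g by blast
qed

subsection \<open>Stabilizers\<close>

text \<open>An element \<open>w\<close> of the stabilizer is multiplied by a word in the simple
  roots through \<open>x\<close> until the image of \<open>c\<close> is positive on all of them. A
  simple root \<open>a\<close> off \<open>x\<close> is positive at \<open>x\<close>, and so is its
  preimage under the product \<open>h\<close>, as \<open>h\<close> fixes \<open>x\<close>. Dominance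
  of \<open>x\<close> makes this preimage positive at \<open>c\<close>. So \<open>h\<close> fixes
  the chamber and is the identity.\<close>

lemma stab_dominant:
  assumes c: "regular G c"
    and x: "\<And>b. b \<in> roots G \<Longrightarrow> b \<bullet> c > 0 \<Longrightarrow> b \<bullet> x \<ge> 0"
  shows "stab G x = refl_prod ` lists {a \<in> simple G c. a \<bullet> x = 0}" (is "_ = refl_prod ` lists ?S")
proof
  have S: "?S \<subseteq> roots G" using simple_subset by auto
  have fix_x: "refl_prod as x = x" if "set as \<subseteq> ?S" for as
    using that
  proof (induction as)
    case (Cons a as)
    then have "a \<noteq> 0" "a \<bullet> x = 0" using S roots_nz[of a G] by auto
    then show ?case using Cons by (simp add: reflection_fixes_iff)
  qed simp
  show "refl_prod ` lists ?S \<subseteq> stab G x"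
  proof (rule image_subsetI)
    fix as assume "as \<in> lists ?S"
    then have "set as \<subseteq> ?S" by auto
    then show "refl_prod as \<in> stab G x"
      using fix_x[of as] refl_prod_mem[of as] S by (auto simp: stab_def)
  qed
  show "stab G x \<subseteq> refl_prod ` lists ?S"
  proof
    fix w assume "w \<in> stab G x"
    then have w: "w \<in> G" "w x = x" by (auto simp: stab_def)
    obtain us where us: "set us \<subseteq> ?S" "\<And>a. a \<in> ?S \<Longrightarrow> a \<bullet> c > 0 \<Longrightarrow> a \<bullet> refl_prod us (w c) \<ge> 0"
      by (rule refl_prod_inner_max[OF finite_refl_prod[OF S], of c "w c"]) (rule that)
    define h where "h = refl_prod us \<circ> w"
    have uG: "refl_prod us \<in> G" using us S by (intro refl_prod_mem) blast
    then have hG: "h \<in> G" unfolding h_def using w comp_mem by blast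
    have hx: "h x = x" using w fix_x us by (simp add: h_def)
    have hc: "regular G (h c)" using hG c generic_mem by blast
    have pos0: "a \<bullet> h c > 0" if "a \<in> ?S" for a
    proof -
      have "a \<bullet> h c \<ge> 0" using us(2)[OF that] that by (simp add: h_def simple_def)
      moreover have "a \<bullet> h c \<noteq> 0" using hc that S by (auto simp: generic_def)
      ultimately show ?thesis by simp
    qed
    have "a \<bullet> h c > 0" if a: "a \<in> simple G c" for a
    proof (cases "a \<bullet> x = 0")
      case True
      then show ?thesis using pos0 a by blast
    next
      case False
      then have "a \<bullet> x > 0" using x[of a] a by (force simp: simple_def)
      moreover note swap = inner_mem_inv'[OF hG, of a]
      ultimately have "ginv h a \<bullet> x > 0" using hx by metis
      moreover have r: "ginv h a \<in> roots G" using a simple_subset root_image[OF inv_mem[OF hG]] by blast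
      ultimately have "\<not> - ginv h a \<bullet> c > 0" using x[OF roots_minus[OF r]] by auto
      moreover have "ginv h a \<bullet> c \<noteq> 0" using c r by (simp add: generic_def)
      ultimately show ?thesis by (simp add: swap)
    qed
    from chamber_free[OF c hG simple_pos_imp_pos[OF c this]] have "h = id" .
    then have "refl_prod (rev us) (refl_prod us (w y)) = refl_prod (rev us) y" for y
      unfolding h_def by (metis comp_apply id_apply)
    then have "w = refl_prod (rev us)" by (auto simp: refl_prod_inverse)
    moreover have "set (rev us) \<subseteq> ?S" using us(1) by simp
    ultimately show "w \<in> refl_prod ` lists ?S" by (simp add: lists_eq_set del: set_rev)
  qed
qed

text \<open>Every point lies in a closed chamber: a regular \<open>c\<close> close to
  \<open>x\<close> keeps the roots negative at \<open>x\<close> negative.\<close>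

lemma dominant_near:
  obtains c where "regular G c" "\<And>b. b \<in> roots G \<Longrightarrow> b \<bullet> c > 0 \<Longrightarrow> b \<bullet> x \<ge> 0"
proof -
  define U where "U = (\<Inter>a\<in>{a \<in> roots G. a \<bullet> x < 0}. {y. a \<bullet> y < 0})"
  have "open U" unfolding U_def using finite_roots_group by (intro open_INT ballI) (auto simp: open_halfspace_lt)
  moreover have "x \<in> U" "0 \<notin> roots G" using roots_nz by (auto simp: U_def)
  ultimately obtain c where c: "c \<in> U" "regular G c" using generic_near[OF finite_roots_group] by blast
  show ?thesis
  proof (rule that[OF c(2)])
    show "b \<bullet> x \<ge> 0" if "b \<in> roots G" "b \<bullet> c > 0" for b
      using c(1) that by (force simp: U_def)
  qed
qed

lemma stab_frg: "finite_reflection_group (stab G x)"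
proof -
  obtain c where c: "regular G c" "\<And>b. b \<in> roots G \<Longrightarrow> b \<bullet> c > 0 \<Longrightarrow> b \<bullet> x \<ge> 0"
    using dominant_near by blast
  show ?thesis
    unfolding finite_reflection_group_iff
  proof (intro conjI exI)
    show "finite (stab G x)" using finite_group by (simp add: stab_def)
    show "stab G x = refl_prod ` lists {a \<in> simple G c. a \<bullet> x = 0}"
      by (rule stab_dominant[OF c])
    show "0 \<notin> {a \<in> simple G c. a \<bullet> x = 0}"
      using simple_subset roots_nz by blast
  qed
qed

lemma roots_stab: "roots (stab G x) = {a \<in> roots G. a \<bullet> x = 0}"
proof (intro Set.set_eqI)
  fix a
  have "norm a = 1 \<Longrightarrow> reflection a x = x \<longleftrightarrow> a \<bullet> x = 0"
    by (rule reflection_fixes_iff) auto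
  then show "a \<in> roots (stab G x) \<longleftrightarrow> a \<in> {a \<in> roots G. a \<bullet> x = 0}"
    by (auto simp: roots_def stab_def)
qed

text \<open>The stabilizer of \<open>x\<close> is generated by the reflections whose roots vanish at
  \<open>x\<close>. Hence what it fixes depends only on the set of hyperplanes through
  \<open>x\<close>.\<close>

lemma stab_fixes:
  assumes "w \<in> stab G x" and y: "\<And>a. a \<in> roots G \<Longrightarrow> a \<bullet> x = 0 \<Longrightarrow> a \<bullet> y = 0"
  shows "w y = y"
proof -
  interpret S: refl_group "stab G x" by unfold_locales (rule stab_frg)
  show ?thesis
    using assms(1)
  proof (induction rule: S.group_induct)
    case (refl a h)
    then have "a \<bullet> y = 0" "a \<noteq> 0" using y roots_nz[of a "stab G x"] by (auto simp: roots_stab)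
    then show ?case using refl by (simp add: reflection_fixes_iff)
  qed simp
qed

end

section \<open>Faces of an arrangement\<close>

text \<open>A face is encoded by its sign vector; the value 0 outside \<open>A\<close> makes the
  vectors comparable as functions and finite in number.\<close>

definition face_sgn :: "'v::euclidean_space set \<Rightarrow> 'v \<Rightarrow> 'v \<Rightarrow> real" where
  "face_sgn A x = (\<lambda>a. if a \<in> A then sgn (a \<bullet> x) else 0)"

text \<open>For a sign vector that occurs, this is the linear span of the face, so its dimension is
  that of the face.\<close>

definition face_span :: "'v::euclidean_space set \<Rightarrow> ('v \<Rightarrow> real) \<Rightarrow> 'v set" where
  "face_span A \<sigma> = {x. \<forall>a\<in>A. \<sigma> a = 0 \<longrightarrow> a \<bullet> x = 0}"

lemma finite_face_sgn: "finite A \<Longrightarrow> finite (face_sgn A ` X)"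
proof -
  assume "finite A"
  then have "finite {f. \<forall>a. (a \<in> A \<longrightarrow> f a \<in> {-1, 0, 1::real}) \<and> (a \<notin> A \<longrightarrow> f a = 0)}"
    by (rule finite_set_of_finite_funs) simp
  moreover have "face_sgn A x a \<in> {-1, 0, 1}" "a \<notin> A \<Longrightarrow> face_sgn A x a = 0" for x a
    by (simp_all add: face_sgn_def sgn_if)
  then have "face_sgn A ` X \<subseteq> {f. \<forall>a. (a \<in> A \<longrightarrow> f a \<in> {-1, 0, 1}) \<and> (a \<notin> A \<longrightarrow> f a = 0)}"
    by blast
  ultimately show ?thesis by (rule finite_subset[rotated])
qed

lemma face_sgn_insert:
  "a \<notin> A \<Longrightarrow> face_sgn (insert a A) x = (face_sgn A x)(a := sgn (a \<bullet> x))"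
  by (auto simp: face_sgn_def fun_eq_iff)

lemma dim_Int_hyperplane:
  fixes V :: "'v::euclidean_space set"
  assumes V: "subspace V" and v: "v \<in> V" "a \<bullet> v \<noteq> 0"
  shows "dim V = Suc (dim (V \<inter> {x. a \<bullet> x = 0}))"
proof -
  let ?W = "V \<inter> {x. a \<bullet> x = 0}"
  have W: "subspace ?W" using V by (intro subspace_inter subspace_hyperplane) auto
  have "V = span (insert v ?W)"
  proof
    show "span (insert v ?W) \<subseteq> V" using v V by (intro span_minimal) auto
    show "V \<subseteq> span (insert v ?W)"
    proof
      fix x assume x: "x \<in> V"
      define k where "k = (a \<bullet> x) / (a \<bullet> v)"
      have "x - k *\<^sub>R v \<in> ?W"
        using x v V by (auto simp: k_def inner_diff_right intro!: subspace_diff subspace_scale)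
      then show "x \<in> span (insert v ?W)"
        unfolding span_insert by (auto intro: span_base)
    qed
  qed
  then have "dim V = dim (insert v ?W)" by (metis dim_span)
  also have "\<dots> = Suc (dim ?W)"
    using v W by (subst dim_insert) (simp add: span_eq_iff[THEN iffD2])
  finally show ?thesis .
qed

text \<open>The Euler characteristic with compact supports of a relatively open convex set, computed from
  the cells into which the hyperplanes cut it.\<close>

lemma euler_face_sum:
  fixes A :: "'v::euclidean_space set"
  assumes "finite A" "subspace V" "open U" "convex U" "V \<inter> U \<noteq> {}"
  shows "(\<Sum>\<sigma>\<in>face_sgn A ` (V \<inter> U). (-1) ^ dim (V \<inter> face_span A \<sigma>)) = ((-1) ^ dim V :: 'b::comm_ring_1)"
  using assms
proof (induction A arbitrary: V U rule: finite_induct)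
  case empty
  then have "face_sgn {} ` (V \<inter> U) = {\<lambda>_. 0}" by (auto simp: face_sgn_def)
  then show ?case by (simp add: face_span_def)
next
  case (insert a A)
  let ?p = "\<lambda>s. {x. sgn (a \<bullet> x) = s}" and ?F = "face_sgn (insert a A)"
  define f where "f V U = (\<Sum>\<sigma>\<in>face_sgn A ` (V \<inter> U). (-1) ^ dim (V \<inter> face_span A \<sigma>) :: 'b)" for V U
  define g where "g s X = (\<Sum>\<sigma>\<in>?F ` (X \<inter> ?p s).
    (-1) ^ dim (V \<inter> face_span (insert a A) \<sigma>) :: 'b)" for s X
  have inj: "inj_on (\<lambda>\<sigma>. \<sigma>(a := s)) (face_sgn A ` X)" for s :: real and X
  proof (rule inj_onI)
    fix \<sigma> \<tau> assume "\<sigma> \<in> face_sgn A ` X" "\<tau> \<in> face_sgn A ` X" and eq: "\<sigma>(a := s) = \<tau>(a := s)"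
    then have "\<sigma> a = 0" "\<tau> a = 0" using insert.hyps(2) by (auto simp: face_sgn_def)
    then show "\<sigma> = \<tau>" using fun_upd_eqD[OF eq] by (metis eq fun_upd_triv fun_upd_upd)
  qed
  have img: "?F ` (X \<inter> ?p s) = (\<lambda>\<sigma>. \<sigma>(a := s)) ` face_sgn A ` (X \<inter> ?p s)" for s X
    unfolding image_image by (intro image_cong refl) (auto simp: face_sgn_insert insert.hyps(2))
  have g_eq: "g s X = (\<Sum>\<sigma>\<in>face_sgn A ` (X \<inter> ?p s). (-1) ^ dim (V \<inter> face_span (insert a A) (\<sigma>(a := s))))" for s X
    unfolding g_def img by (subst sum.reindex[OF inj]) simp
  have span_ne: "face_span (insert a A) (\<sigma>(a := s)) = face_span A \<sigma>" if "s \<noteq> 0" for \<sigma> and s :: real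
    using that insert.hyps(2) by (auto simp: face_span_def)
  have span_0: "face_span (insert a A) (\<sigma>(a := 0)) = {x. a \<bullet> x = 0} \<inter> face_span A \<sigma>" for \<sigma>
    using insert.hyps(2) by (auto simp: face_span_def)
  let ?H = "{x. a \<bullet> x = 0}"
  have gpos: "g 1 (V \<inter> U) = f V (U \<inter> {x. a \<bullet> x > 0})"
    unfolding g_eq f_def by (simp add: span_ne sgn_1_pos Int_assoc)
  have gneg: "g (-1) (V \<inter> U) = f V (U \<inter> {x. a \<bullet> x < 0})"
    unfolding g_eq f_def by (simp add: span_ne sgn_1_neg Int_assoc)
  have "V \<inter> U \<inter> ?p 0 = V \<inter> ?H \<inter> U" by (auto simp: sgn_0_0)
  then have gz: "g 0 (V \<inter> U) = f (V \<inter> ?H) U"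
    unfolding g_eq f_def by (simp add: span_0 Int_assoc)
  have split: "?F ` (V \<inter> U) =
     (\<Union>s\<in>{1, 0, -1}. ?F ` (V \<inter> U \<inter> ?p s))"
    by (auto simp: sgn_real_def)
  have disj: "?F ` (X \<inter> ?p s) \<inter> ?F ` (X \<inter> ?p t) = {}"
    if "s \<noteq> t" for s t :: real and X
    using that by (auto simp: face_sgn_def fun_eq_iff) metis
  have "(\<Sum>\<sigma>\<in>?F ` (V \<inter> U). (-1) ^ dim (V \<inter> face_span (insert a A) \<sigma>)) =
    (\<Sum>s\<in>{1, 0, -1}. g s (V \<inter> U))"
    unfolding split g_def
    by (rule sum.UNION_disjoint) (use insert.hyps disj in \<open>auto simp del: sgn_0_0 intro: finite_face_sgn\<close>)
  also have "\<dots> = f V (U \<inter> {x. a \<bullet> x > 0}) + f (V \<inter> ?H) U + f V (U \<inter> {x. a \<bullet> x < 0})"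
    by (simp add: gpos gneg gz)
  also have "\<dots> = (-1) ^ dim V"
  proof -
    \<comment> \<open>Empty pieces get the value 0, so that the same equation serves all three
      pieces cut out by the new hyperplane.\<close>
    have IH: "f V' U' = (if V' \<inter> U' = {} then 0 else (-1) ^ dim V')"
      if "subspace V'" "open U'" "convex U'" for V' U'
      using insert.IH[OF that] by (simp add: f_def)
    have H: "subspace (V \<inter> ?H)"
      using insert.prems by (intro subspace_inter subspace_hyperplane) auto
    have P: "open (U \<inter> {x. a \<bullet> x > 0})" "convex (U \<inter> {x. a \<bullet> x > 0})"
      "open (U \<inter> {x. a \<bullet> x < 0})" "convex (U \<inter> {x. a \<bullet> x < 0})"
      using insert.prems
      by (auto intro!: open_Int convex_Int open_halfspace_gt open_halfspace_lt convex_halfspace_gt convex_halfspace_lt)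
    note IHs = IH[OF insert.prems(1) P(1,2)] IH[OF insert.prems(1) P(3,4)] IH[OF H insert.prems(2,3)]
    show ?thesis
    proof (cases "V \<subseteq> ?H")
      case True
      then have "V \<inter> (U \<inter> {x. a \<bullet> x > 0}) = {}" "V \<inter> (U \<inter> {x. a \<bullet> x < 0}) = {}" "V \<inter> ?H = V"
        by auto
      then show ?thesis unfolding IHs using insert.prems(4) by simp
    next
      case False
      then obtain v where v: "v \<in> V" "a \<bullet> v \<noteq> 0" by auto
      have dimH: "dim V = Suc (dim (V \<inter> ?H))"
        by (rule dim_Int_hyperplane[OF insert.prems(1) v])
      show ?thesis
      proof (cases "V \<inter> ?H \<inter> U = {}")
        \<comment> \<open>A convex set that misses the hyperplane lies strictly on one side, and
          just one of the three terms survives.\<close>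
        case True
        have ne: "V \<inter> U \<noteq> {}" by (rule insert.prems(4))
        have cn: "connected (V \<inter> U)"
          using insert.prems by (intro convex_connected convex_Int) (auto simp: subspace_imp_convex)
        have "\<not> (\<exists>x\<in>V \<inter> U. \<exists>y\<in>V \<inter> U. a \<bullet> x < 0 \<and> a \<bullet> y > 0)"
        proof
          assume "\<exists>x\<in>V \<inter> U. \<exists>y\<in>V \<inter> U. a \<bullet> x < 0 \<and> a \<bullet> y > 0"
          then obtain x y where "x \<in> V \<inter> U" "y \<in> V \<inter> U" "a \<bullet> x \<le> 0" "0 \<le> a \<bullet> y"
            by (meson less_imp_le)
          from connected_ivt_hyperplane[OF cn this] show False using True by blast
        qed
        moreover have "a \<bullet> x < 0 \<or> a \<bullet> x > 0" if "x \<in> V \<inter> U" for x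
          using that True by (force simp: not_less)
        ultimately consider "V \<inter> (U \<inter> {x. a \<bullet> x > 0}) = {}" "V \<inter> (U \<inter> {x. a \<bullet> x < 0}) \<noteq> {}"
          | "V \<inter> (U \<inter> {x. a \<bullet> x < 0}) = {}" "V \<inter> (U \<inter> {x. a \<bullet> x > 0}) \<noteq> {}"
          using ne by blast
        then show ?thesis
        proof cases
          case 1
          then show ?thesis unfolding IHs using True by simp
        next
          case 2
          then show ?thesis unfolding IHs using True by simp
        qed
      next
        case False
        \<comment> \<open>Here all three pieces are nonempty, and with d = dim V the total is (-1)^d
          + (-1)^(d-1) + (-1)^d = (-1)^d.\<close>
        then obtain x where x: "x \<in> V" "a \<bullet> x = 0" "x \<in> U" by auto
        obtain e where e: "e > 0" "ball x e \<subseteq> U"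
          using insert.prems(2) x open_contains_ball by blast
        define u where "u = sgn (a \<bullet> v) *\<^sub>R v"
        have u: "u \<in> V" "a \<bullet> u > 0"
          using v insert.prems(1) by (auto simp: u_def subspace_scale sgn_if)
        then have "u \<noteq> 0" by auto
        define k where "k = e / (2 * norm u)"
        have k: "k > 0" "k * norm u < e" using e \<open>u \<noteq> 0\<close> by (auto simp: k_def)
        have "x + k *\<^sub>R u \<in> V \<inter> U" "x - k *\<^sub>R u \<in> V \<inter> U"
          using k e(2) x u insert.prems(1)
          by (auto simp: dist_norm subset_iff intro!: subspace_add subspace_diff subspace_scale)
        moreover have "a \<bullet> (x + k *\<^sub>R u) > 0" "a \<bullet> (x - k *\<^sub>R u) < 0"
          using x k u by (auto simp: inner_add_right inner_diff_right)
        ultimately have "V \<inter> (U \<inter> {x. a \<bullet> x > 0}) \<noteq> {}" "V \<inter> (U \<inter> {x. a \<bullet> x < 0}) \<noteq> {}"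
          by blast+
        then show ?thesis unfolding IHs using False dimH by simp
      qed
    qed
  qed
  finally show ?case .
qed

lemma sum_Pow_power_card:
  fixes s :: "'b::comm_ring_1"
  assumes "finite X"
  shows "(\<Sum>B\<in>Pow X. s ^ card B) = (1 + s) ^ card X"
proof -
  have "(1 + s) ^ card X = (\<Prod>x\<in>X. s + 1)" by (simp add: add.commute)
  also have "\<dots> = (\<Sum>B\<in>Pow X. (\<Prod>x\<in>B. s) * (\<Prod>x\<in>X - B. 1))" by (rule prod_add[OF assms])
  finally show ?thesis by simp
qed

text \<open>Expanding t^k into powers of t - 1 over subsets \<open>B\<close> of positive normals and
  exchanging the sums reduces the claim to the faces negative on \<open>B\<close>. These are the
  faces meeting an open convex cone that contains \<open>-c\<close>, so their Euler sum is (-1)^n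
  for every \<open>B\<close>, and the expansion can be undone.\<close>

lemma alternating_face_sum_sep:
  fixes A :: "'v::euclidean_space set" and t :: "'b::comm_ring_1"
  assumes "finite A"
  shows "(\<Sum>\<sigma>\<in>range (face_sgn A). (-1) ^ dim (face_span A \<sigma>) * t ^ card {a \<in> A. a \<bullet> c > 0 \<and> \<sigma> a = -1}) =
    (-1) ^ DIM('v) * t ^ card {a \<in> A. a \<bullet> c > 0}"
proof -
  let ?R = "range (face_sgn A)" and ?d = "\<lambda>\<sigma>. (-1 :: 'b) ^ dim (face_span A \<sigma>)"
  let ?N = "\<lambda>\<sigma>. {a \<in> A. a \<bullet> c > 0 \<and> \<sigma> a = -1}" and ?neg = "\<lambda>B \<sigma>. \<forall>b\<in>B. \<sigma> b = (-1 :: real)"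
  define s where "s = t - 1"
  define P where "P = {a \<in> A. a \<bullet> c > 0}"
  have P: "finite P" using assms by (simp add: P_def)
  have tpow: "t ^ card X = (\<Sum>B\<in>Pow X. s ^ card B)" if "finite X" for X :: "'v set"
    using sum_Pow_power_card[OF that, of s] by (simp add: s_def)
  have fin: "finite (?R)" by (rule finite_face_sgn[OF assms])
  have inner: "(\<Sum>\<sigma>\<in>{\<sigma> \<in> ?R. ?neg B \<sigma>}. ?d \<sigma>) = ((-1) ^ DIM('v) :: 'b)"
    if "B \<in> Pow P" for B
  proof -
    have B: "B \<subseteq> A" "finite B" "\<And>b. b \<in> B \<Longrightarrow> b \<bullet> c > 0"
      using that P finite_subset by (auto simp: P_def)
    let ?U = "\<Inter>b\<in>B. {x. b \<bullet> x < 0}"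
    have "{\<sigma> \<in> ?R. ?neg B \<sigma>} = face_sgn A ` (UNIV \<inter> ?U)"
    proof -
      have "(\<forall>b\<in>B. face_sgn A x b = -1) \<longleftrightarrow> x \<in> ?U" for x
        using B(1) by (auto simp: face_sgn_def sgn_1_neg subset_iff)
      then show ?thesis by blast
    qed
    moreover have "- c \<in> ?U" using B(3) by simp
    then have "UNIV \<inter> ?U \<noteq> {}" by blast
    moreover have "open ?U" "convex ?U"
      using B(2) by (auto intro!: open_INT convex_INT open_halfspace_lt convex_halfspace_lt)
    ultimately show ?thesis
      using euler_face_sum[OF assms subspace_UNIV, of ?U] by simp
  qed
  have "(\<Sum>\<sigma>\<in>?R. ?d \<sigma> * t ^ card (?N \<sigma>)) =
    (\<Sum>\<sigma>\<in>?R. \<Sum>B\<in>Pow P. if ?neg B \<sigma> then ?d \<sigma> * s ^ card B else 0)"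
  proof (rule sum.cong[OF refl])
    fix \<sigma> :: "'v \<Rightarrow> real"
    have "finite (?N \<sigma>)" using assms by simp
    from tpow[OF this]
    have "?d \<sigma> * t ^ card (?N \<sigma>) =
      (\<Sum>B\<in>Pow (?N \<sigma>). ?d \<sigma> * s ^ card B)"
      by (simp add: sum_distrib_left)
    also have "Pow (?N \<sigma>) = {B \<in> Pow P. ?neg B \<sigma>}"
      by (auto simp: P_def)
    also have "(\<Sum>B\<in>\<dots>. ?d \<sigma> * s ^ card B) =
      (\<Sum>B\<in>Pow P. if ?neg B \<sigma> then ?d \<sigma> * s ^ card B else 0)"
      using P by (subst sum.inter_filter) auto
    finally show "?d \<sigma> * t ^ card (?N \<sigma>) = \<dots>" .
  qed
  also have "\<dots> = (\<Sum>B\<in>Pow P. \<Sum>\<sigma>\<in>?R. if ?neg B \<sigma> then ?d \<sigma> * s ^ card B else 0)"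
    by (rule sum.swap)
  also have "\<dots> = (\<Sum>B\<in>Pow P. (-1) ^ DIM('v) * s ^ card B)"
  proof (rule sum.cong[OF refl])
    fix B assume "B \<in> Pow P"
    have "(\<Sum>\<sigma>\<in>?R. if ?neg B \<sigma> then ?d \<sigma> * s ^ card B else 0) =
      (\<Sum>\<sigma>\<in>{\<sigma> \<in> ?R. ?neg B \<sigma>}. ?d \<sigma> * s ^ card B)"
      using fin by (subst sum.inter_filter) auto
    also have "\<dots> = (\<Sum>\<sigma>\<in>{\<sigma> \<in> ?R. ?neg B \<sigma>}. ?d \<sigma>) * s ^ card B"
      by (simp add: sum_distrib_right)
    also have "\<dots> = (-1) ^ DIM('v) * s ^ card B"
      unfolding inner[OF \<open>B \<in> Pow P\<close>] by simp
    finally show "(\<Sum>\<sigma>\<in>?R. if ?neg B \<sigma> then ?d \<sigma> * s ^ card B else 0) = \<dots>" .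
  qed
  also have "\<dots> = (-1) ^ DIM('v) * t ^ card P"
    by (simp add: tpow[OF P] sum_distrib_left)
  finally show ?thesis by (simp add: P_def)
qed

section \<open>Homogeneous polynomials\<close>

interpretation fun_vs: vector_space "\<lambda>c (f :: 'a \<Rightarrow> real) x. c * f x"
  by unfold_locales (auto simp: algebra_simps fun_eq_iff)

lemma sum_fun_apply: "sum f S x = (\<Sum>i\<in>S. f i x)"
  by (induction S rule: infinite_finite_induct) auto

text \<open>The trace of a projection is its rank. With X the coordinates of the \<open>E b\<close>
  in a basis of \<open>U\<close>, and Y those of this basis in \<open>B\<close>, the left side is
  tr(XY), while YX is the identity on \<open>U\<close>.\<close>

lemma (in vector_space) sum_representation_projection:
  assumes B: "independent B" "finite B" and U: "subspace U" "U \<subseteq> span B"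
    and add: "\<And>x y. x \<in> span B \<Longrightarrow> y \<in> span B \<Longrightarrow> E (x + y) = E x + E y"
    and scl: "\<And>c x. x \<in> span B \<Longrightarrow> E (scale c x) = scale c (E x)"
    and into: "\<And>x. x \<in> span B \<Longrightarrow> E x \<in> U" and fix_U: "\<And>u. u \<in> U \<Longrightarrow> E u = u"
  shows "(\<Sum>b\<in>B. representation B (E b) b) = of_nat (dim U)"
proof -
  obtain C where C: "C \<subseteq> U" "independent C" "U \<subseteq> span C" "card C = dim U"
    using basis_exists[of U] by blast
  have finC: "finite C"
    using independent_span_bound[OF B(2) C(2)] C(1) U(2) by blast
  have CB: "C \<subseteq> span B" using C(1) U(2) by blast
  have UC: "E x \<in> span C" if "x \<in> span B" for x using into[OF that] C(3) by blast
  have Esum: "E (\<Sum>i\<in>I. scale (c i) (v i)) = (\<Sum>i\<in>I. scale (c i) (E (v i)))" if "finite I" "\<And>i. i \<in> I \<Longrightarrow> v i \<in> span B"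
    for I :: "'b set" and c v
    using that
  proof (induction I rule: finite_induct)
    case empty
    show ?case using scl[of 0 0] span_zero by simp
  next
    case (insert i I)
    then show ?case by (simp add: add scl span_scale span_sum)
  qed
  have "(\<Sum>b\<in>B. representation B (E b) b) = (\<Sum>b\<in>B. \<Sum>u\<in>C. representation C (E b) u * representation B u b)"
  proof (rule sum.cong[OF refl])
    fix b assume b: "b \<in> B"
    have "E b = (\<Sum>u\<in>C. scale (representation C (E b) u) u)"
      by (rule sum_representation_eq[symmetric, OF C(2) UC finC order_refl]) (rule span_base[OF b])
    then have "representation B (E b) = representation B (\<Sum>u\<in>C. scale (representation C (E b) u) u)"
      by simp
    also have "\<dots> = (\<lambda>b'. \<Sum>u\<in>C. representation C (E b) u * representation B u b')"
      using CB by (subst representation_sum[OF B(1)]) (auto simp: representation_scale[OF B(1)] span_scale subset_iff intro!: ext sum.cong)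
    finally show "representation B (E b) b = (\<Sum>u\<in>C. representation C (E b) u * representation B u b)"
      by (rule fun_cong)
  qed
  also have "\<dots> = (\<Sum>u\<in>C. \<Sum>b\<in>B. representation B u b * representation C (E b) u)"
    by (subst sum.swap) (simp add: mult.commute)
  also have "\<dots> = (\<Sum>u\<in>C. 1)"
  proof (rule sum.cong[OF refl])
    fix u assume u: "u \<in> C"
    have "u = (\<Sum>b\<in>B. scale (representation B u b) b)"
      using u CB by (intro sum_representation_eq[symmetric, OF B(1) _ B(2) order_refl]) auto
    then have "E u = (\<Sum>b\<in>B. scale (representation B u b) (E b))"
      using Esum[OF B(2), of id "representation B u"] by (simp add: span_base)
    then have "representation C (E u) = (\<lambda>u'. \<Sum>b\<in>B. representation B u b * representation C (E b) u')"
      by (simp add: representation_sum[OF C(2)] representation_scale[OF C(2)] UC span_base span_scale)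
    moreover have "representation C (E u) u = 1"
      using u C(1) fix_U representation_basis[OF C(2) u] by (simp add: subset_iff)
    ultimately show "(\<Sum>b\<in>B. representation B u b * representation C (E b) u) = 1" by simp
  qed
  finally show ?thesis by (simp add: C(4))
qed

text \<open>The common last step of all dimension counts below: indexed functions that are
  independent and generate \<open>V\<close> pointwise.\<close>

lemma fun_basis:
  fixes b :: "'i \<Rightarrow> 'a \<Rightarrow> real"
  assumes I: "finite I" and V: "fun_vs.subspace V" "\<And>i. i \<in> I \<Longrightarrow> b i \<in> V"
    and indep: "\<And>u. \<forall>x. (\<Sum>i\<in>I. u i * b i x) = 0 \<Longrightarrow> \<forall>i\<in>I. u i = 0"
    and gen: "\<And>p. p \<in> V \<Longrightarrow> \<exists>u. \<forall>x. p x = (\<Sum>i\<in>I. u i * b i x)"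
  shows "inj_on b I" "fun_vs.independent (b ` I)" "fun_vs.span (b ` I) = V" "fun_vs.dim V = card I"
proof -
  show inj: "inj_on b I"
  proof (rule inj_onI, rule ccontr)
    fix i j assume ij: "i \<in> I" "j \<in> I" "b i = b j" "i \<noteq> j"
    have "(\<Sum>k\<in>I. (if k = i then 1 else if k = j then -1 else 0) * b k x) = 0" for x
    proof -
      have "(\<Sum>k\<in>I. (if k = i then 1 else if k = j then -1 else 0) * b k x) =
        (\<Sum>k\<in>I. if k = i then b i x else 0) - (\<Sum>k\<in>I. if k = j then b j x else 0)"
        unfolding sum_subtractf[symmetric] using ij(4) by (intro sum.cong refl) auto
      then show ?thesis using ij I by simp
    qed
    then show False using indep ij(1) by fastforce
  qed
  show ind: "fun_vs.independent (b ` I)"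
  proof (rule fun_vs.independent_if_scalars_zero)
    fix u p assume u: "(\<Sum>p\<in>b ` I. (\<lambda>x. u p * p x)) = 0" "p \<in> b ` I"
    have "(\<Sum>i\<in>I. u (b i) * b i x) = 0" for x
      using fun_cong[OF u(1), of x] by (simp add: sum_fun_apply sum.reindex[OF inj])
    then show "u p = 0" using indep[of "\<lambda>i. u (b i)"] u(2) by blast
  qed (use I in simp)
  show span: "fun_vs.span (b ` I) = V"
  proof
    show "fun_vs.span (b ` I) \<subseteq> V" by (rule fun_vs.span_minimal[OF image_subsetI V(1)]) (rule V(2))
    show "V \<subseteq> fun_vs.span (b ` I)"
    proof
      fix p assume "p \<in> V"
      then obtain u where "\<And>x. p x = (\<Sum>i\<in>I. u i * b i x)" using gen by blast
      then have "p = (\<Sum>i\<in>I. (\<lambda>x. u i * b i x))" by (intro ext) (simp add: sum_fun_apply)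
      also have "\<dots> \<in> fun_vs.span (b ` I)"
        by (intro fun_vs.span_sum fun_vs.span_scale fun_vs.span_base imageI)
      finally show "p \<in> fun_vs.span (b ` I)" .
    qed
  qed
  show "fun_vs.dim V = card I"
    using fun_vs.dim_span_eq_card_independent[OF ind] by (simp add: span card_image[OF inj])
qed

abbreviation rpf :: "('a::real_normed_vector \<Rightarrow> real) \<Rightarrow> bool" where
  "rpf \<equiv> real_polynomial_function"

lemmas rpf_linear = real_polynomial_function.intros(1)
  and rpf_const = real_polynomial_function.intros(2)
  and rpf_add = real_polynomial_function.intros(3)
  and rpf_mult = real_polynomial_function.intros(4)

definition hpoly :: "nat \<Rightarrow> ('v::euclidean_space \<Rightarrow> real) set" where
  "hpoly k = {p. rpf p \<and> homogeneous k p}"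

lemma subspace_hpoly: "fun_vs.subspace (hpoly k)"
proof -
  have "rpf (f + g)" if "rpf f" "rpf g" for f g :: "'a \<Rightarrow> real"
    using rpf_add[OF that] by (simp add: plus_fun_def)
  moreover have "rpf (0 :: 'a \<Rightarrow> real)"
    using rpf_const[of 0] by (simp add: zero_fun_def)
  ultimately show ?thesis
    unfolding fun_vs.subspace_def hpoly_def
    by (auto simp: homogeneous_def algebra_simps intro: rpf_mult rpf_const)
qed

text \<open>Evaluated at \<open>z x\<close>, both sides become polynomials in the scalar
  \<open>z\<close>; the coefficients of z^k are compared.\<close>

lemma homogeneous_sum_component:
  assumes "finite S" "homogeneous k p" "\<And>s. s \<in> S \<Longrightarrow> homogeneous (e s) (g s)"
    and p: "\<And>x. p x = (\<Sum>s\<in>S. g s x)"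
  shows "p x = (\<Sum>s\<in>{s \<in> S. e s = k}. g s x)"
proof -
  define n where "n = Max (insert k (e ` S))"
  have n: "k \<le> n" "\<And>s. s \<in> S \<Longrightarrow> e s \<le> n" using assms(1) by (auto simp: n_def)
  define c where "c i = (\<Sum>s\<in>{s \<in> S. e s = i}. g s x) - (if i = k then p x else 0)" for i
  have "(\<Sum>i\<le>n. c i * z ^ i) = 0" for z
  proof -
    have "z ^ k * p x = p (z *\<^sub>R x)" using assms(2) by (simp add: homogeneous_def)
    also have "\<dots> = (\<Sum>s\<in>S. g s x * z ^ e s)"
      unfolding p using assms(3) by (intro sum.cong refl) (simp add: homogeneous_def mult.commute)
    also have "\<dots> = (\<Sum>i\<le>n. \<Sum>s\<in>{s \<in> S. e s = i}. g s x * z ^ e s)"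
      using assms(1) n by (intro sum.group[symmetric]) auto
    also have "\<dots> = (\<Sum>i\<le>n. (\<Sum>s\<in>{s \<in> S. e s = i}. g s x) * z ^ i)"
      by (intro sum.cong refl) (simp add: sum_distrib_right)
    finally have *: "z ^ k * p x = \<dots>" .
    have "(\<Sum>i\<le>n. c i * z ^ i) = (\<Sum>i\<le>n. (\<Sum>s\<in>{s \<in> S. e s = i}. g s x) * z ^ i) - (\<Sum>i\<le>n. if i = k then p x * z ^ i else 0)"
      unfolding sum_subtractf[symmetric] by (intro sum.cong refl) (auto simp: c_def algebra_simps)
    also have "\<dots> = 0" using n by (simp add: *[symmetric])
    finally show ?thesis .
  qed
  then have "c k = 0" using polyfun_eq_0[of c n] n by blast
  then show ?thesis by (simp add: c_def)
qed

subsection \<open>Monomials\<close>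

text \<open>With the coordinates for \<open>f\<close> these are the ordinary monomials
  \<open>mon\<close>; with basic invariants for \<open>f\<close> they span the invariants.\<close>

definition monom_fun :: "('m::finite \<Rightarrow> 'v \<Rightarrow> real) \<Rightarrow> ('m \<Rightarrow> nat) \<Rightarrow> 'v \<Rightarrow> real" where
  "monom_fun f \<alpha> = (\<lambda>x. \<Prod>i\<in>UNIV. f i x ^ \<alpha> i)"

text \<open>The degree of the monomial with exponents \<open>\<alpha>\<close> when the i-th factor
  has degree \<open>d i\<close>.\<close>

definition wt :: "('m::finite \<Rightarrow> nat) \<Rightarrow> ('m \<Rightarrow> nat) \<Rightarrow> nat" where
  "wt d \<alpha> = (\<Sum>i\<in>UNIV. d i * \<alpha> i)"

abbreviation coord :: "'m::finite \<Rightarrow> real^'m \<Rightarrow> real" where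
  "coord i u \<equiv> u $ i"

abbreviation mon :: "('m::finite \<Rightarrow> nat) \<Rightarrow> real^'m \<Rightarrow> real" where
  "mon \<equiv> monom_fun coord"

lemma monom_fun_polynomial:
  "(\<And>i. rpf (f i)) \<Longrightarrow> rpf (monom_fun f \<alpha>)"
  unfolding monom_fun_def by (intro real_polynomial_function_prod real_polynomial_function_power) auto

lemma monom_fun_homogeneous:
  "(\<And>i. homogeneous (d i) (f i)) \<Longrightarrow> homogeneous (wt d \<alpha>) (monom_fun f \<alpha>)"
  by (simp add: homogeneous_def monom_fun_def wt_def power_sum power_mult power_mult_distrib prod.distrib)

lemma coord_polynomial: "rpf (coord i)"
  by (rule rpf_linear) (rule bounded_linear_vec_nth)

text \<open>Monomials are distinct multiplicative characters, so Dedekind's argument applies.\<close>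

lemma monom_fun_coord_independent:
  fixes c :: "('m::finite \<Rightarrow> nat) \<Rightarrow> real"
  assumes "finite S" "\<And>u. (\<Sum>\<alpha>\<in>S. c \<alpha> * mon \<alpha> u) = 0" "\<alpha> \<in> S"
  shows "c \<alpha> = 0"
  using assms
proof (induction S arbitrary: c \<alpha> rule: finite_induct)
  case (insert \<alpha>0 S)
  let ?m = "monom_fun (coord :: 'm \<Rightarrow> _)"
  have S0: "c \<beta> = 0" if "\<beta> \<in> S" for \<beta>
  proof -
    have "\<beta> \<noteq> \<alpha>0" using that insert.hyps by auto
    then obtain i where i: "\<beta> i \<noteq> \<alpha>0 i" by auto
    \<comment> \<open>A point at which the two characters differ: each monomial takes there the
      value 2 to its i-th exponent.\<close>
    define u0 :: "real^'m" where "u0 = (\<chi> j. if j = i then 2 else 1)"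
    have mult: "?m \<alpha> (\<chi> j. u0 $ j * u $ j) = ?m \<alpha> u0 * ?m \<alpha> u" for \<alpha> u
      by (simp add: monom_fun_def power_mult_distrib prod.distrib)
    have u0: "?m \<alpha> u0 = 2 ^ \<alpha> i" for \<alpha>
    proof -
      have "?m \<alpha> u0 = (\<Prod>j\<in>UNIV. if j = i then 2 ^ \<alpha> j else 1)"
        unfolding monom_fun_def by (intro prod.cong refl) (simp add: u0_def)
      then show ?thesis by simp
    qed
    \<comment> \<open>The shifted relation minus 2^(\<open>\<alpha>0 i\<close>) times the original
      one; the term of \<open>\<alpha>0\<close> drops out.\<close>
    define c' where "c' \<alpha> = c \<alpha> * (2 ^ \<alpha> i - 2 ^ \<alpha>0 i)" for \<alpha>
    have "(\<Sum>\<alpha>\<in>S. c' \<alpha> * ?m \<alpha> u) = 0" for u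
    proof -
      have "(\<Sum>\<alpha>\<in>S. c' \<alpha> * ?m \<alpha> u) = (\<Sum>\<alpha>\<in>insert \<alpha>0 S. c' \<alpha> * ?m \<alpha> u)"
        using insert.hyps by (simp add: c'_def)
      also have "\<dots> = (\<Sum>\<alpha>\<in>insert \<alpha>0 S. c \<alpha> * ?m \<alpha> (\<chi> j. u0 $ j * u $ j)) - 2 ^ \<alpha>0 i * (\<Sum>\<alpha>\<in>insert \<alpha>0 S. c \<alpha> * ?m \<alpha> u)"
        unfolding sum_distrib_left sum_subtractf[symmetric] mult u0 c'_def
        by (intro sum.cong refl) (simp add: algebra_simps)
      finally show ?thesis using insert.prems(1) by simp
    qed
    from insert.IH[OF this that] show "c \<beta> = 0" using i by (simp add: c'_def)
  qed
  have "c \<alpha>0 * ?m \<alpha>0 (\<chi> j. 1) = 0"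
    using insert.prems(1)[of "\<chi> j. 1"] insert.hyps S0 by simp
  then have "c \<alpha>0 = 0" by (simp add: monom_fun_def)
  then show ?case using insert.prems(2) S0 by auto
qed simp

lemma real_polynomial_function_expand:
  fixes P :: "real^'m::finite \<Rightarrow> real"
  assumes "rpf P"
  shows "\<exists>S c. finite S \<and> (\<forall>u. P u = (\<Sum>\<alpha>\<in>S. c \<alpha> * mon \<alpha> u))"
proof -
  let ?m = "monom_fun (coord :: 'm \<Rightarrow> _)"
  let ?V = "fun_vs.span (range ?m)"
  have mult_mono: "(\<lambda>x. ?m \<alpha> x * ?m \<beta> x) \<in> ?V" for \<alpha> \<beta>
  proof -
    have "(\<lambda>x. ?m \<alpha> x * ?m \<beta> x) = ?m (\<lambda>i. \<alpha> i + \<beta> i)"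
      by (simp add: monom_fun_def power_add prod.distrib)
    then show ?thesis by (simp add: fun_vs.span_base)
  qed
  have mult_closed: "(\<lambda>x. f x * g x) \<in> ?V"
    if "f \<in> ?V" "\<And>\<alpha>. (\<lambda>x. ?m \<alpha> x * g x) \<in> ?V" for f g
    using that(1)
  proof (induction rule: fun_vs.span_induct_alt)
    case base
    show ?case using fun_vs.span_zero[of "range ?m"] by (simp add: zero_fun_def)
  next
    case (step c b f)
    then have "(\<lambda>x. c * (b x * g x)) + (\<lambda>x. f x * g x) \<in> ?V"
      using that(2) by (intro fun_vs.span_add fun_vs.span_scale) auto
    then show ?case by (simp add: plus_fun_def algebra_simps)
  qed
  have "P \<in> ?V"
    using assms
  proof (induction P rule: real_polynomial_function.induct)
    case (linear h)
    interpret h: bounded_linear h by fact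
    have m: "?m (\<lambda>j. if j = i then 1 else 0) u = u $ i" for i u
    proof -
      have "?m (\<lambda>j. if j = i then 1 else 0) u = (\<Prod>j\<in>UNIV. if j = i then u $ j else 1)"
        unfolding monom_fun_def by (intro prod.cong refl) simp
      then show ?thesis by simp
    qed
    have "h u = h (\<Sum>i\<in>UNIV. (u $ i) *\<^sub>R axis i 1)" for u
      by (simp add: basis_expansion scalar_mult_eq_scaleR[symmetric])
    also have "\<dots> u = (\<Sum>i\<in>UNIV. h (axis i 1) * ?m (\<lambda>j. if j = i then 1 else 0) u)" for u
      unfolding m h.sum h.scaleR by (simp only: real_scaleR_def mult.commute)
    finally have h_eq: "h u = (\<Sum>i\<in>UNIV. h (axis i 1) * ?m (\<lambda>j. if j = i then 1 else 0) u)" for u .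
    have "h = (\<Sum>i\<in>UNIV. (\<lambda>u. h (axis i 1) * ?m (\<lambda>j. if j = i then 1 else 0) u))"
      unfolding fun_eq_iff sum_fun_apply by (rule allI, rule h_eq)
    also have "\<dots> \<in> ?V"
      by (intro fun_vs.span_sum fun_vs.span_scale fun_vs.span_base rangeI)
    finally show ?case .
  next
    case (const r)
    have "(\<lambda>_. r) = (\<lambda>u. r * ?m (\<lambda>_. 0) u)" by (simp add: monom_fun_def)
    also have "\<dots> \<in> ?V" by (intro fun_vs.span_scale fun_vs.span_base rangeI)
    finally show ?case .
  next
    case (add f g)
    then show ?case using fun_vs.span_add[of f "range ?m" g] by (simp add: plus_fun_def)
  next
    case (mult f g)
    show ?case
    proof (rule mult_closed[OF mult.IH(1)])
      fix \<alpha>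
      have "(\<lambda>x. g x * ?m \<alpha> x) \<in> ?V" by (rule mult_closed[OF mult.IH(2) mult_mono])
      then show "(\<lambda>x. ?m \<alpha> x * g x) \<in> ?V" by (simp add: mult.commute)
    qed
  qed
  then obtain T r where T: "finite T" "T \<subseteq> range ?m" "P = (\<Sum>b\<in>T. (\<lambda>x. r b * b x))"
    unfolding fun_vs.span_explicit by blast
  then obtain S where S: "inj_on ?m S" "T = ?m ` S" using subset_image_inj[of T ?m UNIV] by auto
  have "P u = (\<Sum>\<alpha>\<in>S. r (?m \<alpha>) * ?m \<alpha> u)" for u
    unfolding T(3) S(2) sum_fun_apply by (simp only: sum.reindex[OF S(1)] comp_def)
  moreover have "finite S" using T(1) S finite_imageD by blast
  ultimately show ?thesis by (intro exI[of _ S] exI[of _ "\<lambda>\<alpha>. r (?m \<alpha>)"] conjI allI)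
qed

lemma homogeneous_decomposition:
  fixes p :: "real^'n::finite \<Rightarrow> real"
  assumes "rpf p"
  obtains n q where "\<And>k. q k \<in> hpoly k" "\<And>x. p x = (\<Sum>k\<le>n. q k x)"
proof -
  obtain S c where S: "finite S" "\<And>u. p u = (\<Sum>\<alpha>\<in>S. c \<alpha> * mon \<alpha> u)"
    using real_polynomial_function_expand[OF assms] by blast
  define w where "w = wt (\<lambda>_::'n. 1)"
  define q where "q k x = (\<Sum>\<alpha>\<in>{\<alpha> \<in> S. w \<alpha> = k}. c \<alpha> * mon \<alpha> x)" for k x
  have "homogeneous (w \<alpha>) (mon \<alpha>)" for \<alpha> :: "'n \<Rightarrow> nat"
    unfolding w_def by (rule monom_fun_homogeneous) (simp add: homogeneous_def)
  then have "homogeneous k (q k)" for k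
    by (auto simp: homogeneous_def q_def sum_distrib_left mult.left_commute intro!: sum.cong)
  moreover have "rpf (q k)" for k
    unfolding q_def using S(1)
    by (intro real_polynomial_function_sum rpf_mult rpf_const monom_fun_polynomial coord_polynomial) auto
  moreover have "p x = (\<Sum>k\<le>Max (insert 0 (w ` S)). q k x)" for x
    unfolding S(2) q_def using S(1) by (intro sum.group[symmetric]) auto
  ultimately show ?thesis using that unfolding hpoly_def by blast
qed

subsection \<open>Hilbert series of algebras of invariants\<close>

definition inv_hpoly :: "('v::euclidean_space \<Rightarrow> 'v) set \<Rightarrow> nat \<Rightarrow> ('v \<Rightarrow> real) set" where
  "inv_hpoly G k = {p \<in> hpoly k. \<forall>g\<in>G. p \<circ> g = p}"

definition hilbert :: "('v::euclidean_space \<Rightarrow> 'v) set \<Rightarrow> real fps" where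
  "hilbert G = Abs_fps (\<lambda>k. real (fun_vs.dim (inv_hpoly G k)))"

lemma finite_wt:
  assumes "\<And>i. d i > 0"
  shows "finite {\<alpha>. wt d \<alpha> = k}"
proof (rule finite_subset)
  show "finite {\<alpha> :: 'a \<Rightarrow> nat. \<forall>i. (i \<in> UNIV \<longrightarrow> \<alpha> i \<in> {..k}) \<and> (i \<notin> UNIV \<longrightarrow> \<alpha> i = 0)}"
    by (rule finite_set_of_finite_funs) auto
  have "\<alpha> i \<le> wt d \<alpha>" for \<alpha> i
  proof -
    have "\<alpha> i \<le> d i * \<alpha> i" using assms[of i] by (cases "d i") auto
    also have "\<dots> \<le> wt d \<alpha>" unfolding wt_def by (rule member_le_sum) auto
    finally show ?thesis .
  qed
  then show "{\<alpha>. wt d \<alpha> = k} \<subseteq> {\<alpha>. \<forall>i. (i \<in> UNIV \<longrightarrow> \<alpha> i \<in> {..k}) \<and> (i \<notin> UNIV \<longrightarrow> \<alpha> i = 0)}"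
    by auto
qed

text \<open>An invariant of degree 0 is constant, and subtracting the constant from its variable
  gives an algebraic relation.\<close>

lemma basic_invariants_degree_pos:
  fixes G :: "('v::euclidean_space \<Rightarrow> 'v) set" and f :: "'m::finite \<Rightarrow> 'v \<Rightarrow> real"
  assumes "basic_invariants G f d"
  shows "d i > 0"
proof (rule ccontr)
  assume "\<not> d i > 0"
  then have "homogeneous 0 (f i)" using assms by (metis basic_invariants_def gr0I)
  then have const: "f i x = f i 0" for x
    unfolding homogeneous_def by (metis mult_1 power_0 scaleR_zero_left)
  define P where "P u = u $ i - f i 0" for u :: "real^'m"
  have "rpf P"
    unfolding P_def by (intro real_polynomial_function_diff coord_polynomial rpf_const)
  moreover have "P (\<chi> i. f i x) = 0" for x using const by (simp add: P_def)
  moreover have "algebraically_independent f" using assms by (simp add: basic_invariants_def)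
  ultimately have "P u = 0" for u unfolding algebraically_independent_def by blast
  from this[of "\<chi> j. f i 0 + 1"] show False by (simp add: P_def)
qed

text \<open>Algebraic independence makes the monomials in the invariants linearly independent. They
  span because only the terms of weight \<open>k\<close> survive when a form of degree
  \<open>k\<close> is written as a polynomial in the invariants.\<close>

lemma basic_invariants_basis:
  fixes G :: "('v::euclidean_space \<Rightarrow> 'v) set" and f :: "'m::finite \<Rightarrow> 'v \<Rightarrow> real"
  assumes bi: "basic_invariants G f d"
  shows "inj_on (monom_fun f) {\<alpha>. wt d \<alpha> = k}"
    and "fun_vs.independent (monom_fun f ` {\<alpha>. wt d \<alpha> = k})"
    and "fun_vs.span (monom_fun f ` {\<alpha>. wt d \<alpha> = k}) = inv_hpoly G k"
    and dim_inv_hpoly: "fun_vs.dim (inv_hpoly G k) = card {\<alpha>. wt d \<alpha> = k}"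
proof -
  let ?A = "{\<alpha>. wt d \<alpha> = k}"
  have alg: "algebraically_independent f" using bi by (simp add: basic_invariants_def)
  have fin: "finite ?A" by (rule finite_wt) (rule basic_invariants_degree_pos[OF bi])
  have indep: "\<forall>\<alpha>\<in>?A. c \<alpha> = 0" if c: "\<forall>x. (\<Sum>\<alpha>\<in>?A. c \<alpha> * monom_fun f \<alpha> x) = 0" for c
  proof -
    define P where "P u = (\<Sum>\<alpha>\<in>?A. c \<alpha> * mon \<alpha> u)" for u :: "real^'m"
    have "rpf P"
      unfolding P_def using fin
      by (intro real_polynomial_function_sum rpf_mult rpf_const monom_fun_polynomial coord_polynomial)
    moreover have "P (\<chi> i. f i x) = 0" for x
      using c by (simp add: P_def monom_fun_def)
    ultimately have "P u = 0" for u using alg unfolding algebraically_independent_def by blast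
    then show ?thesis using monom_fun_coord_independent[OF fin] unfolding P_def by blast
  qed
  have hom: "homogeneous (wt d \<alpha>) (monom_fun f \<alpha>)" for \<alpha>
    by (rule monom_fun_homogeneous) (use bi in \<open>simp add: basic_invariants_def\<close>)
  have sub: "fun_vs.subspace (inv_hpoly G k)"
    using subspace_hpoly[of k] unfolding fun_vs.subspace_def inv_hpoly_def
    by (auto simp: fun_eq_iff)
  have mem: "monom_fun f \<alpha> \<in> inv_hpoly G k" if "\<alpha> \<in> ?A" for \<alpha>
  proof -
    have fi: "rpf (f i)" "g \<in> G \<Longrightarrow> f i \<circ> g = f i" for i g
      using bi by (auto simp: basic_invariants_def invariant_polynomials_def)
    have "monom_fun f \<alpha> \<circ> g = monom_fun f \<alpha>" if "g \<in> G" for g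
      using fun_cong[OF fi(2)[OF that]] by (auto simp: monom_fun_def fun_eq_iff)
    then show ?thesis
      using hom[of \<alpha>] that monom_fun_polynomial[OF fi(1)] by (auto simp: inv_hpoly_def hpoly_def)
  qed
  have gen: "\<exists>c. \<forall>x. p x = (\<Sum>\<alpha>\<in>?A. c \<alpha> * monom_fun f \<alpha> x)" if p: "p \<in> inv_hpoly G k" for p
  proof -
    have "p \<in> invariant_polynomials G" using p by (simp add: inv_hpoly_def hpoly_def invariant_polynomials_def)
    then obtain P :: "real^'m \<Rightarrow> real" where P: "rpf P" "\<And>x. p x = P (\<chi> i. f i x)"
      using bi unfolding basic_invariants_def by blast
    obtain S c where S: "finite S" "\<And>u. P u = (\<Sum>\<alpha>\<in>S. c \<alpha> * mon \<alpha> u)"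
      using real_polynomial_function_expand[OF P(1)] by blast
    have "p x = (\<Sum>\<alpha>\<in>{\<alpha> \<in> S. wt d \<alpha> = k}. c \<alpha> * monom_fun f \<alpha> x)" for x
    proof (rule homogeneous_sum_component[OF S(1)])
      show "homogeneous k p" using p by (simp add: inv_hpoly_def hpoly_def)
      show "homogeneous (wt d \<alpha>) (\<lambda>x. c \<alpha> * monom_fun f \<alpha> x)" for \<alpha>
        using hom[of \<alpha>] by (simp add: homogeneous_def)
      show "p x = (\<Sum>\<alpha>\<in>S. c \<alpha> * monom_fun f \<alpha> x)" for x
        by (simp add: P(2) S(2) monom_fun_def)
    qed
    also have "\<dots> x = (\<Sum>\<alpha>\<in>?A. (if \<alpha> \<in> S then c \<alpha> else 0) * monom_fun f \<alpha> x)" for x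
      using fin by (intro sum.mono_neutral_cong_left) auto
    finally show ?thesis by (intro exI allI)
  qed
  note basis = fun_basis[where b = "monom_fun f", OF fin sub mem indep gen]
  show "inj_on (monom_fun f) ?A" by (rule basis(1))
  show "fun_vs.independent (monom_fun f ` ?A)" by (rule basis(2))
  show "fun_vs.span (monom_fun f ` ?A) = inv_hpoly G k" by (rule basis(3))
  show "fun_vs.dim (inv_hpoly G k) = card ?A" by (rule basis(4))
qed

text \<open>Induction on the set of allowed variables: either the exponent of the new variable is
  zero, or it can be lowered by one at the cost of \<open>d i\<close> in weight. This is a recursion
  that multiplication by 1 - q^(d i) undoes.\<close>

lemma wt_generating_function:
  fixes d :: "'m::finite \<Rightarrow> nat"
  assumes d: "\<And>i. d i > 0" and "finite I"
  shows "Abs_fps (\<lambda>k. real (card {\<alpha>. (\<forall>i. i \<notin> I \<longrightarrow> \<alpha> i = 0) \<and> wt d \<alpha> = k})) * (\<Prod>i\<in>I. 1 - fps_X ^ d i) = 1"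
  using assms(2)
proof (induction I rule: finite_induct)
  case empty
  have "{\<alpha>. (\<forall>i. \<alpha> i = 0) \<and> wt d \<alpha> = k} = (if k = 0 then {\<lambda>_. 0} else {})" for k
    by (auto simp: wt_def)
  then show ?case by (simp add: fps_eq_iff)
next
  case (insert i I)
  define S where "S J k = {\<alpha>. (\<forall>i. i \<notin> J \<longrightarrow> \<alpha> i = 0) \<and> wt d \<alpha> = k}" for J k
  define F where "F J = Abs_fps (\<lambda>k. real (card (S J k)))" for J
  have fin: "finite (S J k)" for J k
    unfolding S_def by (rule finite_subset[of _ "{\<alpha>. wt d \<alpha> = k}"]) (auto intro: finite_wt d)
  \<comment> \<open>Stated additively, to stay clear of truncated subtraction.\<close>
  have wt_upd: "wt d (\<alpha>(i := m)) + d i * \<alpha> i = wt d \<alpha> + d i * m" for \<alpha> m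
    unfolding wt_def by (simp add: sum.remove[of UNIV i])
  have c: "card (S (insert i I) k) = card (S I k) + (if k < d i then 0 else card (S (insert i I) (k - d i)))" for k
  proof -
    let ?T = "{\<alpha> \<in> S (insert i I) k. \<alpha> i \<noteq> 0}"
    have T: "d i + wt d (\<alpha>(i := \<alpha> i - 1)) = k" if "\<alpha> \<in> ?T" for \<alpha>
      using that wt_upd[of \<alpha> "\<alpha> i - 1"] by (cases "\<alpha> i") (auto simp: S_def)
    have "\<alpha> \<in> S I k \<longleftrightarrow> \<alpha> \<in> S (insert i I) k \<and> \<alpha> i = 0" for \<alpha>
      using insert.hyps(2) unfolding S_def mem_Collect_eq by (metis insert_iff)
    then have "S (insert i I) k = S I k \<union> ?T" by (intro Set.set_eqI) auto
    moreover have "card (S I k \<union> ?T) = card (S I k) + card ?T"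
      using insert.hyps by (intro card_Un_disjoint fin finite_subset[OF Collect_restrict fin]) (auto simp: S_def)
    moreover have "card ?T = (if k < d i then 0 else card (S (insert i I) (k - d i)))"
    proof (cases "k < d i")
      case True
      then have "?T = {}" using T by fastforce
      then show ?thesis using True by (simp only: card.empty if_True)
    next
      case False
      have "bij_betw (\<lambda>\<alpha>. \<alpha>(i := \<alpha> i - 1)) ?T (S (insert i I) (k - d i))"
      proof (rule bij_betw_byWitness[of _ "\<lambda>\<alpha>. \<alpha>(i := Suc (\<alpha> i))"])
        show "(\<lambda>\<alpha>. \<alpha>(i := \<alpha> i - 1)) ` ?T \<subseteq> S (insert i I) (k - d i)"
        proof (rule image_subsetI)
          fix \<alpha> assume "\<alpha> \<in> ?T"
          then show "\<alpha>(i := \<alpha> i - 1) \<in> S (insert i I) (k - d i)"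
            using T[of \<alpha>] by (simp add: S_def)
        qed
        show "(\<lambda>\<alpha>. \<alpha>(i := Suc (\<alpha> i))) ` S (insert i I) (k - d i) \<subseteq> ?T"
        proof (rule image_subsetI)
          fix \<alpha> assume "\<alpha> \<in> S (insert i I) (k - d i)"
          then show "\<alpha>(i := Suc (\<alpha> i)) \<in> ?T"
            using False wt_upd[of \<alpha> "Suc (\<alpha> i)"] by (auto simp: S_def)
        qed
      qed auto
      then show ?thesis using False by (simp add: bij_betw_same_card)
    qed
    ultimately show ?thesis by simp
  qed
  have "F (insert i I) * (1 - fps_X ^ d i) = F I"
    by (rule fps_ext) (simp add: F_def c right_diff_distrib fps_X_power_mult_right_nth)
  then have "F (insert i I) * (\<Prod>i\<in>insert i I. 1 - fps_X ^ d i) = F I * (\<Prod>i\<in>I. 1 - fps_X ^ d i)"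
    using insert.hyps by (simp add: mult.assoc[symmetric])
  then show ?case using insert.IH by (simp add: F_def S_def)
qed

lemma hilbert_basic_invariants:
  assumes "basic_invariants G f d"
  shows "hilbert G * (\<Prod>i\<in>UNIV. 1 - fps_X ^ d i) = 1"
  using wt_generating_function[OF basic_invariants_degree_pos[OF assms], of UNIV]
  by (simp add: hilbert_def dim_inv_hpoly[OF assms])

text \<open>Turns the monomial basis of all forms of degree \<open>k\<close>, and the Hilbert series
  (1 - q)^(-n), into instances of the results on basic invariants.\<close>

lemma basic_invariants_trivial: "basic_invariants {id} (coord :: 'n::finite \<Rightarrow> _) (\<lambda>_. 1)"
proof -
  have "(\<chi> i. x $ i) = x" for x :: "real^'n" by (simp add: vec_eq_iff)
  then show ?thesis
    by (auto simp: basic_invariants_def invariant_polynomials_def homogeneous_def coord_polynomial algebraically_independent_def)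
qed

lemma hilbert_trivial: "hilbert {id :: real^'n \<Rightarrow> real^'n} * (1 - fps_X) ^ CARD('n::finite) = 1"
  using hilbert_basic_invariants[OF basic_invariants_trivial] by simp

section \<open>The monomial basis and traces on homogeneous polynomials\<close>

abbreviation exps :: "nat \<Rightarrow> ('m::finite \<Rightarrow> nat) set" where
  "exps k \<equiv> {\<alpha>. wt (\<lambda>_. 1) \<alpha> = k}"

lemma finite_exps: "finite (exps k)"
  by (rule finite_wt) simp

definition hbasis :: "nat \<Rightarrow> (real^'n::finite \<Rightarrow> real) set" where
  "hbasis k = mon ` exps k"

lemma hbasis:
  shows "finite (hbasis k)" "fun_vs.independent (hbasis k)" "fun_vs.span (hbasis k) = hpoly k"
  using basic_invariants_basis[OF basic_invariants_trivial] finite_exps[of k]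
  by (auto simp: hbasis_def inv_hpoly_def)

lemma hpoly_comp_linear:
  assumes "linear g" "p \<in> hpoly k"
  shows "p \<circ> g \<in> hpoly k"
  using assms
  by (auto simp: hpoly_def homogeneous_def linear_cmul linear_conv_bounded_linear
      intro!: real_polynomial_function_compose polynomial_function_bounded_linear)

text \<open>The trace of \<open>g\<close> acting by composition on the forms of degree
  \<open>k\<close>, computed in the monomial basis.\<close>

definition ptrace :: "nat \<Rightarrow> (real^'n::finite \<Rightarrow> real^'n) \<Rightarrow> real" where
  "ptrace k g = (\<Sum>b\<in>hbasis k. fun_vs.representation (hbasis k) (b \<circ> g) b)"

text \<open>The average \<open>E\<close> of the composites with \<open>g\<close>, weighted by
  \<open>\<epsilon> g\<close>, projects onto the semi-invariants of the character
  \<open>\<epsilon>\<close>, so its trace is their dimension. Since \<open>\<epsilon>\<close> has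
  values of square one it is its own inverse, and the same weight serves for projecting and for the
  semi-invariance.\<close>

lemma sum_ptrace:
  fixes G :: "(real^'n::finite \<Rightarrow> real^'n) set"
  assumes "refl_group G"
    and \<epsilon>: "\<And>g. g \<in> G \<Longrightarrow> \<epsilon> g * \<epsilon> g = 1" "\<And>g h. g \<in> G \<Longrightarrow> h \<in> G \<Longrightarrow> \<epsilon> (g \<circ> h) = \<epsilon> g * \<epsilon> h"
  shows "(\<Sum>g\<in>G. \<epsilon> g * ptrace k g) = real (card G) * real (fun_vs.dim {p \<in> hpoly k. \<forall>g\<in>G. p \<circ> g = (\<lambda>x. \<epsilon> g * p x)})"
proof -
  interpret refl_group G by fact
  let ?B = "hbasis k :: (real^'n \<Rightarrow> real) set"
  let ?U = "{p \<in> hpoly k. \<forall>g\<in>G. p \<circ> g = (\<lambda>x. \<epsilon> g * p x)}"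
  let ?r = "fun_vs.representation ?B"
  define n where "n = real (card G)"
  have n: "n \<noteq> 0" using finite_group id_mem by (auto simp: n_def)
  define E where "E p = (\<lambda>x. 1 / n * (\<Sum>g\<in>G. \<epsilon> g * p (g x)))" for p :: "real^'n \<Rightarrow> real"
  have E_eq: "E p = (\<lambda>x. 1 / n * (\<Sum>g\<in>G. (\<lambda>x. \<epsilon> g * (p \<circ> g) x)) x)" for p
    by (auto simp: E_def sum_fun_apply)
  have comp: "b \<circ> g \<in> fun_vs.span ?B" if "b \<in> fun_vs.span ?B" "g \<in> G" for b g
    using hpoly_comp_linear[OF linear_mem[OF that(2)], of b k] that(1) by (simp only: hbasis(3))
  have EB: "E p \<in> fun_vs.span ?B" if "p \<in> fun_vs.span ?B" for p
    unfolding E_eq by (intro fun_vs.span_scale fun_vs.span_sum comp that)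
  have "(\<Sum>b\<in>?B. ?r (E b) b) = real (fun_vs.dim ?U)"
  proof (rule fun_vs.sum_representation_projection[OF hbasis(2,1), where U = ?U and E = E])
    show "fun_vs.subspace ?U"
      using subspace_hpoly[of k] unfolding fun_vs.subspace_def
      by (auto simp: fun_eq_iff algebra_simps)
    show "?U \<subseteq> fun_vs.span ?B" by (auto simp: hbasis(3))
    show "E (p + q) = E p + E q" for p q
      by (auto simp: E_def sum.distrib algebra_simps)
    show "E (\<lambda>x. c * p x) = (\<lambda>x. c * E p x)" for c p
      by (auto simp: E_def sum_distrib_left mult.left_commute intro!: ext sum.cong)
    show "E u = u" if "u \<in> ?U" for u
    proof
      fix x
      have "(\<Sum>g\<in>G. \<epsilon> g * u (g x)) = (\<Sum>g\<in>G. u x)"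
      proof (rule sum.cong[OF refl])
        fix g assume g: "g \<in> G"
        then have "u \<circ> g = (\<lambda>x. \<epsilon> g * u x)" using that by blast
        then have "u (g x) = \<epsilon> g * u x" by (metis comp_apply)
        then show "\<epsilon> g * u (g x) = u x" using \<epsilon>(1)[OF g] by (simp add: mult.assoc[symmetric])
      qed
      then show "E u x = u x" using n by (simp add: E_def n_def)
    qed
    show "E p \<in> ?U" if p: "p \<in> fun_vs.span ?B" for p
    proof -
      have "E p \<circ> h = (\<lambda>x. \<epsilon> h * E p x)" if h: "h \<in> G" for h
      proof
        fix x
        have "(\<Sum>g\<in>G. \<epsilon> g * p (g (h x))) = (\<Sum>g\<in>G. \<epsilon> h * (\<epsilon> g * p (g x)))"
        proof (rule sum.reindex_bij_witness[of _ "\<lambda>g. g \<circ> ginv h" "\<lambda>g. g \<circ> h"])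
          show "(g \<circ> h) \<circ> ginv h = g" "(g \<circ> ginv h) \<circ> h = g" for g
            using h by (auto simp: fun_eq_iff)
          show "g \<circ> h \<in> G" "g \<circ> ginv h \<in> G" if "g \<in> G" for g
            using comp_mem inv_mem h that by blast+
          show "\<epsilon> h * (\<epsilon> (g \<circ> h) * p ((g \<circ> h) x)) = \<epsilon> g * p (g (h x))" if "g \<in> G" for g
          proof -
            have "\<epsilon> h * (\<epsilon> g * \<epsilon> h) = \<epsilon> g" using \<epsilon>(1)[OF h] by (simp add: mult.left_commute)
            then show ?thesis by (simp add: \<epsilon>(2)[OF that h] mult.assoc[symmetric])
          qed
        qed
        then show "(E p \<circ> h) x = \<epsilon> h * E p x"
          by (simp add: E_def sum_distrib_left[symmetric])
      qed
      then show ?thesis using EB[OF p] by (auto simp: hbasis(3))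
    qed
  qed
  moreover have "?r (E b) b = 1 / n * (\<Sum>g\<in>G. \<epsilon> g * ?r (b \<circ> g) b)" if "b \<in> ?B" for b
  proof -
    note bs = comp[OF fun_vs.span_base[OF that]]
    have "?r (E b) b =
        1 / n * ?r (\<Sum>g\<in>G. (\<lambda>x. \<epsilon> g * (b \<circ> g) x)) b"
      unfolding E_eq
      by (subst fun_vs.representation_scale[OF hbasis(2)])
        (intro fun_vs.span_sum fun_vs.span_scale bs, assumption, rule refl)
    also have "?r (\<Sum>g\<in>G. (\<lambda>x. \<epsilon> g * (b \<circ> g) x)) b =
        (\<Sum>g\<in>G. ?r (\<lambda>x. \<epsilon> g * (b \<circ> g) x) b)"
      by (subst fun_vs.representation_sum[OF hbasis(2)]) (intro fun_vs.span_scale bs, assumption, rule refl)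
    also have "\<dots> = (\<Sum>g\<in>G. \<epsilon> g * ?r (b \<circ> g) b)"
      by (intro sum.cong refl) (subst fun_vs.representation_scale[OF hbasis(2)], intro bs, simp_all)
    finally show ?thesis .
  qed
  then have "(\<Sum>b\<in>?B. ?r (E b) b) =
      1 / n * (\<Sum>b\<in>?B. \<Sum>g\<in>G. \<epsilon> g * ?r (b \<circ> g) b)"
    by (simp only: sum_distrib_left cong: sum.cong)
  ultimately have "real (fun_vs.dim ?U) = 1 / n * (\<Sum>b\<in>?B. \<Sum>g\<in>G. \<epsilon> g * ?r (b \<circ> g) b)"
    by (simp only:)
  also have "\<dots> = 1 / n * (\<Sum>g\<in>G. \<epsilon> g * ptrace k g)"
    by (subst sum.swap) (simp add: ptrace_def sum_distrib_left)
  finally have "real (fun_vs.dim ?U) = 1 / n * (\<Sum>g\<in>G. \<epsilon> g * ptrace k g)" .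
  moreover have "n * r = s" if "r = 1 / n * s" for r s using n that by simp
  ultimately have "n * real (fun_vs.dim ?U) = (\<Sum>g\<in>G. \<epsilon> g * ptrace k g)" by blast
  then show ?thesis by (simp only: n_def)
qed

lemma sum_ptrace_invariants:
  fixes G :: "(real^'n::finite \<Rightarrow> real^'n) set"
  assumes "refl_group G"
  shows "(\<Sum>g\<in>G. ptrace k g) = real (card G) * real (fun_vs.dim (inv_hpoly G k))"
  using sum_ptrace[OF assms, of "\<lambda>_. 1" k] by (simp add: inv_hpoly_def)

section \<open>Skew invariants\<close>

text \<open>On the line through \<open>x\<close> in direction \<open>y\<close> the linear factors
  are nonzero for small t different from 0; there \<open>q\<close> vanishes, and continuity carries
  this to \<open>x\<close>.\<close>

lemma prod_inner_cancel:
  fixes q :: "'v::euclidean_space \<Rightarrow> real"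
  assumes B: "finite B" "\<And>a. a \<in> B \<Longrightarrow> a \<bullet> y \<noteq> 0"
    and q: "continuous_on UNIV q" and z: "\<And>t. (\<Prod>a\<in>B. a \<bullet> (x + t *\<^sub>R y)) * q (x + t *\<^sub>R y) = 0"
  shows "q x = 0"
proof -
  have "\<forall>\<^sub>F t in at 0. \<forall>a\<in>B. a \<bullet> (x + t *\<^sub>R y) \<noteq> 0"
  proof (rule eventually_ball_finite[OF B(1)], rule ballI)
    fix a assume a: "a \<in> B"
    have "eventually (\<lambda>t. t \<noteq> - (a \<bullet> x) / (a \<bullet> y)) (at 0)"
      by (rule eventually_neq_at_within)
    then show "\<forall>\<^sub>F t in at 0. a \<bullet> (x + t *\<^sub>R y) \<noteq> 0"
      by eventually_elim (use B(2)[OF a] in \<open>simp add: inner_add_right field_simps eq_neg_iff_add_eq_0\<close>)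
  qed
  then have "\<forall>\<^sub>F t in at 0. q (x + t *\<^sub>R y) = 0"
    by eventually_elim (use z B(1) in auto)
  moreover have "((\<lambda>t. q (x + t *\<^sub>R y)) \<longlongrightarrow> q (x + 0 *\<^sub>R y)) (at 0)"
  proof (rule isCont_tendsto_compose[of _ q])
    show "isCont q (x + 0 *\<^sub>R y)" using q by (simp add: continuous_on_eq_continuous_at)
  qed (intro tendsto_intros)
  ultimately have "((\<lambda>t. 0) \<longlongrightarrow> q x) (at (0::real))"
    using tendsto_cong by fastforce
  then show ?thesis by (simp add: tendsto_const_iff)
qed

lemma real_polynomial_function_continuous: "rpf q \<Longrightarrow> continuous_on X q"
  for q :: "'v::euclidean_space \<Rightarrow> real"
  by (intro continuous_on_polymonial_function) (simp add: real_polynomial_function_eq[symmetric])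

text \<open>For a unit vector \<open>a\<close> this is division with remainder by the linear form of
  \<open>a\<close>, the remainder being \<open>p\<close> composed with the projection to the
  hyperplane. Products are handled as in the Leibniz rule.\<close>

lemma real_polynomial_function_hyperplane_diff:
  fixes p :: "'v::euclidean_space \<Rightarrow> real"
  assumes "rpf p"
  shows "\<exists>q. rpf q \<and> (\<forall>x. p x - p (x - (a \<bullet> x) *\<^sub>R a) = (a \<bullet> x) * q x)"
proof -
  define h where "h x = x - (a \<bullet> x) *\<^sub>R a" for x
  have "linear h" by (intro linearI) (auto simp: h_def inner_add_right algebra_simps)
  then have h: "polynomial_function h"
    by (intro polynomial_function_bounded_linear) (simp only: linear_conv_bounded_linear)
  show ?thesis
    using assms unfolding h_def[symmetric]
  proof (induction p rule: real_polynomial_function.induct)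
    case (linear f)
    interpret f: bounded_linear f by fact
    show ?case
      by (intro exI[of _ "\<lambda>_. f a"] conjI rpf_const) (simp add: h_def f.diff f.scaleR)
  next
    case (const c)
    show ?case by (intro exI[of _ "\<lambda>_. 0"] conjI rpf_const) simp
  next
    case (add f g)
    then obtain q r where qr: "rpf q" "\<And>x. f x - f (h x) = (a \<bullet> x) * q x"
      "rpf r" "\<And>x. g x - g (h x) = (a \<bullet> x) * r x" by blast
    then show ?case
      by (intro exI[of _ "\<lambda>x. q x + r x"] conjI rpf_add allI) (simp_all only: add_diff_add qr distrib_left)
  next
    case (mult f g)
    then obtain q r where qr: "rpf q" "\<And>x. f x - f (h x) = (a \<bullet> x) * q x"
      "rpf r" "\<And>x. g x - g (h x) = (a \<bullet> x) * r x" by blast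
    have "rpf (\<lambda>x. f (h x))"
      using real_polynomial_function_compose[OF h mult.hyps(1)] by (simp only: comp_def)
    then have "rpf (\<lambda>x. q x * g x + f (h x) * r x)"
      using qr mult.hyps by (intro rpf_add rpf_mult)
    moreover have "f x * g x - f (h x) * g (h x) = (a \<bullet> x) * (q x * g x + f (h x) * r x)" for x
    proof -
      have "f x * g x - f (h x) * g (h x) = (f x - f (h x)) * g x + f (h x) * (g x - g (h x))"
        by (simp only: left_diff_distrib right_diff_distrib diff_add_cancel add_diff_eq)
      then show ?thesis unfolding qr by (simp add: algebra_simps)
    qed
    ultimately show ?case by blast
  qed
qed

text \<open>The linear factors are split off one at a time. The quotient by the earlier ones still
  vanishes on the hyperplane of \<open>b\<close>, because the earlier factors are nonzero in a
  generic direction \<open>y\<close> of that hyperplane.\<close>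

lemma vanishing_on_hyperplanes:
  fixes p :: "'v::euclidean_space \<Rightarrow> real"
  assumes "finite B" "rpf p"
    and "\<And>a. a \<in> B \<Longrightarrow> norm a = 1" "\<And>a b. a \<in> B \<Longrightarrow> b \<in> B \<Longrightarrow> a \<noteq> - b"
    and "\<And>a x. a \<in> B \<Longrightarrow> a \<bullet> x = 0 \<Longrightarrow> p x = 0"
  shows "\<exists>q. rpf q \<and> (\<forall>x. p x = (\<Prod>a\<in>B. a \<bullet> x) * q x)"
  using assms
proof (induction B rule: finite_induct)
  case empty
  then show ?case by auto
next
  case (insert b B)
  have "\<exists>q. rpf q \<and> (\<forall>x. p x = (\<Prod>a\<in>B. a \<bullet> x) * q x)"
    by (rule insert.IH) (use insert.prems in \<open>blast+\<close>)
  then obtain q where q: "rpf q" "\<And>x. p x = (\<Prod>a\<in>B. a \<bullet> x) * q x" by blast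
  obtain y where y: "b \<bullet> y = 0" "\<And>a. a \<in> B \<Longrightarrow> a \<noteq> b \<Longrightarrow> a \<noteq> - b \<Longrightarrow> a \<bullet> y \<noteq> 0"
    by (rule generic_on_hyperplane[OF insert.hyps(1), of b]) (use insert.prems(2) that in auto)
  have "q x = 0" if x: "b \<bullet> x = 0" for x
  proof (rule prod_inner_cancel[OF insert.hyps(1)])
    show "a \<bullet> y \<noteq> 0" if "a \<in> B" for a
      using y(2)[OF that] insert.hyps(2) insert.prems(3) that by blast
    show "continuous_on UNIV q" by (rule real_polynomial_function_continuous[OF q(1)])
    show "(\<Prod>a\<in>B. a \<bullet> (x + t *\<^sub>R y)) * q (x + t *\<^sub>R y) = 0" for t
      unfolding q(2)[symmetric] using x y(1) by (intro insert.prems(4)[of b]) (auto simp: inner_add_right)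
  qed
  moreover obtain r where r: "rpf r" "\<And>x. q x - q (x - (b \<bullet> x) *\<^sub>R b) = (b \<bullet> x) * r x"
    using real_polynomial_function_hyperplane_diff[OF q(1)] by blast
  moreover have "b \<bullet> (x - (b \<bullet> x) *\<^sub>R b) = 0" for x
    using insert.prems(2)[of b] by (simp add: inner_diff_right dot_square_norm)
  ultimately have "q x = (b \<bullet> x) * r x" for x by (metis diff_zero)
  then show ?case using q(2) r(1) insert.hyps by (intro exI[of _ r]) (simp add: mult_ac)
qed

section \<open>The product of the positive roots and the sign character\<close>

definition pos_roots :: "('v::euclidean_space \<Rightarrow> 'v) set \<Rightarrow> 'v \<Rightarrow> 'v set" where
  "pos_roots G c = {a \<in> roots G. a \<bullet> c > 0}"

definition root_prod :: "('v::euclidean_space \<Rightarrow> 'v) set \<Rightarrow> 'v \<Rightarrow> 'v \<Rightarrow> real" where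
  "root_prod G c x = (\<Prod>a\<in>pos_roots G c. a \<bullet> x)"

definition fixed :: "('v \<Rightarrow> 'v) \<Rightarrow> 'v set" where
  "fixed g = {x. g x = x}"

lemma prod_inner_polynomial:
  fixes B :: "'v::euclidean_space set"
  assumes "finite B"
  shows "rpf (\<lambda>x. \<Prod>a\<in>B. a \<bullet> x)"
  using assms by (intro real_polynomial_function_prod rpf_linear bounded_linear_inner_right)

lemma prod_inner_homogeneous:
  fixes B :: "'v::euclidean_space set"
  shows "homogeneous (card B) (\<lambda>x. \<Prod>a\<in>B. a \<bullet> x)"
  by (simp add: homogeneous_def prod.distrib)

locale refl_chamber = refl_group G for G :: "('v::euclidean_space \<Rightarrow> 'v) set" +
  fixes c :: 'v
  assumes c: "regular G c"
begin

lemma pos_roots_finite: "finite (pos_roots G c)"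
  using finite_roots_group by (simp add: pos_roots_def)

lemma pos_roots_cases: "a \<in> roots G \<Longrightarrow> a \<in> pos_roots G c \<or> - a \<in> pos_roots G c"
  using c roots_minus by (force simp: pos_roots_def generic_def)

lemma pos_roots_uminus: "a \<in> pos_roots G c \<Longrightarrow> - a \<notin> pos_roots G c"
  by (auto simp: pos_roots_def)

text \<open>The reflection permutes the positive roots other than its own up to signs. The product
  of these signs is found without counting them: at a point fixed by the reflection and off all
  other hyperplanes, the remaining product is nonzero and unchanged, so the sign is 1. The
  reflection's own factor gives -1.\<close>

lemma root_prod_reflection:
  assumes "b \<in> roots G"
  shows "root_prod G c (reflection b x) = - root_prod G c x"
proof -
  let ?B = "pos_roots G c"
  obtain b' where b': "b' \<in> ?B" "reflection b = reflection b'"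
    using pos_roots_cases[OF assms] by (metis reflection_minus)
  let ?s = "reflection b'"
  have bR: "b' \<in> roots G" using b' by (simp add: pos_roots_def)
  have bn: "norm b' = 1" by (rule roots_norm[OF bR])
  define \<tau> where "\<tau> a = (if ?s a \<in> ?B then ?s a else - ?s a)" for a
  define \<eta> where "\<eta> a = (if ?s a \<in> ?B then 1 else - 1 :: real)" for a
  let ?P = "\<lambda>x. \<Prod>a\<in>?B - {b'}. a \<bullet> x"
  have lin: "?s (- a) = - ?s a" for a by (simp add: linear_neg linear_reflection)
  have sB: "?s a \<in> ?B \<or> - ?s a \<in> ?B" if "a \<in> ?B" for a
    using that pos_roots_cases root_image[OF reflection_mem[OF bR]] by (auto simp: pos_roots_def)
  have \<tau>B: "\<tau> a \<in> ?B" if "a \<in> ?B" for a using sB[OF that] by (auto simp: \<tau>_def)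
  have \<tau>\<tau>: "\<tau> (\<tau> a) = a" if "a \<in> ?B" for a
    using sB[OF that] that pos_roots_uminus by (auto simp: \<tau>_def lin)
  have \<tau>b: "\<tau> b' = b'" using b' pos_roots_uminus by (simp add: \<tau>_def reflection_self)
  have bij: "bij_betw \<tau> (?B - {b'}) (?B - {b'})"
  proof (rule bij_betw_byWitness[of _ \<tau>])
    have "\<tau> a \<noteq> b'" if "a \<in> ?B - {b'}" for a using \<tau>\<tau>[of a] \<tau>b that by auto
    then show "\<tau> ` (?B - {b'}) \<subseteq> ?B - {b'}" "\<tau> ` (?B - {b'}) \<subseteq> ?B - {b'}"
      using \<tau>B by auto
  qed (use \<tau>\<tau> in auto)
  have P: "?P (?s x) = (\<Prod>a\<in>?B - {b'}. \<eta> a) * ?P x" for x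
  proof -
    have "?P (?s x) = (\<Prod>a\<in>?B - {b'}. \<eta> a * (\<tau> a \<bullet> x))"
      by (intro prod.cong refl) (simp add: \<eta>_def \<tau>_def reflection_self_adjoint)
    also have "\<dots> = (\<Prod>a\<in>?B - {b'}. \<eta> a) * (\<Prod>a\<in>?B - {b'}. \<tau> a \<bullet> x)"
      by (rule prod.distrib)
    also have "(\<Prod>a\<in>?B - {b'}. \<tau> a \<bullet> x) = ?P x"
      by (rule prod.reindex_bij_betw[OF bij])
    finally show ?thesis .
  qed
  obtain y where y: "b' \<bullet> y = 0" "\<And>a. a \<in> ?B \<Longrightarrow> a \<noteq> b' \<Longrightarrow> a \<noteq> - b' \<Longrightarrow> a \<bullet> y \<noteq> 0"
    by (rule generic_on_hyperplane[OF pos_roots_finite _ bn]) (auto simp: pos_roots_def roots_norm)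
  have "?s y = y" using y(1) bn by (subst reflection_fixes_iff) auto
  moreover have "?P y \<noteq> 0"
    using y(2) pos_roots_finite pos_roots_uminus b'(1) by (auto simp: prod_zero_iff)
  ultimately have "(\<Prod>a\<in>?B - {b'}. \<eta> a) = 1" using P[of y] by simp
  then have P': "?P (?s x) = ?P x" by (simp add: P)
  have split: "root_prod G c x = (b' \<bullet> x) * ?P x" for x
    unfolding root_prod_def by (rule prod.remove[OF pos_roots_finite b'(1)])
  have "b' \<bullet> ?s x = - (b' \<bullet> x)"
    by (metis inner_minus_left reflection_self reflection_self_adjoint)
  then show ?thesis by (simp add: split P' b'(2))
qed

lemma root_prod_nz: "root_prod G c c \<noteq> 0"
  unfolding root_prod_def using pos_roots_finite by (auto simp: pos_roots_def)

text \<open>The determinant on \<open>G\<close>, read off from its effect on the root product;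
  multiplicativity is then immediate.\<close>

definition sign :: "('v \<Rightarrow> 'v) \<Rightarrow> real" where
  "sign g = root_prod G c (g c) / root_prod G c c"

lemma root_prod_sign: "g \<in> G \<Longrightarrow> root_prod G c (g x) = sign g * root_prod G c x"
proof -
  assume "g \<in> G"
  then have "\<exists>s. \<forall>x. root_prod G c (g x) = s * root_prod G c x"
  proof (induction rule: group_induct)
    case id
    show ?case by (intro exI[of _ 1]) simp
  next
    case (refl a h)
    then obtain s where "\<forall>x. root_prod G c (h x) = s * root_prod G c x" by blast
    then show ?case using root_prod_reflection[OF refl(1)] by (intro exI[of _ "- s"]) simp
  qed
  then obtain s where s: "\<And>x. root_prod G c (g x) = s * root_prod G c x" by blast
  then show ?thesis using root_prod_nz by (simp add: sign_def)
qed

lemma sign_comp: "g \<in> G \<Longrightarrow> h \<in> G \<Longrightarrow> sign (g \<circ> h) = sign g * sign h"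
  using root_prod_nz by (simp add: sign_def[of "g \<circ> h"] root_prod_sign)

lemma sign_id: "sign id = 1"
  using root_prod_nz by (simp add: sign_def)

lemma sign_reflection: "a \<in> roots G \<Longrightarrow> sign (reflection a) = -1"
  using root_prod_nz by (simp add: sign_def root_prod_reflection)

lemma sign_square: "g \<in> G \<Longrightarrow> sign g * sign g = 1"
proof (induction rule: group_induct)
  case (refl a h)
  then have "sign (reflection a \<circ> h) = - sign h"
    by (simp only: sign_comp[OF reflection_mem] sign_reflection mult_minus1)
  then show ?case using refl by (simp only: minus_mult_minus)
qed (simp only: sign_id mult_1)

lemma subspace_fixed: "g \<in> G \<Longrightarrow> subspace (fixed g)"
  using linear_mem by (auto simp: subspace_def fixed_def linear_0 linear_add linear_cmul)

text \<open>At a generic point of the fixed space, the stabilizer contains \<open>g\<close> and is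
  nontrivial, so some root vanishes there and, by genericity, on the whole fixed space.\<close>

lemma root_orthogonal_fixed:
  assumes "g \<in> G" "g \<noteq> id"
  obtains a where "a \<in> roots G" "\<And>x. x \<in> fixed g \<Longrightarrow> a \<bullet> x = 0"
proof -
  obtain x where x: "x \<in> fixed g" "\<And>a v. a \<in> roots G \<Longrightarrow> a \<bullet> x = 0 \<Longrightarrow> v \<in> fixed g \<Longrightarrow> a \<bullet> v = 0"
    using subspace_generic_point[OF finite_roots_group subspace_fixed[OF assms(1)]] by blast
  have "g \<in> stab G x" using x(1) assms(1) by (simp add: stab_def fixed_def)
  then have "\<exists>a\<in>roots G. a \<bullet> x = 0"
    using stab_fixes[of g x] assms(2) by (metis eq_id_iff)
  then show ?thesis using that x(2) by blast
qed

text \<open>A root \<open>a\<close> orthogonal to the fixed space of \<open>g\<close> has the form \<open>y - g y\<close>, and then its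
  reflection maps \<open>g y\<close> back to \<open>y\<close>.\<close>

lemma dim_fixed_reflection:
  assumes g: "g \<in> G" and a: "a \<in> roots G" "\<And>x. x \<in> fixed g \<Longrightarrow> a \<bullet> x = 0"
  shows "dim (fixed (reflection a \<circ> g)) = Suc (dim (fixed g))"
proof -
  let ?F = "fixed g" and ?F' = "fixed (reflection a \<circ> g)"
  \<comment> \<open>\<open>1 - g\<close> maps the orthogonal complement of the fixed space
    injectively into itself, hence onto; as it contains \<open>a\<close>, this yields
    \<open>y\<close> with \<open>a = y - g y\<close>.\<close>
  define K where "K = {x. \<forall>v\<in>?F. v \<bullet> x = 0}"
  define f where "f x = x - g x" for x
  have K: "subspace K" by (auto simp: K_def subspace_def inner_add_right)
  have linf: "linear f"
    using linear_mem[OF g] by (auto intro!: linearI simp: f_def linear_add linear_cmul algebra_simps)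
  have "f ` K \<subseteq> K"
  proof
    fix z assume "z \<in> f ` K"
    then obtain x where x: "z = x - g x" by (auto simp: f_def)
    have "v \<bullet> z = 0" if "v \<in> ?F" for v
      using that inner_mem[OF g, of v x] by (simp add: x inner_diff_right fixed_def)
    then show "z \<in> K" by (simp add: K_def)
  qed
  moreover have "dim (f ` K) = dim K"
  proof (rule dim_image_eq[OF linf])
    show "inj_on f (span K)"
    proof (rule linear_injective_on_subspace_0[OF linf subspace_span, THEN iffD2], intro ballI impI)
      fix x assume x: "x \<in> span K" "f x = 0"
      then have "x \<in> K" "x \<in> ?F" using K by (auto simp: f_def fixed_def span_eq_iff[THEN iffD2])
      then have "x \<bullet> x = 0" by (auto simp: K_def)
      then show "x = 0" by simp
    qed
  qed
  ultimately have "f ` K = K"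
    using K linf by (intro subspace_dim_equal linear_subspace_image) auto
  moreover have "a \<in> K" using a(2) by (auto simp: K_def inner_commute)
  ultimately obtain y where y: "a = y - g y" by (auto simp: f_def)
  have an: "norm a = 1" by (rule roots_norm[OF a(1)])
  have "g y \<bullet> g y = y \<bullet> y" by (rule inner_mem[OF g])
  moreover have gy: "g y = y - a" using y by simp
  \<comment> \<open>Because \<open>g\<close> preserves the length of \<open>y\<close>, the vector
    \<open>g y = y - a\<close> is exactly the mirror image of \<open>y\<close>.\<close>
  ultimately have ay: "2 * (a \<bullet> y) = a \<bullet> a"
    by (simp add: inner_diff_left inner_diff_right inner_commute)
  have "reflection a y = g y"
    using an ay by (simp add: reflection_unit gy dot_square_norm)
  then have y': "y \<in> ?F'" by (simp add: fixed_def) (metis reflection_involution)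
  \<comment> \<open>The old fixed space is the section of the new one by the hyperplane of
    \<open>a\<close>, and \<open>y\<close> lies off that hyperplane.\<close>
  have F: "?F = ?F' \<inter> {x. a \<bullet> x = 0}"
  proof (intro Set.set_eqI iffI)
    fix x assume "x \<in> ?F"
    then show "x \<in> ?F' \<inter> {x. a \<bullet> x = 0}"
      using a(2)[of x] an by (auto simp: fixed_def reflection_unit)
  next
    fix x assume x: "x \<in> ?F' \<inter> {x. a \<bullet> x = 0}"
    then have "g x = reflection a x" by (simp add: fixed_def) (metis reflection_involution)
    then show "x \<in> ?F" using x an by (simp add: fixed_def reflection_unit)
  qed
  have "a \<bullet> y \<noteq> 0" using ay an by (auto simp: dot_square_norm)
  moreover have "reflection a \<circ> g \<in> G" using comp_mem reflection_mem a(1) g by blast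
  ultimately show ?thesis
    using dim_Int_hyperplane[OF subspace_fixed y'] F by simp
qed

text \<open>Induction on the codimension of the fixed space: multiplying by a suitable reflection
  enlarges this space by one dimension and changes the sign. The sum in the exponent has the parity
  of the codimension.\<close>

lemma sign_eq_dim_fixed: "g \<in> G \<Longrightarrow> sign g = (-1) ^ (DIM('v) + dim (fixed g))"
proof (induction "DIM('v) - dim (fixed g)" arbitrary: g rule: less_induct)
  case less
  show ?case
  proof (cases "g = id")
    case True
    then have "fixed g = UNIV" by (auto simp: fixed_def)
    then show ?thesis by (simp add: True sign_id power_add flip: power_mult_distrib)
  next
    case False
    obtain a where a: "a \<in> roots G" "\<And>x. x \<in> fixed g \<Longrightarrow> a \<bullet> x = 0"
      using root_orthogonal_fixed[OF less.prems False] by blast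
    let ?h = "reflection a \<circ> g"
    have d: "dim (fixed ?h) = Suc (dim (fixed g))" by (rule dim_fixed_reflection[OF less.prems a])
    have h: "?h \<in> G" using comp_mem reflection_mem a(1) less.prems by blast
    have "dim (fixed ?h) \<le> DIM('v)" by (rule dim_subset_UNIV)
    then have "DIM('v) - dim (fixed ?h) < DIM('v) - dim (fixed g)" using d by linarith
    from less.hyps[OF this h] have "sign ?h = - ((-1) ^ (DIM('v) + dim (fixed g)))" unfolding d by simp
    moreover have "sign ?h = - sign g"
      by (simp only: sign_comp[OF reflection_mem[OF a(1)] less.prems] sign_reflection[OF a(1)] mult_minus1)
    ultimately show ?thesis by simp
  qed
qed

definition skew :: "nat \<Rightarrow> ('v \<Rightarrow> real) set" where
  "skew k = {p \<in> hpoly k. \<forall>g\<in>G. p \<circ> g = (\<lambda>x. sign g * p x)}"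

lemma root_prod_cancel:
  assumes "continuous_on UNIV q" "\<And>x. root_prod G c x * q x = 0"
  shows "q x = 0"
proof (rule prod_inner_cancel[OF pos_roots_finite])
  show "a \<bullet> c \<noteq> 0" if "a \<in> pos_roots G c" for a using that by (simp add: pos_roots_def)
  show "(\<Prod>a\<in>pos_roots G c. a \<bullet> (x + t *\<^sub>R c)) * q (x + t *\<^sub>R c) = 0" for t
    using assms(2) by (simp add: root_prod_def)
qed (rule assms(1))

lemma root_prod_hpoly: "root_prod G c \<in> hpoly (card (pos_roots G c))"
  using prod_inner_polynomial[OF pos_roots_finite] prod_inner_homogeneous[of "pos_roots G c"]
  by (simp add: hpoly_def root_prod_def[abs_def])

text \<open>On a root hyperplane the reflection fixes \<open>x\<close> and has sign -1, so the skew
  \<open>p\<close> is zero there.\<close>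

lemma skew_divisible:
  assumes "p \<in> skew k"
  obtains q where "rpf q" "\<And>x. p x = root_prod G c x * q x"
proof -
  have p: "rpf p" "\<And>g x. g \<in> G \<Longrightarrow> p (g x) = sign g * p x"
    using assms by (auto simp: skew_def hpoly_def fun_eq_iff)
  have "\<exists>q. rpf q \<and> (\<forall>x. p x = (\<Prod>a\<in>pos_roots G c. a \<bullet> x) * q x)"
  proof (rule vanishing_on_hyperplanes[OF pos_roots_finite p(1)])
    show "norm a = 1" if "a \<in> pos_roots G c" for a using that roots_norm[of a G] by (simp add: pos_roots_def)
    show "a \<noteq> - b" if "a \<in> pos_roots G c" "b \<in> pos_roots G c" for a b
      using that pos_roots_uminus by blast
    show "p x = 0" if a: "a \<in> pos_roots G c" "a \<bullet> x = 0" for a x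
    proof -
      have aR: "a \<in> roots G" using a by (simp add: pos_roots_def)
      then have "reflection a x = x" using a roots_nz[OF aR] by (simp add: reflection_fixes_iff)
      then show ?thesis using p(2)[OF reflection_mem[OF aR], of x] by (simp add: sign_reflection[OF aR])
    qed
  qed
  then show ?thesis using that by (auto simp: root_prod_def)
qed

lemma root_prod_mult_skew:
  assumes "q \<in> inv_hpoly G k"
  shows "(\<lambda>x. root_prod G c x * q x) \<in> skew (k + card (pos_roots G c))"
proof -
  have q: "rpf q" "homogeneous k q" "\<And>g x. g \<in> G \<Longrightarrow> q (g x) = q x"
    using assms by (auto simp: inv_hpoly_def hpoly_def fun_eq_iff)
  then show ?thesis
    using root_prod_hpoly root_prod_sign
    by (auto simp: skew_def hpoly_def homogeneous_def power_add fun_eq_iff intro: rpf_mult)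
qed

end

text \<open>Multiplication by the root product maps the invariants of degree \<open>k - N\<close>
  bijectively onto the skew invariants of degree \<open>k\<close>.\<close>

lemma dim_skew:
  fixes G :: "(real^'n::finite \<Rightarrow> real^'n) set"
  assumes "refl_chamber G c"
  defines "N \<equiv> card (pos_roots G c)"
  shows "fun_vs.dim (refl_chamber.skew G c k) = (if k < N then 0 else fun_vs.dim (inv_hpoly G (k - N)))"
proof -
  interpret refl_chamber G c by fact
  let ?\<pi> = "root_prod G c"
  have skew_eq: "(k < N \<longrightarrow> p = 0) \<and> (\<not> k < N \<longrightarrow> (\<exists>q\<in>inv_hpoly G (k - N). p = (\<lambda>x. ?\<pi> x * q x)))" if p: "p \<in> skew k" for p
  proof -
    obtain q where q: "rpf q" "\<And>x. p x = ?\<pi> x * q x"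
      by (rule skew_divisible[OF p]) (rule that)
    \<comment> \<open>The quotient is so far just some polynomial; comparing degrees shows that only
      its part of degree \<open>k - N\<close> contributes.\<close>
    obtain n r where r: "\<And>j. r j \<in> hpoly j" "\<And>x. q x = (\<Sum>j\<le>n. r j x)"
      by (rule homogeneous_decomposition[OF q(1)]) (rule that)
    have px: "p x = (\<Sum>j\<in>{j \<in> {..n}. N + j = k}. ?\<pi> x * r j x)" for x
    proof (rule homogeneous_sum_component)
      show "homogeneous k p" using p by (simp add: skew_def hpoly_def)
      show "homogeneous (N + j) (\<lambda>x. ?\<pi> x * r j x)" for j
        using r(1)[of j] root_prod_hpoly by (simp add: hpoly_def homogeneous_def power_add N_def)
      show "p x = (\<Sum>j\<le>n. ?\<pi> x * r j x)" for x by (simp add: q r sum_distrib_left)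
    qed simp
    show ?thesis
    proof (cases "k < N")
      case True
      then have "{j \<in> {..n}. N + j = k} = {}" by auto
      then have "p x = 0" for x by (simp only: px sum.empty)
      then show ?thesis using True by (simp add: fun_eq_iff)
    next
      case False
      define s where "s = (if k - N \<le> n then r (k - N) else 0)"
      have "{j \<in> {..n}. N + j = k} = (if k - N \<le> n then {k - N} else {})" using False by auto
      then have ps: "p x = ?\<pi> x * s x" for x unfolding px by (simp add: s_def)
      have sh: "s \<in> hpoly (k - N)"
        by (auto simp: s_def intro: r(1) fun_vs.subspace_0[OF subspace_hpoly])
      have "s \<circ> g = s" if g: "g \<in> G" for g
      proof
        fix x
        have sg: "rpf (s \<circ> g)" "rpf s"
          using sh hpoly_comp_linear[OF linear_mem[OF g] sh] by (simp_all only: hpoly_def mem_Collect_eq)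
        have "s (g x) - s x = 0"
        proof (rule root_prod_cancel)
          show "continuous_on UNIV (\<lambda>x. s (g x) - s x)"
            using sg by (intro real_polynomial_function_continuous real_polynomial_function_diff) (simp_all only: comp_def)
          show "?\<pi> x * (s (g x) - s x) = 0" for x
          proof -
            have "p (g x) = sign g * p x" using p g by (auto simp: skew_def fun_eq_iff)
            then have "sign g * (?\<pi> x * (s (g x) - s x)) = 0"
              by (simp add: ps root_prod_sign[OF g] algebra_simps)
            then show ?thesis using sign_square[OF g] by auto
          qed
        qed
        then show "(s \<circ> g) x = s x" by simp
      qed
      then have "s \<in> inv_hpoly G (k - N)" using sh by (simp add: inv_hpoly_def)
      then show ?thesis using False ps by (intro conjI impI bexI[of _ s]) auto
    qed
  qed
  show ?thesis
  proof (cases "k < N")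
    case True
    then have "skew k \<subseteq> {0}" using skew_eq by auto
    then have "fun_vs.dim (skew k) = 0"
      by (intro fun_vs.dim_unique[of "{}"]) (auto simp: fun_vs.span_empty fun_vs.independent_empty)
    then show ?thesis using True by simp
  next
    case False
    let ?I = "inv_hpoly G (k - N)"
    define M where "M q = (\<lambda>x. ?\<pi> x * q x)" for q
    obtain C where C: "C \<subseteq> ?I" "fun_vs.independent C" "?I \<subseteq> fun_vs.span C" "card C = fun_vs.dim ?I"
      using fun_vs.basis_exists[of ?I] by blast
    have Ch: "C \<subseteq> hpoly (k - N)" using C(1) by (auto simp: inv_hpoly_def)
    then have finC: "finite C"
      using fun_vs.independent_span_bound[OF hbasis(1) C(2)] by (simp add: hbasis(3))
    have Minj: "q = 0" if "q \<in> hpoly (k - N)" "M q = 0" for q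
    proof
      fix x
      show "q x = 0 x"
        using root_prod_cancel[of q x] that real_polynomial_function_continuous[of q UNIV]
        by (simp add: hpoly_def M_def fun_eq_iff)
    qed
    have indep: "\<forall>b\<in>C. u b = 0" if "\<forall>x. (\<Sum>b\<in>C. u b * M b x) = 0" for u
    proof -
      let ?q = "\<Sum>b\<in>C. (\<lambda>x. u b * b x)"
      have "?q \<in> hpoly (k - N)"
        using Ch subspace_hpoly[of "k - N"] by (intro fun_vs.subspace_sum fun_vs.subspace_scale) auto
      moreover have "M ?q = 0"
        using that by (simp add: M_def sum_fun_apply sum_distrib_left mult.left_commute fun_eq_iff)
      ultimately have "?q = 0" by (rule Minj)
      then show ?thesis using fun_vs.independentD[OF C(2) finC order_refl] by blast
    qed
    have sub: "fun_vs.subspace (skew k)"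
      using subspace_hpoly[of k] unfolding fun_vs.subspace_def skew_def
      by (auto simp: fun_eq_iff algebra_simps)
    have mem: "M q \<in> skew k" if "q \<in> C" for q
    proof -
      have "M q \<in> skew (k - N + N)"
        unfolding M_def N_def using C(1) that by (intro root_prod_mult_skew) (auto simp: N_def)
      then show ?thesis using False by simp
    qed
    have gen: "\<exists>u. \<forall>x. p x = (\<Sum>b\<in>C. u b * M b x)" if p: "p \<in> skew k" for p
    proof -
      obtain q where q: "q \<in> ?I" "p = M q" using skew_eq[OF p] False by (auto simp: M_def)
      then have "q \<in> fun_vs.span C" using C(3) by blast
      then obtain u where "q = (\<Sum>b\<in>C. (\<lambda>x. u b * b x))"
        using fun_vs.span_finite[OF finC] by auto
      then show ?thesis
        by (intro exI[of _ u]) (simp add: q(2) M_def sum_fun_apply sum_distrib_left mult.left_commute)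
    qed
    show ?thesis using fun_basis(4)[where b = M, OF finC sub mem indep gen] False C(4) by simp
  qed
qed

section \<open>Molien series of group elements and the alternating sum of Hilbert series\<close>

definition trace_fps :: "(real^'n::finite \<Rightarrow> real^'n) \<Rightarrow> real fps" where
  "trace_fps g = Abs_fps (\<lambda>k. ptrace k g)"

lemma sum_trace_fps:
  fixes G :: "(real^'n::finite \<Rightarrow> real^'n) set"
  assumes "refl_group G"
  shows "(\<Sum>g\<in>G. trace_fps g) = of_nat (card G) * hilbert G"
  by (rule fps_ext) (simp add: fps_sum_nth trace_fps_def hilbert_def sum_ptrace_invariants[OF assms] fps_of_nat[symmetric])

text \<open>Averaging against the sign counts skew invariants, which sit \<open>N\<close> degrees
  above the invariants; this is where q^N comes from.\<close>

lemma sum_sign_trace_fps: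
  fixes G :: "(real^'n::finite \<Rightarrow> real^'n) set"
  assumes "refl_chamber G c"
  shows "(\<Sum>g\<in>G. fps_const (refl_chamber.sign G c g) * trace_fps g) =
    of_nat (card G) * fps_X ^ card (pos_roots G c) * hilbert G"
proof (rule fps_ext)
  interpret refl_chamber G c by fact
  fix k
  have "(\<Sum>g\<in>G. sign g * ptrace k g) = real (card G) * real (fun_vs.dim (skew k))"
    unfolding skew_def by (rule sum_ptrace[OF refl_group_axioms sign_square sign_comp])
  then show "fps_nth (\<Sum>g\<in>G. fps_const (sign g) * trace_fps g) k =
      fps_nth (of_nat (card G) * fps_X ^ card (pos_roots G c) * hilbert G) k"
    using dim_skew[OF assms, of k]
    by (simp add: fps_sum_nth trace_fps_def hilbert_def fps_of_nat[symmetric] mult.assoc fps_X_power_mult_nth)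
qed

lemma fps_const_sum: "fps_const (sum f S) = (\<Sum>x\<in>S. fps_const (f x))"
  by (induction S rule: infinite_finite_induct) (auto simp flip: fps_const_add)

text \<open>A representative point; its stabilizer, and the hyperplanes separating it from another
  point, depend only on the face.\<close>

definition face_pt :: "'v::euclidean_space set \<Rightarrow> ('v \<Rightarrow> real) \<Rightarrow> 'v" where
  "face_pt A \<sigma> = (SOME x. face_sgn A x = \<sigma>)"

lemma face_sgn_face_pt: "\<sigma> \<in> range (face_sgn A) \<Longrightarrow> face_sgn A (face_pt A \<sigma>) = \<sigma>"
  unfolding face_pt_def by (rule someI_ex) auto

lemma face_sgn_eqD: "face_sgn A x = face_sgn A y \<Longrightarrow> a \<in> A \<Longrightarrow> sgn (a \<bullet> x) = sgn (a \<bullet> y)"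
  by (drule fun_cong[of _ _ a]) (simp add: face_sgn_def)

text \<open>The order of a stabilizer times its Hilbert series is the sum of the trace series of its
  elements. After exchanging sums, the faces belonging to one \<open>g\<close> are the cells of its
  fixed space, whose Euler sum is (-1)^(dim of that space) = (-1)^n sign g. What remains is the
  signed sum of the trace series.\<close>

lemma alternating_hilbert_sum:
  fixes G :: "(real^'n::finite \<Rightarrow> real^'n) set"
  assumes "refl_chamber G c"
  defines "A \<equiv> roots G"
  shows "(\<Sum>\<sigma>\<in>range (face_sgn A). (-1) ^ dim (face_span A \<sigma>) *
      (of_nat (card (stab G (face_pt A \<sigma>))) * hilbert (stab G (face_pt A \<sigma>)))) =
    (-1) ^ CARD('n) * (of_nat (card G) * fps_X ^ card (pos_roots G c) * hilbert G)"
proof -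
  let ?R = "range (face_sgn A)" and ?S = "\<lambda>\<sigma>. stab G (face_pt A \<sigma>)"
  let ?d = "\<lambda>\<sigma>. (-1 :: real fps) ^ dim (face_span A \<sigma>)"
  let ?t = "\<lambda>g \<sigma>. if g \<in> ?S \<sigma> then ?d \<sigma> * trace_fps g else 0"
  interpret refl_chamber G c by fact
  have A: "finite A" unfolding A_def by (rule finite_roots_group)
  have finR: "finite ?R" by (rule finite_face_sgn[OF A])
  have stab_trace: "of_nat (card (stab G x)) * hilbert (stab G x) = (\<Sum>g\<in>stab G x. trace_fps g)" for x
    by (rule sum_trace_fps[symmetric]) (unfold_locales, rule stab_frg)
  have fixed_sum: "(\<Sum>\<sigma>\<in>{\<sigma> \<in> ?R. g \<in> ?S \<sigma>}. (-1) ^ dim (face_span A \<sigma>)) = (-1) ^ CARD('n) * sign g"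
    if g: "g \<in> G" for g
  proof -
    \<comment> \<open>Whether \<open>g\<close> fixes a point depends only on the face containing
      it.\<close>
    have iff: "g x = x \<longleftrightarrow> g y = y" if "face_sgn A x = face_sgn A y" for x y
      using stab_fixes[of g x y] stab_fixes[of g y x] g face_sgn_eqD[OF that]
      by (auto simp: stab_def A_def) (metis sgn_0_0)+
    have set_eq: "{\<sigma> \<in> ?R. g \<in> ?S \<sigma>} = face_sgn A ` (fixed g \<inter> UNIV)"
    proof (intro Set.set_eqI iffI)
      fix \<sigma> assume "\<sigma> \<in> {\<sigma> \<in> ?R. g \<in> ?S \<sigma>}"
      then show "\<sigma> \<in> face_sgn A ` (fixed g \<inter> UNIV)"
        using face_sgn_face_pt[of \<sigma> A] by (intro image_eqI[of _ _ "face_pt A \<sigma>"]) (auto simp: stab_def fixed_def)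
    next
      fix \<sigma> assume "\<sigma> \<in> face_sgn A ` (fixed g \<inter> UNIV)"
      then obtain x where x: "\<sigma> = face_sgn A x" "g x = x" by (auto simp: fixed_def)
      then have "g (face_pt A \<sigma>) = face_pt A \<sigma>"
        using iff[of x "face_pt A \<sigma>"] face_sgn_face_pt[of \<sigma> A] by auto
      then show "\<sigma> \<in> {\<sigma> \<in> ?R. g \<in> ?S \<sigma>}" using x g by (auto simp: stab_def)
    qed
    \<comment> \<open>The spans of these faces lie inside the fixed space, so their dimensions are
      those occurring in the Euler sum for that space.\<close>
    have span: "face_span A \<sigma> \<subseteq> fixed g" if \<sigma>: "\<sigma> \<in> face_sgn A ` (fixed g \<inter> UNIV)" for \<sigma>
    proof
      fix y assume y: "y \<in> face_span A \<sigma>"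
      obtain x where "\<sigma> = face_sgn A x" "x \<in> fixed g" using \<sigma> by blast
      then have x: "\<sigma> = face_sgn A x" "g x = x" by (simp_all add: fixed_def)
      have "g y = y"
        by (rule stab_fixes[of g x]) (use x y g in \<open>auto simp: stab_def face_span_def face_sgn_def A_def\<close>)
      then show "y \<in> fixed g" by (simp add: fixed_def)
    qed
    have "(\<Sum>\<sigma>\<in>{\<sigma> \<in> ?R. g \<in> ?S \<sigma>}. (-1) ^ dim (face_span A \<sigma>)) =
      (\<Sum>\<sigma>\<in>face_sgn A ` (fixed g \<inter> UNIV). (-1) ^ dim (fixed g \<inter> face_span A \<sigma>) :: real)"
      unfolding set_eq by (intro sum.cong refl) (use span in \<open>simp add: Int_absorb1\<close>)
    also have "\<dots> = (-1) ^ dim (fixed g)"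
      using subspace_0[OF subspace_fixed[OF g]]
      by (intro euler_face_sum A subspace_fixed g) auto
    also have "\<dots> = (-1) ^ CARD('n) * sign g"
      by (simp add: sign_eq_dim_fixed[OF g] power_add flip: power_mult_distrib mult.assoc)
    finally show ?thesis .
  qed
  have "(\<Sum>\<sigma>\<in>?R. ?d \<sigma> * (of_nat (card (?S \<sigma>)) * hilbert (?S \<sigma>))) =
    (\<Sum>\<sigma>\<in>?R. \<Sum>g\<in>G. ?t g \<sigma>)"
  proof (rule sum.cong[OF refl])
    fix \<sigma>
    have st: "{g \<in> G. g \<in> ?S \<sigma>} = ?S \<sigma>" by (auto simp: stab_def)
    have "(\<Sum>g\<in>?S \<sigma>. ?d \<sigma> * trace_fps g) =
      (\<Sum>g\<in>G. ?t g \<sigma>)"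
      using sum.inter_filter[OF finite_group, of "\<lambda>g. ?d \<sigma> * trace_fps g" "\<lambda>g. g \<in> ?S \<sigma>"]
      unfolding st .
    then show "?d \<sigma> * (of_nat (card (?S \<sigma>)) * hilbert (?S \<sigma>)) =
      (\<Sum>g\<in>G. ?t g \<sigma>)"
      by (simp only: stab_trace sum_distrib_left)
  qed
  also have "\<dots> = (\<Sum>g\<in>G. \<Sum>\<sigma>\<in>?R. ?t g \<sigma>)"
    by (rule sum.swap)
  also have "\<dots> = (\<Sum>g\<in>G. (-1) ^ CARD('n) * (fps_const (sign g) * trace_fps g))"
  proof (rule sum.cong[OF refl])
    fix g assume g: "g \<in> G"
    have "(\<Sum>\<sigma>\<in>?R. ?t g \<sigma>) =
      (\<Sum>\<sigma>\<in>{\<sigma> \<in> ?R. g \<in> ?S \<sigma>}. ?d \<sigma> * trace_fps g)"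
      by (rule sum.inter_filter[symmetric, OF finR])
    also have "\<dots> = fps_const (\<Sum>\<sigma>\<in>{\<sigma> \<in> ?R. g \<in> ?S \<sigma>}. (-1) ^ dim (face_span A \<sigma>)) * trace_fps g"
      unfolding fps_const_sum sum_distrib_right
      by (intro sum.cong refl arg_cong2[of _ _ _ _ "(*)"]) (simp add: fps_const_power[symmetric] fps_const_neg[symmetric] del: fps_const_power fps_const_neg)
    also have "\<dots> = (-1) ^ CARD('n) * (fps_const (sign g) * trace_fps g)"
      unfolding fixed_sum[OF g] fps_const_mult[symmetric]
      by (simp add: fps_const_power[symmetric] fps_const_neg[symmetric] mult.assoc del: fps_const_power fps_const_neg fps_const_mult)
    finally show "(\<Sum>\<sigma>\<in>?R. ?t g \<sigma>) = \<dots>" .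
  qed
  also have "\<dots> = (-1) ^ CARD('n) * (of_nat (card G) * fps_X ^ card (pos_roots G c) * hilbert G)"
    unfolding sum_distrib_left[symmetric] sum_sign_trace_fps[OF assms(1)] ..
  finally show ?thesis .
qed

section \<open>The Poincare polynomial and Solomon's formula\<close>

text \<open>Each chamber contributes q to the number of hyperplanes separating it from
  \<open>x\<close>. The base point is arbitrary, by \<open>dist_series_eq\<close>.\<close>

definition dist_series :: "('v::euclidean_space \<Rightarrow> 'v) set \<Rightarrow> 'v \<Rightarrow> real fps" where
  "dist_series G x = (\<Sum>g\<in>G. fps_X ^ sep G (g (SOME c. regular G c)) x)"

text \<open>The usual length polynomial: the length of \<open>g\<close> is the number of hyperplanes
  between the chambers of \<open>c\<close> and \<open>g c\<close>.\<close>

definition poincare :: "('v::euclidean_space \<Rightarrow> 'v) set \<Rightarrow> real fps" where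
  "poincare G = dist_series G (SOME c. regular G c)"

lemma same_side:
  assumes A: "\<And>a. a \<in> A \<Longrightarrow> - a \<in> A" and c: "generic A c"
    and x: "\<And>a. a \<in> A \<Longrightarrow> a \<bullet> c > 0 \<Longrightarrow> a \<bullet> x > 0" and a: "a \<in> A"
  shows "a \<bullet> x > 0 \<longleftrightarrow> a \<bullet> c > 0" "a \<bullet> x < 0 \<longleftrightarrow> a \<bullet> c < 0"
proof -
  have p: "a \<bullet> c > 0 \<Longrightarrow> a \<bullet> x > 0" and q: "a \<bullet> c < 0 \<Longrightarrow> a \<bullet> x < 0"
    using x[OF a] x[OF A[OF a]] by auto
  have "a \<bullet> c \<noteq> 0" using c a by (simp add: generic_def)
  then consider "a \<bullet> c > 0" | "a \<bullet> c < 0" by linarith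
  then show "a \<bullet> x > 0 \<longleftrightarrow> a \<bullet> c > 0" "a \<bullet> x < 0 \<longleftrightarrow> a \<bullet> c < 0"
    by (cases; use p q in force)+
qed

lemma sep_cong:
  assumes "\<And>a. a \<in> roots G \<Longrightarrow> a \<bullet> x > 0 \<longleftrightarrow> a \<bullet> x' > 0" "\<And>a. a \<in> roots G \<Longrightarrow> a \<bullet> y < 0 \<longleftrightarrow> a \<bullet> y' < 0"
  shows "sep G x y = sep G x' y'"
  unfolding sep_def using assms by (intro arg_cong[of _ _ card]) auto

section \<open>Distance series and their factorization over stabilizers\<close>

context refl_group
begin

lemma generic_exists: "\<exists>c. regular G c"
  using generic_near[OF finite_roots_group open_UNIV UNIV_I] roots_nz by blast

lemma sum_mem_right: "h \<in> G \<Longrightarrow> (\<Sum>g\<in>G. f (g \<circ> h)) = (\<Sum>g\<in>G. f g)"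
  for f :: "('v \<Rightarrow> 'v) \<Rightarrow> 'b::comm_monoid_add"
  by (rule sum.reindex_bij_witness[of _ "\<lambda>g. g \<circ> ginv h" "\<lambda>g. g \<circ> h"])
    (auto simp: fun_eq_iff simp del: o_apply intro: comp_mem inv_mem, simp_all)

lemma sum_mem_left: "h \<in> G \<Longrightarrow> (\<Sum>g\<in>G. f (h \<circ> g)) = (\<Sum>g\<in>G. f g)"
  for f :: "('v \<Rightarrow> 'v) \<Rightarrow> 'b::comm_monoid_add"
  by (rule sum.reindex_bij_witness[of _ "\<lambda>g. ginv h \<circ> g" "\<lambda>g. h \<circ> g"])
    (auto simp: fun_eq_iff simp del: o_apply intro: comp_mem inv_mem, simp_all)

text \<open>Some \<open>h\<close> carries \<open>y\<close> into the chamber of \<open>c\<close>, and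
  right translation by \<open>h\<close> permutes the summands.\<close>

lemma sum_sep_generic:
  fixes f :: "nat \<Rightarrow> 'b::comm_monoid_add"
  assumes y: "regular G y" and c: "regular G c"
  shows "(\<Sum>g\<in>G. f (sep G (g y) x)) = (\<Sum>g\<in>G. f (sep G (g c) x))"
proof -
  obtain h where h: "h \<in> G" "\<And>b. b \<in> roots G \<Longrightarrow> b \<bullet> c > 0 \<Longrightarrow> b \<bullet> h y > 0"
    using chamber_transitive[OF c y] by blast
  have "sep G (g c) x = sep G ((g \<circ> h) y) x" if g: "g \<in> G" for g
  proof (rule sep_cong)
    fix a assume a: "a \<in> roots G"
    have "ginv g a \<in> roots G" using a g inv_mem root_image by blast
    from same_side(1)[OF roots_minus c h(2) this]
    show "a \<bullet> g c > 0 \<longleftrightarrow> a \<bullet> (g \<circ> h) y > 0"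
      using inner_mem_inv'[OF g] by simp
  qed simp
  then have "(\<Sum>g\<in>G. f (sep G (g c) x)) = (\<Sum>g\<in>G. f (sep G ((g \<circ> h) y) x))"
    by (intro sum.cong refl) simp
  also have "\<dots> = (\<Sum>g\<in>G. f (sep G (g y) x))"
    by (rule sum_mem_right[OF h(1)])
  finally show ?thesis ..
qed

lemma dist_series_eq:
  assumes "regular G c"
  shows "dist_series G x = (\<Sum>g\<in>G. fps_X ^ sep G (g c) x)"
  unfolding dist_series_def by (rule sum_sep_generic[OF someI_ex[OF generic_exists] assms])

lemma dist_series_mem: "h \<in> G \<Longrightarrow> dist_series G (h x) = dist_series G x"
proof -
  assume h: "h \<in> G"
  obtain c where c: "regular G c" using generic_exists by blast
  have "dist_series G (h x) = (\<Sum>g\<in>G. fps_X ^ sep G ((h \<circ> g) c) (h x))"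
    unfolding dist_series_eq[OF c] by (rule sum_mem_left[OF h, symmetric])
  then show ?thesis by (simp add: sep_mem[OF h] dist_series_eq[OF c])
qed

lemma dist_series_generic:
  assumes "regular G y"
  shows "dist_series G y = poincare G"
proof -
  obtain c where c: "regular G c" "c = (SOME c. regular G c)"
    using someI_ex[OF generic_exists] by blast
  obtain h where h: "h \<in> G" "\<And>b. b \<in> roots G \<Longrightarrow> b \<bullet> c > 0 \<Longrightarrow> b \<bullet> h y > 0"
    using chamber_transitive[OF c(1) assms] by blast
  have "dist_series G (h y) = dist_series G c"
    unfolding dist_series_def
    by (intro sum.cong refl arg_cong[of _ _ "\<lambda>n. fps_X ^ n"] sep_cong same_side(2)[OF roots_minus c(1) h(2)])
  then show ?thesis by (simp add: dist_series_mem[OF h(1)] poincare_def c(2))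
qed

text \<open>Let \<open>c\<close> be regular with \<open>x\<close> in its closed chamber. A
  hyperplane separating \<open>y\<close> from \<open>c\<close> either separates \<open>y\<close>
  from \<open>x\<close>, or passes through \<open>x\<close> and separates \<open>y\<close> from
  \<open>c\<close>; so distances add. Elements \<open>u\<close> of the stabilizer leave the first
  part unchanged. The double sum over \<open>g\<close> and \<open>u\<close> thus has exponents sep(u
  g c, c), and each \<open>u\<close> yields a full Poincare polynomial. No coset representatives are
  chosen, whence the factor on the right.\<close>

lemma dist_series_stab:
  "dist_series G x * poincare (stab G x) = of_nat (card (stab G x)) * poincare G"
proof -
  interpret S: refl_group "stab G x" by unfold_locales (rule stab_frg)
  let ?A = "roots G" and ?B = "roots (stab G x)"
  obtain c where c: "generic ?A c" "\<And>b. b \<in> ?A \<Longrightarrow> b \<bullet> c > 0 \<Longrightarrow> b \<bullet> x \<ge> 0"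
    using dominant_near by blast
  have genB: "generic ?B y" if "generic ?A y" for y
    using that by (auto simp: generic_def roots_stab)
  have "sep G y c = sep G y x + sep (stab G x) y c" for y
  proof -
    have "{a \<in> ?A. a \<bullet> y > 0 \<and> a \<bullet> c < 0} = {a \<in> ?A. a \<bullet> y > 0 \<and> a \<bullet> x < 0} \<union> {a \<in> ?B. a \<bullet> y > 0 \<and> a \<bullet> c < 0}"
    proof -
      have "a \<bullet> c < 0 \<longleftrightarrow> a \<bullet> x < 0 \<or> (a \<bullet> x = 0 \<and> a \<bullet> c < 0)" if a: "a \<in> ?A" for a
      proof -
        have "a \<bullet> c \<noteq> 0" using c(1) a by (simp add: generic_def)
        moreover have "a \<bullet> c > 0 \<Longrightarrow> a \<bullet> x \<ge> 0" "a \<bullet> c < 0 \<Longrightarrow> a \<bullet> x \<le> 0"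
          using c(2)[OF a] c(2)[OF roots_minus[OF a]] by auto
        ultimately show ?thesis by linarith
      qed
      then show ?thesis by (auto simp: roots_stab)
    qed
    then show ?thesis
      unfolding sep_def using finite_roots_group S.finite_roots_group
      by (simp add: card_Un_disjoint roots_stab disjoint_iff)
  qed
  then have split: "fps_X ^ sep G y c = fps_X ^ sep G y x * (fps_X :: real fps) ^ sep (stab G x) y c" for y
    by (simp add: power_add)
  have "dist_series G x * poincare (stab G x) =
    (\<Sum>g\<in>G. fps_X ^ sep G (g c) x * (\<Sum>u\<in>stab G x. fps_X ^ sep (stab G x) (u (g c)) c))"
    unfolding dist_series_eq[OF c(1)] sum_distrib_right
  proof (rule sum.cong[OF refl])
    fix g assume g: "g \<in> G"
    \<comment> \<open>The point \<open>g c\<close> is also regular for the stabilizer, so the second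
      factor may be written with a base point varying with \<open>g\<close>.\<close>
    have "poincare (stab G x) = dist_series (stab G x) c"
      by (rule S.dist_series_generic[OF genB[OF c(1)], symmetric])
    also have "\<dots> = (\<Sum>u\<in>stab G x. fps_X ^ sep (stab G x) (u (g c)) c)"
      by (rule S.dist_series_eq) (rule genB, use g c(1) generic_mem in blast)
    finally show "fps_X ^ sep G (g c) x * poincare (stab G x) =
      fps_X ^ sep G (g c) x * (\<Sum>u\<in>stab G x. fps_X ^ sep (stab G x) (u (g c)) c)" by simp
  qed
  also have "\<dots> = (\<Sum>g\<in>G. \<Sum>u\<in>stab G x. fps_X ^ sep G ((u \<circ> g) c) c)"
    unfolding sum_distrib_left
  proof (intro sum.cong refl)
    fix g u assume "u \<in> stab G x"
    then have "sep G (u (g c)) x = sep G (g c) x"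
      using sep_mem[of u "g c" x] by (simp add: stab_def)
    then show "fps_X ^ sep G (g c) x * fps_X ^ sep (stab G x) (u (g c)) c = (fps_X :: real fps) ^ sep G ((u \<circ> g) c) c"
      by (simp add: split)
  qed
  also have "\<dots> = (\<Sum>u\<in>stab G x. \<Sum>g\<in>G. fps_X ^ sep G ((u \<circ> g) c) c)"
    by (rule sum.swap)
  also have "\<dots> = (\<Sum>u\<in>stab G x. poincare G)"
  proof (rule sum.cong[OF refl])
    fix u assume "u \<in> stab G x"
    then have "u \<in> G" by (simp add: stab_def)
    from sum_mem_left[OF this, of "\<lambda>g. (fps_X :: real fps) ^ sep G (g c) c"]
    show "(\<Sum>g\<in>G. fps_X ^ sep G ((u \<circ> g) c) c) = poincare G"
      by (simp only: dist_series_eq[OF c(1), symmetric] dist_series_generic[OF c(1)])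
  qed
  finally show ?thesis by simp
qed

lemma stab_eq_iff: "stab G x = G \<longleftrightarrow> (\<forall>a\<in>roots G. a \<bullet> x = 0)"
proof
  assume "stab G x = G"
  then show "\<forall>a\<in>roots G. a \<bullet> x = 0" using roots_stab[of x] by auto
next
  assume *: "\<forall>a\<in>roots G. a \<bullet> x = 0"
  have "g x = x" if "g \<in> G" for g
    by (rule stab_fixes[of g 0]) (use that * in \<open>auto simp: stab_def linear_0[OF linear_mem]\<close>)
  then show "stab G x = G" by (auto simp: stab_def)
qed

end

text \<open>For each \<open>g\<close> the sum over faces is an instance of
  \<open>alternating_face_sum_sep\<close> with base point \<open>g c\<close>, and all |G| instances
  have the same value.\<close>

lemma (in refl_chamber) alternating_dist_series_sum:
  "(\<Sum>\<sigma>\<in>range (face_sgn (roots G)). (-1) ^ dim (face_span (roots G) \<sigma>) * dist_series G (face_pt (roots G) \<sigma>)) =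
    (-1) ^ DIM('v) * (of_nat (card G) * fps_X ^ card (pos_roots G c))"
proof -
  let ?A = "roots G"
  let ?R = "range (face_sgn ?A)" and ?d = "\<lambda>\<sigma>. (-1 :: real fps) ^ dim (face_span ?A \<sigma>)"
  let ?t = "\<lambda>g \<sigma>. (fps_X :: real fps) ^ card {a \<in> ?A. a \<bullet> g c > 0 \<and> \<sigma> a = -1}"
  have sep_face: "sep G y (face_pt ?A \<sigma>) = card {a \<in> ?A. a \<bullet> y > 0 \<and> \<sigma> a = -1}" if "\<sigma> \<in> range (face_sgn ?A)" for \<sigma> y
  proof -
    have "a \<bullet> face_pt ?A \<sigma> < 0 \<longleftrightarrow> \<sigma> a = -1" if "a \<in> ?A" for a
      using fun_cong[OF face_sgn_face_pt[OF \<open>\<sigma> \<in> _\<close>], of a] that by (simp add: face_sgn_def) (metis sgn_1_neg)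
    then show ?thesis unfolding sep_def by (intro arg_cong[of _ _ card]) auto
  qed
  \<comment> \<open>All \<open>N\<close> hyperplanes separate a regular point from its negative, and
    \<open>g\<close> preserves separation.\<close>
  have N: "card {a \<in> ?A. a \<bullet> g c > 0} = card (pos_roots G c)" if "g \<in> G" for g
    using sep_mem[OF that, of c "- c"] linear_mem[OF that] by (simp add: sep_def linear_neg pos_roots_def)
  have "(\<Sum>\<sigma>\<in>?R. ?d \<sigma> * dist_series G (face_pt ?A \<sigma>)) =
    (\<Sum>\<sigma>\<in>?R. \<Sum>g\<in>G. ?d \<sigma> * ?t g \<sigma>)"
    by (intro sum.cong refl) (simp add: dist_series_eq[OF c] sep_face sum_distrib_left)
  also have "\<dots> = (\<Sum>g\<in>G. \<Sum>\<sigma>\<in>?R. ?d \<sigma> * ?t g \<sigma>)"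
    by (rule sum.swap)
  also have "\<dots> = (\<Sum>g\<in>G. (-1) ^ DIM('v) * fps_X ^ card (pos_roots G c))"
    by (intro sum.cong refl) (simp add: alternating_face_sum_sep[OF finite_roots_group] N)
  finally show ?thesis by (simp add: mult.left_commute)
qed

theorem solomon:
  fixes G :: "(real^'n::finite \<Rightarrow> real^'n) set"
  assumes "refl_group G"
  shows "poincare G * hilbert G * (1 - fps_X) ^ CARD('n) = 1"
  using assms
proof (induction "card G" arbitrary: G rule: less_induct)
  case less
  interpret refl_group G by fact
  obtain c where c: "regular G c" using generic_exists by blast
  interpret refl_chamber G c by unfold_locales (rule c)
  let ?A = "roots G" and ?N = "card (pos_roots G c)"
  show ?case
  proof (cases "?N = 0")
    case True
    then have "pos_roots G c = {}" using pos_roots_finite by simp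
    then have "?A = {}" using pos_roots_cases by blast
    then have "G = {id}" using group_eq by simp
    moreover have "poincare {id :: real^'n \<Rightarrow> real^'n} = 1"
      using dist_series_generic[OF c] dist_series_eq[OF c, of c] \<open>G = {id}\<close> \<open>?A = {}\<close>
      by (simp add: sep_def)
    ultimately show ?thesis using hilbert_trivial by simp
  next
    case False
    let ?R = "range (face_sgn ?A)"
    let ?S = "\<lambda>\<sigma>. stab G (face_pt ?A \<sigma>)" and ?d = "\<lambda>\<sigma>. (-1 :: real fps) ^ dim (face_span ?A \<sigma>)"
    define \<kappa> where "\<kappa> = poincare G * (1 - fps_X) ^ CARD('n)"
    define \<sigma>0 where "\<sigma>0 = face_sgn ?A 0"
    have finR: "finite ?R" by (rule finite_face_sgn[OF finite_roots_group])
    have \<sigma>0: "\<sigma>0 \<in> ?R" by (simp add: \<sigma>0_def)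
    \<comment> \<open>The face of the origin is the only one whose stabilizer is the whole
      group.\<close>
    have S_iff: "?S \<sigma> = G \<longleftrightarrow> \<sigma> = \<sigma>0" if "\<sigma> \<in> ?R" for \<sigma>
    proof -
      have "(\<forall>a\<in>?A. a \<bullet> face_pt ?A \<sigma> = 0) \<longleftrightarrow> face_sgn ?A (face_pt ?A \<sigma>) = \<sigma>0"
        by (auto simp: face_sgn_def \<sigma>0_def fun_eq_iff sgn_0_0)
      then show ?thesis by (simp add: stab_eq_iff face_sgn_face_pt[OF that])
    qed
    have "?S \<sigma>0 = G" using S_iff[OF \<sigma>0] by simp
    then have "\<forall>a\<in>?A. a \<bullet> face_pt ?A \<sigma>0 = 0" by (simp add: stab_eq_iff)
    then have "{a \<in> ?A. a \<bullet> y > 0 \<and> a \<bullet> face_pt ?A \<sigma>0 < 0} = {}" for y by auto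
    then have "sep G y (face_pt ?A \<sigma>0) = 0" for y by (simp only: sep_def card.empty)
    \<comment> \<open>No hyperplane separates a point from the smallest face, so each of the |G|
      summands is 1.\<close>
    then have dist0: "dist_series G (face_pt ?A \<sigma>0) = of_nat (card G)"
      by (simp add: dist_series_eq[OF c])
    have dist: "dist_series G (face_pt ?A \<sigma>) = \<kappa> * (of_nat (card (?S \<sigma>)) * hilbert (?S \<sigma>))"
      if "\<sigma> \<in> ?R - {\<sigma>0}" for \<sigma>
    proof -
      have rg: "refl_group (?S \<sigma>)" by unfold_locales (rule stab_frg)
      have "?S \<sigma> \<subset> G" using S_iff that by (auto simp: stab_def)
      then have "card (?S \<sigma>) < card G" by (rule psubset_card_mono[OF finite_group])
      from less.hyps[OF this rg]
      have IH: "poincare (?S \<sigma>) * hilbert (?S \<sigma>) * (1 - fps_X) ^ CARD('n) = 1" .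
      have "dist_series G (face_pt ?A \<sigma>) =
          dist_series G (face_pt ?A \<sigma>) * (poincare (?S \<sigma>) * hilbert (?S \<sigma>) * (1 - fps_X) ^ CARD('n))"
        unfolding IH by simp
      also have "\<dots> = (dist_series G (face_pt ?A \<sigma>) * poincare (?S \<sigma>)) * (hilbert (?S \<sigma>) * (1 - fps_X) ^ CARD('n))"
        by (simp only: mult_ac)
      also have "\<dots> = \<kappa> * (of_nat (card (?S \<sigma>)) * hilbert (?S \<sigma>))"
        unfolding dist_series_stab \<kappa>_def by (simp only: mult_ac)
      finally show ?thesis .
    qed
    have "(-1) ^ CARD('n) * (of_nat (card G) * fps_X ^ ?N) =
        (\<Sum>\<sigma>\<in>?R. ?d \<sigma> * dist_series G (face_pt ?A \<sigma>))"
      using alternating_dist_series_sum by simp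
    also have "\<dots> = ?d \<sigma>0 * of_nat (card G) + (\<Sum>\<sigma>\<in>?R - {\<sigma>0}. ?d \<sigma> * dist_series G (face_pt ?A \<sigma>))"
      by (simp only: sum.remove[OF finR \<sigma>0] dist0)
    also have "(\<Sum>\<sigma>\<in>?R - {\<sigma>0}. ?d \<sigma> * dist_series G (face_pt ?A \<sigma>)) =
        \<kappa> * (\<Sum>\<sigma>\<in>?R - {\<sigma>0}. ?d \<sigma> * (of_nat (card (?S \<sigma>)) * hilbert (?S \<sigma>)))"
      unfolding sum_distrib_left by (intro sum.cong refl) (simp only: dist mult_ac)
    also have "(\<Sum>\<sigma>\<in>?R - {\<sigma>0}. ?d \<sigma> * (of_nat (card (?S \<sigma>)) * hilbert (?S \<sigma>))) =
        (\<Sum>\<sigma>\<in>?R. ?d \<sigma> * (of_nat (card (?S \<sigma>)) * hilbert (?S \<sigma>))) - ?d \<sigma>0 * (of_nat (card G) * hilbert G)"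
      using \<open>?S \<sigma>0 = G\<close> by (simp add: sum.remove[OF finR \<sigma>0])
    also have "(\<Sum>\<sigma>\<in>?R. ?d \<sigma> * (of_nat (card (?S \<sigma>)) * hilbert (?S \<sigma>))) =
        (-1) ^ CARD('n) * (of_nat (card G) * fps_X ^ ?N * hilbert G)"
      by (rule alternating_hilbert_sum) (rule refl_chamber_axioms)
    finally have *: "(-1) ^ CARD('n) * (of_nat (card G) * fps_X ^ ?N) = ?d \<sigma>0 * of_nat (card G) +
        \<kappa> * ((-1) ^ CARD('n) * (of_nat (card G) * fps_X ^ ?N * hilbert G) - ?d \<sigma>0 * (of_nat (card G) * hilbert G))" .
    \<comment> \<open>Collecting terms gives |G| D (\<open>\<kappa>\<close> H - 1) = 0. As N > 0,
      the constant term of \<open>D\<close> comes from the smallest face alone and is 1 or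
      -1.\<close>
    define D where "D = (-1) ^ CARD('n) * fps_X ^ ?N - ?d \<sigma>0"
    have "of_nat (card G) * D * (\<kappa> * hilbert G) = of_nat (card G) * D"
      using * by (simp add: D_def algebra_simps)
    moreover have "fps_nth D 0 \<noteq> 0"
    proof -
      have "fps_nth D 0 = - ((-1) ^ dim (face_span ?A \<sigma>0))"
        using False by (simp add: D_def fps_power_zeroth)
      then show ?thesis by simp
    qed
    then have "D \<noteq> 0" by auto
    moreover have "card G \<noteq> 0" using finite_group id_mem by auto
    ultimately have "\<kappa> * hilbert G = 1" by simp
    then show ?thesis by (simp add: \<kappa>_def mult_ac)
  qed
qed

section \<open>The symmetric group\<close>

text \<open>Partitions of \<open>k\<close> into at most \<open>n\<close> parts, padded with zeros;
  they index the orbits of the symmetric group on exponent vectors of degree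
  \<open>k\<close>.\<close>

definition msets :: "nat \<Rightarrow> nat \<Rightarrow> nat multiset set" where
  "msets n k = {M. size M = n \<and> sum_mset M = k}"

lemma finite_msets: "finite (msets n k)"
proof (rule finite_subset)
  show "finite (mset ` {xs. set xs \<subseteq> {..k} \<and> length xs = n})"
    by (intro finite_imageI finite_lists_length_eq) simp
  show "msets n k \<subseteq> mset ` {xs. set xs \<subseteq> {..k} \<and> length xs = n}"
  proof
    fix M assume M: "M \<in> msets n k"
    obtain xs where xs: "mset xs = M" using ex_mset by blast
    have "x \<le> k" if x: "x \<in># M" for x
    proof -
      obtain M' where "M = add_mset x M'" using multi_member_split[OF x] by blast
      then show ?thesis using M by (auto simp: msets_def)
    qed
    then show "M \<in> mset ` {xs. set xs \<subseteq> {..k} \<and> length xs = n}"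
      using xs M by (intro image_eqI[of _ _ xs]) (auto simp: msets_def)
  qed
qed

lemma card_msets_0: "card (msets 0 k) = (if k = 0 then 1 else 0)"
proof -
  have "msets 0 k = (if k = 0 then {{#}} else {})" by (auto simp: msets_def)
  then show ?thesis by simp
qed

lemma sum_mset_Suc: "sum_mset (image_mset Suc M) = sum_mset M + size M"
  by (induction M) auto

text \<open>A multiset of \<open>n + 1\<close> natural numbers either contains zero or is shifted up from another one.\<close>

lemma card_msets_Suc:
  "card (msets (Suc n) k) = card (msets n k) + (if k < Suc n then 0 else card (msets (Suc n) (k - Suc n)))"
proof -
  let ?Z = "add_mset 0 ` msets n k" and ?S = "image_mset Suc ` msets (Suc n) (k - Suc n)"
  let ?Y = "if k < Suc n then {} else ?S"
  have split: "msets (Suc n) k = ?Z \<union> ?Y"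
  proof (intro Set.set_eqI iffI)
    fix M assume M: "M \<in> msets (Suc n) k"
    show "M \<in> ?Z \<union> ?Y"
    proof (cases "0 \<in># M")
      case True
      then obtain M' where "M = add_mset 0 M'" using multi_member_split[OF True] by blast
      moreover from this have "M' \<in> msets n k" using M by (simp add: msets_def)
      ultimately show ?thesis by blast
    next
      case False
      let ?M' = "image_mset (\<lambda>x. x - 1) M"
      have "Suc (x - 1) = x" if "x \<in># M" for x using False that by (cases x) auto
      then have "image_mset Suc ?M' = image_mset (\<lambda>x. x) M"
        unfolding multiset.map_comp by (intro image_mset_cong) simp
      then have eq: "M = image_mset Suc ?M'" by simp
      then have "sum_mset ?M' + Suc n = k" using sum_mset_Suc[of ?M'] M by (simp add: msets_def)
      then have "?M' \<in> msets (Suc n) (k - Suc n)" "\<not> k < Suc n" using M by (auto simp: msets_def)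
      then have "M \<in> ?S" using eq by (rule_tac image_eqI)
      then show ?thesis using \<open>\<not> k < Suc n\<close> by simp
    qed
  next
    fix M assume "M \<in> ?Z \<union> ?Y"
    then show "M \<in> msets (Suc n) k"
      by (auto simp: msets_def sum_mset_Suc split: if_splits)
  qed
  have disj: "?Z \<inter> image_mset Suc ` X = {}" for X
  proof -
    have "0 \<notin># image_mset Suc M" for M by auto
    then show ?thesis by (metis (no_types, lifting) disjoint_iff imageE union_single_eq_member)
  qed
  have inj: "inj_on (image_mset Suc) X" for X
    by (rule inj_on_subset[OF multiset.inj_map]) auto
  show ?thesis
  proof (cases "k < Suc n")
    case True
    then show ?thesis by (subst split) (simp add: card_image inj_on_def)
  next
    case False
    have "card (msets (Suc n) k) = card (?Z) + card (?S)"
      using False by (subst split) (simp add: card_Un_disjoint[OF finite_imageI[OF finite_msets] finite_imageI[OF finite_msets] disj])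
    then show ?thesis using False by (simp add: card_image[OF inj]) (simp add: card_image inj_on_def)
  qed
qed

lemma msets_generating_function:
  "Abs_fps (\<lambda>k. real (card (msets n k))) * (\<Prod>i = 1..n. 1 - fps_X ^ i) = 1"
proof (induction n)
  case 0
  show ?case by (simp add: card_msets_0 fps_eq_iff)
next
  case (Suc n)
  have "Abs_fps (\<lambda>k. real (card (msets (Suc n) k))) * (1 - fps_X ^ Suc n) = Abs_fps (\<lambda>k. real (card (msets n k)))"
    by (rule fps_ext) (simp add: card_msets_Suc right_diff_distrib fps_X_power_mult_right_nth del: power_Suc)
  then have "Abs_fps (\<lambda>k. real (card (msets (Suc n) k))) * (1 - fps_X ^ Suc n) * (\<Prod>i = 1..n. 1 - fps_X ^ i) = 1"
    using Suc by (simp only:)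
  then show ?case by (simp add: mult_ac del: power_Suc)
qed

section \<open>Exponent vectors up to permutation of the coordinates\<close>

definition value_mset :: "('n::finite \<Rightarrow> nat) \<Rightarrow> nat multiset" where
  "value_mset \<alpha> = image_mset \<alpha> (mset_set UNIV)"

lemma value_mset_msets: "value_mset \<alpha> \<in> msets CARD('n) (wt (\<lambda>_. 1) \<alpha>)" for \<alpha> :: "'n::finite \<Rightarrow> nat"
  by (simp add: value_mset_def msets_def wt_def sum_unfold_sum_mset)

lemma value_mset_surj:
  assumes "M \<in> msets CARD('n::finite) k"
  obtains \<alpha> :: "'n::finite \<Rightarrow> nat" where "value_mset \<alpha> = M"
proof -
  obtain xs where xs: "mset xs = M" using ex_mset by blast
  then have len: "length xs = CARD('n)" using assms by (auto simp: msets_def)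
  obtain h :: "'n \<Rightarrow> nat" where h: "bij_betw h UNIV {0..<CARD('n)}"
    using ex_bij_betw_finite_nat[of "UNIV :: 'n set"] by auto
  have "mset_set {0..<length xs} = image_mset h (mset_set UNIV)"
    using h len by (simp add: bij_betw_def image_mset_mset_set)
  then have "image_mset (\<lambda>i. xs ! h i) (mset_set UNIV) = image_mset ((!) xs) (mset_set {0..<length xs})"
    by (simp add: multiset.map_comp comp_def)
  also have "\<dots> = M"
    using xs by (metis map_nth mset_map mset_upt)
  finally show ?thesis using that[of "\<lambda>i. xs ! h i"] by (simp add: value_mset_def)
qed

lemma value_mset_comp:
  assumes "bij p"
  shows "value_mset (\<alpha> \<circ> p) = value_mset \<alpha>"
proof -
  have "value_mset (\<alpha> \<circ> p) = image_mset \<alpha> (image_mset p (mset_set UNIV))"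
    by (simp add: value_mset_def multiset.map_comp)
  also have "image_mset p (mset_set UNIV) = mset_set UNIV"
    using assms by (simp add: image_mset_mset_set bij_def)
  finally show ?thesis by (simp add: value_mset_def comp_def)
qed

definition coord_perm :: "('n::finite \<Rightarrow> 'n) \<Rightarrow> real^'n \<Rightarrow> real^'n" where
  "coord_perm p x = (\<chi> i. x $ p i)"

lemma coordinate_permutations_eq: "coordinate_permutations = coord_perm ` {p. bij p}"
  by (auto simp: coordinate_permutations_def coord_perm_def[abs_def])

lemma card_coordinate_permutations:
  "card (coordinate_permutations :: (real^'n::finite \<Rightarrow> real^'n) set) = fact CARD('n)"
proof -
  have "inj_on coord_perm {p :: 'n \<Rightarrow> 'n. bij p}"
  proof (rule inj_onI)
    fix p q :: "'n \<Rightarrow> 'n" assume eq: "coord_perm p = coord_perm q"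
    show "p = q"
    proof
      fix i
      have "coord_perm p (axis (p i) 1) $ i = coord_perm q (axis (p i) 1) $ i" by (simp only: eq)
      then show "p i = q i" by (auto simp: coord_perm_def axis_def split: if_splits)
    qed
  qed
  then have "card (coordinate_permutations :: (real^'n \<Rightarrow> real^'n) set) = card {p :: 'n \<Rightarrow> 'n. bij p}"
    unfolding coordinate_permutations_eq by (rule card_image)
  also have "{p :: 'n \<Rightarrow> 'n. bij p} = {p. p permutes UNIV}"
    by (auto intro: permutes_bij bij_imp_permutes)
  finally show ?thesis by (simp add: card_permutations)
qed

lemma monom_fun_coord_perm:
  assumes "bij p"
  shows "mon \<alpha> (coord_perm p x) = mon (\<alpha> \<circ> inv_into UNIV p) x"
proof -
  have "mon (\<alpha> \<circ> inv_into UNIV p) x = (\<Prod>i\<in>UNIV. x $ p i ^ (\<alpha> \<circ> inv_into UNIV p) (p i))"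
    unfolding monom_fun_def using prod.reindex_bij_betw[OF assms, of "\<lambda>i. x $ i ^ (\<alpha> \<circ> inv_into UNIV p) i"] by simp
  then show ?thesis using assms by (simp add: monom_fun_def coord_perm_def bij_is_inj)
qed

lemma finite_value_mset: "finite {\<alpha> :: 'n::finite \<Rightarrow> nat. value_mset \<alpha> = M}"
proof (rule finite_subset)
  show "finite (exps (sum_mset M) :: ('n \<Rightarrow> nat) set)" by (rule finite_exps)
  show "{\<alpha> :: 'n \<Rightarrow> nat. value_mset \<alpha> = M} \<subseteq> exps (sum_mset M)"
    using value_mset_msets[where 'n = 'n] by (auto simp: msets_def)
qed

definition monomial_symmetric :: "nat multiset \<Rightarrow> real^'n::finite \<Rightarrow> real" where
  "monomial_symmetric M x = (\<Sum>\<alpha>\<in>{\<alpha>. value_mset \<alpha> = M}. mon \<alpha> x)"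

lemma sum_monomial_symmetric:
  "(\<Sum>M\<in>msets CARD('n) k. c M * monomial_symmetric M x) =
    (\<Sum>\<alpha>\<in>exps k. c (value_mset \<alpha>) * mon \<alpha> x)" for x :: "real^'n::finite"
proof -
  have eq: "{\<alpha> \<in> exps k :: ('n \<Rightarrow> nat) set. value_mset \<alpha> = M} = {\<alpha>. value_mset \<alpha> = M}" if "M \<in> msets CARD('n) k" for M
    using that value_mset_msets[where 'n = 'n] by (auto simp: msets_def)
  have "(\<Sum>\<alpha>\<in>exps k. c (value_mset \<alpha>) * mon \<alpha> x) =
    (\<Sum>M\<in>msets CARD('n) k. \<Sum>\<alpha>\<in>{\<alpha> \<in> exps k. value_mset \<alpha> = M}. c (value_mset \<alpha>) * mon \<alpha> x)"
    using value_mset_msets[where 'n = 'n] by (intro sum.group[symmetric] finite_exps finite_msets) auto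
  also have "\<dots> = (\<Sum>M\<in>msets CARD('n) k. c M * monomial_symmetric M x)"
    unfolding monomial_symmetric_def sum_distrib_left
    by (rule sum.cong[OF refl], rule sum.cong[OF eq]) auto
  finally show ?thesis ..
qed

lemma hpoly_expand:
  fixes p :: "real^'n::finite \<Rightarrow> real"
  assumes "p \<in> hpoly k"
  obtains c where "\<And>x. p x = (\<Sum>\<alpha>\<in>exps k. c \<alpha> * mon \<alpha> x)"
proof -
  note inj = basic_invariants_basis(1)[OF basic_invariants_trivial, of k]
  have "p \<in> range (\<lambda>u. \<Sum>b\<in>hbasis k. (\<lambda>x. u b * b x))"
    using assms unfolding hbasis(3)[symmetric] fun_vs.span_finite[OF hbasis(1)] .
  then obtain u where "p = (\<Sum>b\<in>mon ` exps k. (\<lambda>x. u b * b x))"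
    unfolding hbasis_def by blast
  then have "p x = (\<Sum>\<alpha>\<in>exps k. u (mon \<alpha>) * mon \<alpha> x)" for x
    by (simp only: sum_fun_apply sum.reindex[OF inj] comp_apply)
  then show ?thesis using that[of "\<lambda>\<alpha>. u (mon \<alpha>)"] by blast
qed

text \<open>The monomial symmetric polynomials form a basis: the coefficients of an invariant are
  constant on orbits of exponents, and an orbit is determined by its multiset of values.\<close>

lemma dim_inv_symmetric:
  "fun_vs.dim (inv_hpoly (coordinate_permutations :: (real^'n::finite \<Rightarrow> real^'n) set) k) = card (msets CARD('n) k)"
proof -
  let ?P = "coordinate_permutations :: (real^'n \<Rightarrow> real^'n) set"
  let ?A = "exps k :: ('n \<Rightarrow> nat) set"
  let ?m = "monomial_symmetric :: _ \<Rightarrow> real^'n \<Rightarrow> real"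
  have indep: "\<forall>M\<in>msets CARD('n) k. u M = 0" if u: "\<forall>x. (\<Sum>M\<in>msets CARD('n) k. u M * ?m M x) = 0" for u
  proof
    fix M assume M: "M \<in> msets CARD('n) k"
    obtain \<alpha> :: "'n \<Rightarrow> nat" where \<alpha>: "value_mset \<alpha> = M" using value_mset_surj[OF M] by blast
    then have "\<alpha> \<in> ?A" using value_mset_msets[of \<alpha>] M by (simp add: msets_def)
    from monom_fun_coord_independent[OF finite_exps _ this, of "\<lambda>\<alpha>. u (value_mset \<alpha>)"]
    show "u M = 0" using u \<alpha> by (simp add: sum_monomial_symmetric)
  qed
  show ?thesis
  proof (rule fun_basis(4)[OF finite_msets])
    show "fun_vs.subspace (inv_hpoly ?P k)"
      using subspace_hpoly[of k] unfolding fun_vs.subspace_def inv_hpoly_def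
      by (auto simp: fun_eq_iff)
    show "?m M \<in> inv_hpoly ?P k" if M: "M \<in> msets CARD('n) k" for M
    proof -
      have "homogeneous (wt (\<lambda>_. 1) \<alpha>) (mon \<alpha>)" for \<alpha> :: "'n \<Rightarrow> nat"
        by (rule monom_fun_homogeneous) (simp add: homogeneous_def)
      then have "mon \<alpha> (c *\<^sub>R x) = c ^ k * mon \<alpha> x" if "value_mset \<alpha> = M" for \<alpha> :: "'n \<Rightarrow> nat" and c x
        using value_mset_msets[of \<alpha>] M that by (auto simp: homogeneous_def msets_def)
      then have "homogeneous k (?m M)"
        by (auto simp: homogeneous_def monomial_symmetric_def sum_distrib_left intro!: sum.cong)
      moreover have "rpf (?m M)"
        unfolding monomial_symmetric_def[abs_def]
        by (intro real_polynomial_function_sum finite_value_mset monom_fun_polynomial coord_polynomial)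
      moreover have "?m M \<circ> g = ?m M" if g: "g \<in> ?P" for g
      proof
        fix x
        obtain p where p: "bij p" "g = coord_perm p" using g by (auto simp: coordinate_permutations_eq)
        let ?q = "inv_into UNIV p"
        have q: "bij ?q" "\<alpha> \<circ> p \<circ> ?q = \<alpha>" "\<alpha> \<circ> ?q \<circ> p = \<alpha>" for \<alpha> :: "'n \<Rightarrow> nat"
          using p(1) by (auto simp: bij_imp_bij_inv fun_eq_iff bij_is_inj surj_f_inv_f[OF bij_is_surj])
        have "(\<Sum>\<alpha>\<in>{\<alpha>. value_mset \<alpha> = M}. mon (\<alpha> \<circ> ?q) x) = (\<Sum>\<alpha>\<in>{\<alpha>. value_mset \<alpha> = M}. mon \<alpha> x)"
          by (rule sum.reindex_bij_witness[of _ "\<lambda>\<alpha>. \<alpha> \<circ> p" "\<lambda>\<alpha>. \<alpha> \<circ> ?q"])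
            (simp_all only: q(2,3) mem_Collect_eq value_mset_comp[OF p(1)] value_mset_comp[OF q(1)])
        then show "(?m M \<circ> g) x = ?m M x"
          by (simp add: monomial_symmetric_def p(2) monom_fun_coord_perm[OF p(1)])
      qed
      ultimately show ?thesis by (auto simp: inv_hpoly_def hpoly_def)
    qed
    show "\<exists>u. \<forall>x. p x = (\<Sum>M\<in>msets CARD('n) k. u M * ?m M x)" if p: "p \<in> inv_hpoly ?P k" for p
    proof -
      obtain c where c: "\<And>x. p x = (\<Sum>\<alpha>\<in>?A. c \<alpha> * mon \<alpha> x)"
        using hpoly_expand[of p k] p by (auto simp: inv_hpoly_def)
      \<comment> \<open>Invariance under the permutation \<open>s\<close> gives two monomial
        expansions of \<open>p\<close>, whose coefficients must agree.\<close>
      have c_inv: "c (\<beta> \<circ> s) = c \<beta>" if s: "bij s" and \<beta>: "\<beta> \<in> ?A" for \<beta> s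
      proof -
        let ?q = "inv_into UNIV s"
        have q: "bij ?q" "\<alpha> \<circ> s \<circ> ?q = \<alpha>" "\<alpha> \<circ> ?q \<circ> s = \<alpha>" for \<alpha> :: "'n \<Rightarrow> nat"
          using s by (auto simp: bij_imp_bij_inv fun_eq_iff bij_is_inj surj_f_inv_f[OF bij_is_surj])
        have w: "wt (\<lambda>_. 1) (\<alpha> \<circ> t) = wt (\<lambda>_. 1) \<alpha>" if "bij t" for \<alpha> :: "'n \<Rightarrow> nat" and t
          using sum.reindex_bij_betw[OF that, of \<alpha>] by (simp add: wt_def)
        have "(\<Sum>\<alpha>\<in>?A. (c (\<alpha> \<circ> s) - c \<alpha>) * mon \<alpha> x) = 0" for x
        proof -
          have "coord_perm s \<in> ?P" using s by (auto simp: coordinate_permutations_eq)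
          then have "p \<circ> coord_perm s = p" using p by (simp add: inv_hpoly_def)
          then have "p x = p (coord_perm s x)" by (metis comp_apply)
          also have "\<dots> = (\<Sum>\<alpha>\<in>?A. c \<alpha> * mon (\<alpha> \<circ> ?q) x)"
            by (simp only: c monom_fun_coord_perm[OF s])
          also have "\<dots> = (\<Sum>\<alpha>\<in>?A. c (\<alpha> \<circ> s) * mon \<alpha> x)"
            by (rule sum.reindex_bij_witness[of _ "\<lambda>\<alpha>. \<alpha> \<circ> s" "\<lambda>\<alpha>. \<alpha> \<circ> ?q"])
              (simp_all only: q(2,3) mem_Collect_eq w[OF s] w[OF q(1)])
          finally show ?thesis by (simp add: c left_diff_distrib sum_subtractf)
        qed
        from monom_fun_coord_independent[OF finite_exps this \<beta>] show ?thesis by simp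
      qed
      define u where "u M = c (SOME \<alpha>. value_mset \<alpha> = M)" for M
      have u: "c \<alpha> = u (value_mset \<alpha>)" if "\<alpha> \<in> ?A" for \<alpha>
      proof -
        define \<beta> where "\<beta> = (SOME \<beta> :: 'n \<Rightarrow> nat. value_mset \<beta> = value_mset \<alpha>)"
        \<comment> \<open>The chosen representative has the same values as \<open>\<alpha>\<close>,
          hence differs from it by a permutation, which leaves the coefficient unchanged.\<close>
        have v: "value_mset \<beta> = value_mset \<alpha>" unfolding \<beta>_def by (rule someI[of _ \<alpha>]) simp
        then obtain s where s: "s permutes UNIV" "\<And>i. \<beta> i = \<alpha> (s i)"
          using image_mset_eq_implies_permutes[of UNIV \<beta> \<alpha>] by (auto simp: value_mset_def)
        then have "\<beta> = \<alpha> \<circ> s" by auto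
        then show ?thesis using c_inv[OF permutes_bij[OF s(1)] that] by (simp add: u_def \<beta>_def)
      qed
      show ?thesis by (intro exI[of _ u]) (simp add: sum_monomial_symmetric c u)
    qed
  qed (rule indep)
qed

lemma hilbert_coordinate_permutations:
  "hilbert (coordinate_permutations :: (real^'n::finite \<Rightarrow> real^'n) set) * (\<Prod>i = 1..CARD('n). 1 - fps_X ^ i) = 1"
  using msets_generating_function[of "CARD('n)"] by (simp add: hilbert_def dim_inv_symmetric)

section \<open>Chambers\<close>

definition chamber :: "('v::euclidean_space \<Rightarrow> 'v) set \<Rightarrow> 'v \<Rightarrow> 'v set" where
  "chamber G x = {y. \<forall>a\<in>roots G. a \<bullet> x > 0 \<longrightarrow> a \<bullet> y > 0}"

lemma hyp_eq_iff:
  assumes "norm a = 1" "norm b = 1"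
  shows "hyp a = hyp b \<longleftrightarrow> a = b \<or> a = - b"
proof
  assume eq: "hyp a = hyp b"
  obtain x where x: "b \<bullet> x = 0" "a \<noteq> b \<Longrightarrow> a \<noteq> - b \<Longrightarrow> a \<bullet> x \<noteq> 0"
    using generic_on_hyperplane[of "{a}" b] assms by auto
  then have "x \<in> hyp b" by (simp add: hyp_def)
  then have "a \<bullet> x = 0" unfolding eq[symmetric] by (simp add: hyp_def)
  then show "a = b \<or> a = - b" using x by blast
qed (auto simp: hyp_def)

context refl_group
begin

lemma not_in_hyperplanes_iff: "x \<notin> \<Union>(hyperplanes G) \<longleftrightarrow> regular G x"
  by (auto simp: hyperplanes_def hyp_def generic_def)

lemma chamber_altdef: "chamber G x = (\<Inter>a\<in>pos_roots G x. {y. a \<bullet> y > 0})"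
  by (auto simp: chamber_def pos_roots_def)

lemma finite_pos_roots: "finite (pos_roots G x)"
  using finite_roots_group by (simp add: pos_roots_def)

lemma open_chamber: "open (chamber G x)"
  unfolding chamber_altdef using finite_pos_roots by (intro open_INT) (auto simp: open_halfspace_gt)

lemma convex_chamber: "convex (chamber G x)"
  unfolding chamber_altdef by (intro convex_INT) (auto simp: convex_halfspace_gt)

lemma self_in_chamber: "x \<in> chamber G x"
  by (simp add: chamber_def)

lemma chamber_sides:
  assumes "regular G x" "y \<in> chamber G x" "a \<in> roots G"
  shows "a \<bullet> y > 0 \<longleftrightarrow> a \<bullet> x > 0" "a \<bullet> y < 0 \<longleftrightarrow> a \<bullet> x < 0"
  using same_side[OF roots_minus assms(1), of y a] assms(2,3) by (auto simp: chamber_def)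

lemma chamber_generic: "regular G x \<Longrightarrow> y \<in> chamber G x \<Longrightarrow> regular G y"
proof -
  assume x: "regular G x" and y: "y \<in> chamber G x"
  show ?thesis
    unfolding generic_def
  proof
    fix a assume a: "a \<in> roots G"
    then have "a \<bullet> x > 0 \<or> a \<bullet> x < 0" using x by (auto simp: generic_def)
    then show "a \<bullet> y \<noteq> 0" using chamber_sides[OF x y a] by auto
  qed
qed

lemma chamber_eq:
  assumes "regular G x" "y \<in> chamber G x"
  shows "chamber G y = chamber G x"
  unfolding chamber_def using chamber_sides(1)[OF assms] by (simp cong: ball_cong)

lemma interior_closure_chamber: "interior (closure (chamber G x)) = chamber G x"
  by (simp add: convex_interior_closure convex_chamber interior_open open_chamber)

text \<open>A chamber is convex, hence connected; a connected set meeting both sides of a root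
  hyperplane would have to meet the hyperplane.\<close>

lemma connected_component_chamber:
  assumes x: "regular G x"
  shows "connected_component_set (- \<Union>(hyperplanes G)) x = chamber G x"
proof
  have "chamber G x \<subseteq> - \<Union>(hyperplanes G)"
    using chamber_generic[OF x] not_in_hyperplanes_iff by blast
  then show "chamber G x \<subseteq> connected_component_set (- \<Union>(hyperplanes G)) x"
    by (intro connected_component_maximal self_in_chamber convex_connected convex_chamber)
  show "connected_component_set (- \<Union>(hyperplanes G)) x \<subseteq> chamber G x"
  proof
    fix y assume y: "y \<in> connected_component_set (- \<Union>(hyperplanes G)) x"
    let ?T = "connected_component_set (- \<Union>(hyperplanes G)) x"
    have "x \<in> ?T" using x not_in_hyperplanes_iff by (simp add: connected_component_refl_eq)
    have "a \<bullet> y > 0" if a: "a \<in> roots G" "a \<bullet> x > 0" for a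
    proof (rule ccontr)
      assume "\<not> a \<bullet> y > 0"
      then obtain z where z: "z \<in> ?T" "a \<bullet> z = 0"
        using connected_ivt_hyperplane[OF connected_connected_component y \<open>x \<in> ?T\<close>, of a 0] a by auto
      then have "z \<notin> \<Union>(hyperplanes G)" using connected_component_subset by blast
      then show False using z a not_in_hyperplanes_iff by (auto simp: generic_def)
    qed
    then show "y \<in> chamber G x" by (simp add: chamber_def)
  qed
qed

lemma cones_eq: "cones G = (\<lambda>x. closure (chamber G x)) ` {x. regular G x}"
proof -
  have "components (- \<Union>(hyperplanes G)) = chamber G ` {x. regular G x}"
    unfolding components_def using not_in_hyperplanes_iff connected_component_chamber
    by (intro image_cong) auto
  then show ?thesis by (simp add: cones_def image_image)
qed

lemma closure_chamber_subset: "closure (chamber G x) \<subseteq> {y. \<forall>a\<in>roots G. a \<bullet> x > 0 \<longrightarrow> a \<bullet> y \<ge> 0}"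
proof (rule closure_minimal)
  have "{y. \<forall>a\<in>roots G. a \<bullet> x > 0 \<longrightarrow> a \<bullet> y \<ge> 0} = (\<Inter>a\<in>pos_roots G x. {y. a \<bullet> y \<ge> 0})"
    by (auto simp: pos_roots_def)
  then show "closed {y. \<forall>a\<in>roots G. a \<bullet> x > 0 \<longrightarrow> a \<bullet> y \<ge> 0}"
    by (simp add: closed_INT closed_halfspace_ge)
qed (auto simp: chamber_def less_imp_le)

lemma cones_bij:
  assumes c: "regular G c"
  shows "bij_betw (\<lambda>g. closure (chamber G (g c))) G (cones G)"
  unfolding bij_betw_def
proof
  show "inj_on (\<lambda>g. closure (chamber G (g c))) G"
  proof (rule inj_onI)
    fix g h assume gh: "g \<in> G" "h \<in> G" "closure (chamber G (g c)) = closure (chamber G (h c))"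
    then have "chamber G (g c) = chamber G (h c)" using interior_closure_chamber by metis
    then have m: "g c \<in> chamber G (h c)" using self_in_chamber by blast
    have gen: "regular G (h c)" using gh c generic_mem by blast
    have "g \<circ> ginv h = id"
    proof (rule chamber_free[OF gen])
      show "g \<circ> ginv h \<in> G" using gh comp_mem inv_mem by blast
      show "b \<bullet> (g \<circ> ginv h) (h c) > 0" if "b \<in> roots G" "b \<bullet> h c > 0" for b
        using m that gh by (simp add: chamber_def)
    qed
    then have "g (ginv h (h x)) = h x" for x by (metis comp_apply id_apply)
    then show "g = h" using gh by (simp add: fun_eq_iff)
  qed
  show "(\<lambda>g. closure (chamber G (g c))) ` G = cones G"
    unfolding cones_eq
  proof (intro equalityI subsetI)
    fix C assume "C \<in> (\<lambda>x. closure (chamber G x)) ` {x. regular G x}"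
    then obtain x where x: "regular G x" "C = closure (chamber G x)" by blast
    obtain g where g: "g \<in> G" "\<And>b. b \<in> roots G \<Longrightarrow> b \<bullet> x > 0 \<Longrightarrow> b \<bullet> g c > 0"
      using chamber_transitive[OF x(1) c] by blast
    then have "g c \<in> chamber G x" by (simp add: chamber_def)
    then have "C = closure (chamber G (g c))" using chamber_eq x by simp
    then show "C \<in> (\<lambda>g. closure (chamber G (g c))) ` G" using g by blast
  qed (use c generic_mem in auto)
qed

text \<open>The missing wall point is a sum over the other positive roots \<open>b\<close> of points
  of the facet on which \<open>b\<close> is positive. Such points exist, since a facet inside the
  hyperplanes of both \<open>a\<close> and \<open>b\<close> would have dimension at most n -
  2.\<close>

lemma wall_simple:
  assumes c: "regular G c" and s: "s \<in> simple_generators G (closure (chamber G c))"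
  obtains a where "a \<in> simple G c" "s = reflection a"
proof -
  let ?C = "closure (chamber G c)"
  obtain a0 where a0: "a0 \<in> roots G" "s = reflection a0" "(?C \<inter> hyp a0) facet_of ?C"
    using s by (auto simp: simple_generators_def walls_def)
  define a where "a = (if a0 \<bullet> c > 0 then a0 else - a0)"
  have a: "a \<in> roots G" "a \<bullet> c > 0"
    using a0 c roots_minus by (auto simp: a_def generic_def)
  have ra: "s = reflection a" and ha: "hyp a0 = hyp a" by (auto simp: a_def a0 hyp_def)
  have an: "norm a = 1" by (rule roots_norm[OF a(1)])
  have C: "b \<bullet> y \<ge> 0" if "y \<in> ?C" "b \<in> roots G" "b \<bullet> c > 0" for b y
    using closure_chamber_subset that by blast
  have dimC: "aff_dim (?C \<inter> hyp a) = DIM('v) - 1"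
  proof -
    have "aff_dim (chamber G c) = DIM('v)"
      using self_in_chamber[of c] by (intro aff_dim_open open_chamber) auto
    then show ?thesis using a0(3) by (simp add: facet_of_def ha)
  qed
  have ex: "\<exists>z\<in>?C \<inter> hyp a. b \<bullet> z > 0" if b: "b \<in> roots G" "b \<bullet> c > 0" "b \<noteq> a" for b
  proof (rule ccontr)
    assume "\<not> ?thesis"
    then have sub: "?C \<inter> hyp a \<subseteq> hyp a \<inter> {z. b \<bullet> z = 0}" using C b by (force simp: not_less intro: antisym)
    have "b \<noteq> - a" using a b by auto
    then obtain x where x: "a \<bullet> x = 0" "b \<bullet> x \<noteq> 0"
      using generic_on_hyperplane[of "{b}" a] an roots_norm[OF b(1)] b(3) by auto
    have "a \<bullet> a \<noteq> 0" using an by (simp add: dot_square_norm)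
    then have "DIM('v) = Suc (dim (hyp a))"
      using dim_Int_hyperplane[OF subspace_UNIV UNIV_I, of a a] by (simp add: hyp_def)
    moreover have "dim (hyp a) = Suc (dim (hyp a \<inter> {z. b \<bullet> z = 0}))"
      using x by (intro dim_Int_hyperplane) (auto simp: hyp_def subspace_hyperplane)
    moreover have "aff_dim (?C \<inter> hyp a) \<le> dim (hyp a \<inter> {z. b \<bullet> z = 0})"
      using aff_dim_subset[OF sub] by (simp add: aff_dim_subspace subspace_inter subspace_hyperplane hyp_def)
    ultimately show False using dimC by simp
  qed
  define B where "B = pos_roots G c - {a}"
  have "\<forall>b\<in>B. \<exists>z. z \<in> ?C \<inter> hyp a \<and> b \<bullet> z > 0" using ex by (auto simp: B_def pos_roots_def)
  then obtain z where z: "\<And>b. b \<in> B \<Longrightarrow> z b \<in> ?C \<inter> hyp a" "\<And>b. b \<in> B \<Longrightarrow> b \<bullet> z b > 0"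
    by metis
  define w where "w = (\<Sum>b\<in>B. z b)"
  have "a \<bullet> w = 0" using z(1) by (simp add: w_def inner_sum_right hyp_def)
  moreover have "b \<bullet> w > 0" if "b \<in> roots G" "b \<bullet> c > 0" "b \<noteq> a" for b
  proof -
    have "b \<in> B" using that by (simp add: B_def pos_roots_def)
    have "finite B" using finite_pos_roots by (simp add: B_def)
    then show ?thesis
      unfolding w_def inner_sum_right using \<open>b \<in> B\<close> z C that
      by (intro sum_pos2[of B b]) auto
  qed
  ultimately have "a \<in> simple G c" using a by (auto simp: simple_def)
  then show ?thesis using that ra by blast
qed

end

section \<open>The stabilizer of the all-ones vector\<close>

text \<open>The negative part \<open>m\<close> of a combination that represents \<open>v\<close> satisfies \<open>m \<bullet> m \<le> 0\<close>.\<close>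

lemma obtuse_dominant:
  fixes T :: "'v::euclidean_space set"
  assumes T: "finite T" "\<And>a b. a \<in> T \<Longrightarrow> b \<in> T \<Longrightarrow> a \<noteq> b \<Longrightarrow> a \<bullet> b \<le> 0"
    and v: "v \<in> span T" "\<And>a. a \<in> T \<Longrightarrow> a \<bullet> v \<ge> 0"
  obtains u where "\<And>a. u a \<ge> 0" "v = (\<Sum>a\<in>T. u a *\<^sub>R a)"
proof -
  obtain x where x: "v = (\<Sum>a\<in>T. x a *\<^sub>R a)" using v(1) span_finite[OF T(1)] by auto
  define p where "p = (\<Sum>a\<in>T. max (x a) 0 *\<^sub>R a)"
  define m where "m = (\<Sum>a\<in>T. max (- x a) 0 *\<^sub>R a)"
  have vpm: "v = p - m"
    unfolding x p_def m_def sum_subtractf[symmetric] scaleR_left_diff_distrib[symmetric]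
    by (intro sum.cong refl) (auto simp: max_def)
  have "m \<bullet> v \<ge> 0"
    unfolding m_def inner_sum_left using v(2) by (intro sum_nonneg) auto
  moreover have "m \<bullet> p \<le> 0"
  proof -
    have nonpos: "max (x b) 0 * (max (- x a) 0 * (a \<bullet> b)) \<le> 0" if "a \<in> T" "b \<in> T" for a b
    proof (cases "a = b")
      case False
      then have "a \<bullet> b \<le> 0" using T(2) that by blast
      then show ?thesis by (intro mult_nonneg_nonpos) auto
    qed (auto simp: max_def)
    show ?thesis
      unfolding m_def p_def inner_sum_left inner_sum_right inner_scaleR_left inner_scaleR_right sum_distrib_left
      by (intro sum_nonpos) (rule nonpos, assumption+)
  qed
  ultimately have "m \<bullet> m \<le> 0" by (simp add: vpm inner_diff_right)
  then have "m = 0" by (metis inner_eq_zero_iff inner_ge_zero order_antisym)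
  then show ?thesis using that[of "\<lambda>a. max (x a) 0"] vpm by (simp add: p_def)
qed

lemma fixed_coordinate_permutations:
  fixes x :: "real^'n::finite"
  assumes "\<And>g. g \<in> coordinate_permutations \<Longrightarrow> g x = x"
  shows "\<exists>l. x = l *\<^sub>R \<j>"
proof -
  have "x $ i = x $ k" for i k
  proof -
    have "bij (Transposition.transpose i k)" by simp
    then have "coord_perm (Transposition.transpose i k) \<in> coordinate_permutations" by (auto simp: coordinate_permutations_eq)
    then have "coord_perm (Transposition.transpose i k) x = x" by (rule assms)
    then have "coord_perm (Transposition.transpose i k) x $ i = x $ i" by simp
    then show ?thesis by (simp add: coord_perm_def)
  qed
  then have "x = (x $ k) *\<^sub>R \<j>" for k by (simp add: vec_eq_iff all_ones_def)
  then show ?thesis by blast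
qed

lemma coordinate_permutations_fix_ones: "g \<in> coordinate_permutations \<Longrightarrow> g \<j> = \<j>"
  by (auto simp: coordinate_permutations_def all_ones_def)

lemma ones_inner_self: "(\<j> :: real^'n::finite) \<bullet> \<j> = CARD('n)"
  by (simp add: inner_vec_def all_ones_def)

lemma ones_nonzero: "(\<j> :: real^'n::finite) \<noteq> 0"
  by (simp add: vec_eq_iff all_ones_def)

text \<open>Write c = l j + v with v orthogonal to \<open>\<j>\<close>. The vectors orthogonal to
  the simple roots \<open>T\<close> of the parabolic form the line of \<open>\<j>\<close>, so v lies
  in the span of \<open>T\<close>; being dominant for \<open>T\<close>, it is a nonnegative
  combination of \<open>T\<close>. Simple roots outside \<open>T\<close> are therefore nonpositive
  on v, and positive on l j because they are positive on c. Thus l j is dominant with exactly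
  \<open>T\<close> vanishing on it, and \<open>stab_dominant\<close> identifies its
  stabilizer.\<close>

lemma stab_all_ones:
  fixes G :: "(real^'n::finite \<Rightarrow> real^'n) set"
  assumes G: "refl_group G" and ess: "essential G" and C: "C \<in> cones G"
    and par: "standard_parabolic G C coordinate_permutations"
  shows "stab G \<j> = coordinate_permutations"
proof -
  interpret refl_group G by (rule G)
  let ?P = "coordinate_permutations :: (real^'n \<Rightarrow> real^'n) set"
  obtain c where c: "regular G c" "C = closure (chamber G c)"
    using C by (auto simp: cones_eq)
  let ?S = "simple G c"
  obtain J where J: "J \<subseteq> simple_generators G C" "?P = generate (BijGroup UNIV) J"
    using par by (auto simp: standard_parabolic_def)
  define T where "T = {a \<in> ?S. reflection a \<in> J}"
  have "J \<subseteq> reflection ` T"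
  proof
    fix s assume s: "s \<in> J"
    then obtain a where "a \<in> ?S" "s = reflection a"
      using wall_simple[OF c(1)] J(1) c(2) by blast
    then show "s \<in> reflection ` T" using s by (auto simp: T_def)
  qed
  then have "J = reflection ` T" by (auto simp: T_def)
  then have P: "?P = refl_prod ` lists T" using J(2) by (simp only: generate_reflections)
  have TS: "T \<subseteq> ?S" by (auto simp: T_def)
  then have TR: "T \<subseteq> roots G" using simple_subset by blast
  have finT: "finite T" using TR finite_roots_group finite_subset by blast
  have refl_T: "reflection a \<in> ?P" if "a \<in> T" for a
    unfolding P using that by (intro image_eqI[of _ _ "[a]"]) auto
  have Tj: "a \<bullet> \<j> = 0" if "a \<in> T" for a
    using coordinate_permutations_fix_ones[OF refl_T[OF that]] roots_nz[of a G] TR that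
    by (auto simp: reflection_fixes_iff)
  have orth: "\<exists>l. x = l *\<^sub>R \<j>" if x: "\<And>a. a \<in> T \<Longrightarrow> a \<bullet> x = 0" for x
  proof (rule fixed_coordinate_permutations)
    fix g assume "g \<in> ?P"
    then obtain as where as: "set as \<subseteq> T" "g = refl_prod as" unfolding P by auto
    have "refl_prod as x = x" using as(1)
    proof (induction as)
      case (Cons a as)
      then have "a \<noteq> 0" using roots_nz[of a G] TR by auto
      then show ?case using Cons x by (simp add: reflection_fixes_iff)
    qed simp
    then show "g x = x" using as by simp
  qed
  define l where "l = (c \<bullet> \<j>) / CARD('n)"
  define v where "v = c - l *\<^sub>R \<j>"
  have vj: "v \<bullet> \<j> = 0" by (simp add: v_def l_def inner_diff_left ones_inner_self)
  obtain y z where yz: "y \<in> span T" "\<And>w. w \<in> span T \<Longrightarrow> orthogonal z w" "v = y + z"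
    using orthogonal_subspace_decomp_exists[of T v] by blast
  have "y \<bullet> \<j> = 0"
    using yz(1) by (induction rule: span_induct) (auto simp: Tj subspace_def inner_add_left)
  moreover have "a \<bullet> z = 0" if "a \<in> T" for a
    using yz(2)[OF span_base[OF that]] by (simp add: orthogonal_def inner_commute)
  then obtain k where k: "z = k *\<^sub>R \<j>" using orth by blast
  ultimately have "k = 0" using vj yz(3) by (simp add: inner_add_left ones_inner_self)
  then have v_span: "v \<in> span T" using yz(1,3) k by simp
  have v_pos: "a \<bullet> v \<ge> 0" if "a \<in> T" for a
    using that TS Tj by (auto simp: v_def inner_diff_right simple_def)
  have T_obtuse: "a \<bullet> b \<le> 0" if "a \<in> T" "b \<in> T" "a \<noteq> b" for a b
    using simple_obtuse[OF c(1)] that TS by blast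
  obtain u where u: "\<And>a. u a \<ge> 0" "v = (\<Sum>a\<in>T. u a *\<^sub>R a)"
    by (rule obtuse_dominant[OF finT T_obtuse v_span v_pos]) (assumption+, rule that)
  have T0: "b \<bullet> (l *\<^sub>R \<j>) = 0" if "b \<in> T" for b using Tj[OF that] by simp
  have S_pos: "b \<bullet> (l *\<^sub>R \<j>) > 0" if b: "b \<in> ?S" "b \<notin> T" for b
  proof -
    have "b \<bullet> v \<le> 0"
      unfolding u(2) inner_sum_right
    proof (rule sum_nonpos)
      fix a assume a: "a \<in> T"
      then have "b \<bullet> a \<le> 0" using simple_obtuse[OF c(1)] b TS by blast
      then show "b \<bullet> u a *\<^sub>R a \<le> 0" using u(1)[of a] by (simp add: mult_nonneg_nonpos)
    qed
    moreover have "b \<bullet> c > 0" using b by (simp add: simple_def)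
    ultimately show ?thesis by (simp add: v_def inner_diff_right)
  qed
  have "b \<bullet> (l *\<^sub>R \<j>) \<ge> 0" if "b \<in> roots G" "b \<bullet> c > 0" for b
  proof (rule simple_nonneg_imp_nonneg[OF c(1) _ that])
    fix a assume "a \<in> ?S"
    then show "a \<bullet> (l *\<^sub>R \<j>) \<ge> 0" using T0[of a] S_pos[of a] by linarith
  qed
  from stab_dominant[OF c(1) this]
  have st: "stab G (l *\<^sub>R \<j>) = refl_prod ` lists {a \<in> ?S. a \<bullet> (l *\<^sub>R \<j>) = 0}" .
  have "{a \<in> ?S. a \<bullet> (l *\<^sub>R \<j>) = 0} = T"
    using T0 S_pos TS by force
  then have st: "stab G (l *\<^sub>R \<j>) = ?P" using st P by simp
  \<comment> \<open>For l = 0 the symmetric group would be all of \<open>G\<close>, and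
    \<open>\<j>\<close> a nonzero fixed vector.\<close>
  have "l \<noteq> 0"
  proof
    assume "l = 0"
    then have "stab G 0 = ?P" using st by simp
    then have "G = ?P" using stab_eq_iff[of 0] by simp
    then have "\<forall>g\<in>G. g \<j> = \<j>" using coordinate_permutations_fix_ones by blast
    then show False using ess ones_nonzero by (auto simp: essential_def)
  qed
  \<comment> \<open>By linearity the scalar, whatever its sign, does not affect the
    stabilizer.\<close>
  have "stab G (l *\<^sub>R \<j>) = stab G \<j>"
    using \<open>l \<noteq> 0\<close> by (auto simp: stab_def linear_cmul[OF linear_mem])
  then show ?thesis using st by simp
qed

section \<open>Counting cones\<close>

context
  fixes G :: "(real^'n::finite \<Rightarrow> real^'n) set"
  assumes G: "refl_group G"
begin

interpretation refl_group G by (rule G)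

text \<open>With \<open>y = z + \<theta> \<j>\<close>, the boundary value minus
  \<open>\<theta>\<close> is (a . z) / (a . j). It is negative exactly when the hyperplane separates
  \<open>z\<close> from \<open>\<j>\<close>, and one normal of each such hyperplane is positive at
  \<open>z\<close>.\<close>

lemma live_separating_eq:
  assumes z: "y - \<theta> *\<^sub>R \<j> = z"
  shows "{H \<in> live_hyperplanes G. \<exists>a\<in>roots G. H = hyp a \<and> (a \<bullet> y) / (a \<bullet> \<j>) < \<theta>} =
    hyp ` {a \<in> roots G. a \<bullet> z > 0 \<and> a \<bullet> \<j> < 0}"
proof -
  have iff: "(a \<bullet> y) / (a \<bullet> \<j>) < \<theta> \<longleftrightarrow> (a \<bullet> z > 0 \<and> a \<bullet> \<j> < 0) \<or> (- a \<bullet> z > 0 \<and> - a \<bullet> \<j> < 0)" if "a \<bullet> \<j> \<noteq> 0" for a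
  proof -
    have "a \<bullet> y = a \<bullet> z + \<theta> * (a \<bullet> \<j>)" by (simp add: z[symmetric] inner_diff_right)
    then have "(a \<bullet> y) / (a \<bullet> \<j>) = (a \<bullet> z) / (a \<bullet> \<j>) + \<theta>" using that by (simp add: add_divide_distrib)
    then show ?thesis using that by (auto simp: divide_less_0_iff)
  qed
  have live: "hyp a \<in> live_hyperplanes G \<longleftrightarrow> a \<bullet> \<j> \<noteq> 0" if a: "a \<in> roots G" for a
  proof
    assume "hyp a \<in> live_hyperplanes G"
    then obtain b where "b \<in> roots G" "hyp a = hyp b" "b \<bullet> \<j> \<noteq> 0" by (auto simp: live_hyperplanes_def)
    then show "a \<bullet> \<j> \<noteq> 0" using hyp_eq_iff[of a b] a roots_norm[of _ G] by auto
  qed (use a in \<open>auto simp: live_hyperplanes_def\<close>)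
  have hm: "hyp (- a) = hyp a" for a :: "real^'n" by (auto simp: hyp_def)
  show ?thesis
  proof (intro Set.set_eqI iffI)
    fix H assume "H \<in> {H \<in> live_hyperplanes G. \<exists>a\<in>roots G. H = hyp a \<and> (a \<bullet> y) / (a \<bullet> \<j>) < \<theta>}"
    then obtain a where a: "a \<in> roots G" "H = hyp a" "(a \<bullet> y) / (a \<bullet> \<j>) < \<theta>" "a \<bullet> \<j> \<noteq> 0"
      using live by blast
    then consider "a \<bullet> z > 0 \<and> a \<bullet> \<j> < 0" | "- a \<bullet> z > 0 \<and> - a \<bullet> \<j> < 0" using iff by blast
    then show "H \<in> hyp ` {a \<in> roots G. a \<bullet> z > 0 \<and> a \<bullet> \<j> < 0}"
    proof cases
      case 2
      then show ?thesis using a roots_minus by (intro image_eqI[of _ _ "- a"]) (auto simp: hm)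
    qed (use a in blast)
  next
    fix H assume "H \<in> hyp ` {a \<in> roots G. a \<bullet> z > 0 \<and> a \<bullet> \<j> < 0}"
    then obtain a where a: "H = hyp a" "a \<in> roots G" "a \<bullet> z > 0" "a \<bullet> \<j> < 0" by blast
    then have "H \<in> live_hyperplanes G" "(a \<bullet> y) / (a \<bullet> \<j>) < \<theta>" using live iff by auto
    then show "H \<in> {H \<in> live_hyperplanes G. \<exists>a\<in>roots G. H = hyp a \<and> (a \<bullet> y) / (a \<bullet> \<j>) < \<theta>}" using a by blast
  qed
qed

lemma inj_on_hyp: "inj_on hyp {a \<in> roots G. a \<bullet> z > 0 \<and> a \<bullet> x < 0}"
proof (rule inj_onI)
  fix a b assume ab: "a \<in> {a \<in> roots G. a \<bullet> z > 0 \<and> a \<bullet> x < 0}" "b \<in> {a \<in> roots G. a \<bullet> z > 0 \<and> a \<bullet> x < 0}" "hyp a = hyp b"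
  then show "a = b" using hyp_eq_iff[of a b] roots_norm[of _ G] by auto
qed

lemma yields_iff:
  assumes x: "regular G x"
  shows "yields G (closure (chamber G x)) k \<longleftrightarrow> sep G x \<j> = k"
proof -
  have card: "card {H \<in> live_hyperplanes G. \<exists>a\<in>roots G. H = hyp a \<and> (a \<bullet> y) / (a \<bullet> \<j>) < \<theta>} = sep G x \<j>"
    if "y - \<theta> *\<^sub>R \<j> \<in> chamber G x" for y \<theta>
  proof -
    have "sep G x \<j> = sep G (y - \<theta> *\<^sub>R \<j>) \<j>"
      by (rule sep_cong) (use chamber_sides[OF x that] in auto)
    then show ?thesis
      by (simp add: live_separating_eq[OF refl] card_image[OF inj_on_hyp] sep_def)
  qed
  show ?thesis
    unfolding yields_def interior_closure_chamber
  proof (intro iffI allI impI)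
    assume "\<forall>y \<theta>. y - \<theta> *\<^sub>R \<j> \<in> chamber G x \<longrightarrow>
      card {H \<in> live_hyperplanes G. \<exists>a\<in>roots G. H = hyp a \<and> (a \<bullet> y) / (a \<bullet> \<j>) < \<theta>} = k"
    \<comment> \<open>The point \<open>x\<close> itself, with parameter 0, shows that the condition
      defining \<open>yields\<close> is not vacuous.\<close>
    from this[rule_format, of x 0] card[of x 0] show "sep G x \<j> = k"
      using self_in_chamber by simp
  qed (simp only: card)
qed

text \<open>Guarantees that the summation range of the generating function covers every
  cone.\<close>

lemma sep_less_num_intervals: "sep G x \<j> < num_intervals G"
proof -
  have "live_hyperplanes G = hyp ` {a \<in> roots G. a \<bullet> \<j> \<noteq> 0}" by (auto simp: live_hyperplanes_def)
  then have fin: "finite (live_hyperplanes G)" using finite_roots_group by simp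
  have "sep G x \<j> = card (hyp ` {a \<in> roots G. a \<bullet> x > 0 \<and> a \<bullet> \<j> < 0})"
    by (simp add: sep_def card_image[OF inj_on_hyp])
  also have "\<dots> \<le> card (live_hyperplanes G)"
    by (rule card_mono[OF fin]) (auto simp: live_hyperplanes_def)
  finally show ?thesis by (simp add: num_intervals_def)
qed

text \<open>Cones correspond to group elements, and the sum over the group is sorted by the number
  of hyperplanes separating the cone from \<open>\<j>\<close>.\<close>

lemma net_gen_fun_eq: "of_nat (fact CARD('n)) * net_gen_fun G = dist_series G \<j>"
proof -
  obtain c where c: "regular G c" using generic_exists by blast
  let ?s = "\<lambda>g. sep G (g c) \<j>"
  have gen: "regular G (g c)" if "g \<in> G" for g using that c generic_mem by blast
  have num: "num_cones G k = card {g \<in> G. ?s g = k}" for k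
  proof -
    let ?c = "\<lambda>g. closure (chamber G (g c))"
    have inj: "inj_on ?c G" and img: "cones G = ?c ` G"
      using cones_bij[OF c] by (auto simp: bij_betw_def)
    have "{C \<in> cones G. yields G C k} = ?c ` {g \<in> G. ?s g = k}"
      unfolding img using yields_iff[OF gen] by blast
    moreover have "inj_on ?c {g \<in> G. ?s g = k}" using inj by (rule inj_on_subset) blast
    ultimately have "bij_betw ?c {g \<in> G. ?s g = k} {C \<in> cones G. yields G C k}"
      by (simp add: bij_betw_def)
    then show ?thesis unfolding num_cones_def by (rule bij_betw_same_card[symmetric])
  qed
  have "dist_series G \<j> = (\<Sum>g\<in>G. fps_X ^ ?s g)" by (rule dist_series_eq[OF c])
  also have "\<dots> = (\<Sum>k = 0..num_intervals G - 1. \<Sum>g\<in>{g \<in> G. ?s g = k}. fps_X ^ ?s g)"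
  proof (rule sum.group[symmetric, OF finite_group])
    have "?s g \<le> num_intervals G - 1" for g using sep_less_num_intervals[of "g c"] by linarith
    then show "?s ` G \<subseteq> {0..num_intervals G - 1}" by auto
  qed simp
  also have "\<dots> = (\<Sum>k = 0..num_intervals G - 1. of_nat (num_cones G k) * fps_X ^ k)"
    by (intro sum.cong refl) (simp add: num)
  also have "\<dots> = of_nat (fact CARD('n)) * net_gen_fun G"
    unfolding net_gen_fun_def sum_distrib_left
    by (intro sum.cong refl) (simp add: fps_of_nat[symmetric] mult.assoc[symmetric])
  finally show ?thesis ..
qed

end

theorem theorem4p2:
  fixes G :: "(real^'n \<Rightarrow> real^'n) set"
    and C\<^sub>e :: "(real^'n) set"
    and f :: "'m::finite \<Rightarrow> real^'n \<Rightarrow> real"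
    and d :: "'m \<Rightarrow> nat"
  assumes "finite_reflection_group G"
    and "essential G"
    and "C\<^sub>e \<in> cones G"
    and "irreducible_group G C\<^sub>e"
    and "\<not> type_F4 G C\<^sub>e"
    and "standard_parabolic G C\<^sub>e coordinate_permutations"
    and "basic_invariants G f d"
  shows "net_gen_fun G =
    (\<Prod>j\<in>UNIV. 1 - fps_X ^ d j) / (\<Prod>i = 1..CARD('n). 1 - fps_X ^ i)"
proof -
  have G: "refl_group G" by unfold_locales (rule assms(1))
  interpret refl_group G by (rule G)
  let ?P = "coordinate_permutations :: (real^'n \<Rightarrow> real^'n) set"
  let ?d = "\<Prod>j\<in>UNIV. 1 - fps_X ^ d j :: real fps" and ?e = "\<Prod>i = 1..CARD('n). 1 - fps_X ^ i :: real fps"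
  let ?n = "of_nat (fact CARD('n)) :: real fps"
  have st: "stab G \<j> = ?P" by (rule stab_all_ones[OF G assms(2,3,6)])
  have P: "refl_group ?P" unfolding st[symmetric] by unfold_locales (rule stab_frg)
  \<comment> \<open>The order of the stabilizer is n!, the same factor by which the numbers of cones
    are divided.\<close>
  have dist: "dist_series G \<j> * poincare ?P = ?n * poincare G"
    using dist_series_stab[of \<j>] by (simp add: st card_coordinate_permutations)
  \<comment> \<open>Solomon's formula is inserted for \<open>S_n\<close> as a factor 1 and then
    removed for \<open>G\<close>, which trades the quotient of Poincare polynomials for one of
    Hilbert series.\<close>
  have "?n * (net_gen_fun G * hilbert G) = dist_series G \<j> * hilbert G"
    by (simp only: net_gen_fun_eq[OF G, symmetric] mult_ac)
  also have "\<dots> = dist_series G \<j> * hilbert G * (poincare ?P * hilbert ?P * (1 - fps_X) ^ CARD('n))"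
    by (simp only: solomon[OF P] mult_1_right)
  also have "\<dots> = (dist_series G \<j> * poincare ?P) * hilbert G * hilbert ?P * (1 - fps_X) ^ CARD('n)"
    by (simp only: mult_ac)
  also have "\<dots> = ?n * hilbert ?P * (poincare G * hilbert G * (1 - fps_X) ^ CARD('n))"
    unfolding dist by (simp only: mult_ac)
  also have "\<dots> = ?n * hilbert ?P"
    by (simp only: solomon[OF G] mult_1_right)
  finally have "net_gen_fun G * hilbert G = hilbert ?P" by simp
  then have "net_gen_fun G * ?e * (hilbert G * ?d) = hilbert ?P * ?e * ?d"
    by (metis (no_types, lifting) mult.assoc mult.commute)
  then have eq: "net_gen_fun G * ?e = ?d"
    unfolding hilbert_basic_invariants[OF assms(7)] hilbert_coordinate_permutations by simp
  \<comment> \<open>The division of power series in the conclusion cancels only a nonzero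
    denominator.\<close>
  have "?e \<noteq> 0" using hilbert_coordinate_permutations[where 'n = 'n] by (metis mult_zero_right zero_neq_one)
  then show ?thesis unfolding eq[symmetric] by simp
qed

end
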